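(* Let $M$ be a quasi-$A$-generated finite-above $E$-unitary inverse monoid with $A\subseteq\max M^-$, put $G=M/\sigma$, and let $\mathbf{U}$ be a group variety. The following statements are equivalent. (1) $M$ has an $F$-inverse cover via the group variety $\mathbf{U}$. (2) There exists a canonical dual premorphism $G^{\mathbf U}\to M$. (3) There exists a canonical dual premorphism $G^{\mathbf U}\to \mathcal{X}_{\mathrm{cl}}(\Gamma^I)/G$. (4) There exists a canonical dual premorphism $F_{g\mathbf U}(\Gamma)\to \mathcal{X}_{\mathrm{cl}}(\Gamma^I)$. (5) For any arrow $x$ in $F_{g\mathbf U}(\Gamma)$ and for any $n\in\mathbb{N}_0$, the graph $P^{\mathrm{cl}}_n(x)$ contains the terminal vertex $\tau x$ of $x$.
   Context: Maps are written on the right. In an inverse monoid $M$: $E$ is the set of idempotents, $a\le b$ iff $a=eb$ for some $e\in E$ (natural partial order), $\sigma$ is the least group congruence, $M$ is $E$-unitary if every element above an idempotent is idempotent, and $M$ is finite-above if $\{n\in M:n\ge m\}$ is finite for every $m\in M$. $\max M^-$ is the set of elements of $M$ other than $1$ that are maximal for $\le$. $M$ is quasi-$A$-generated if a map $\epsilon_M\colon A\to M$ is given such that $A\epsilon_M\cup E$ generates $M$ as an inverse monoid; if $A\subseteq M$, $\epsilon_M$ is the inclusion. A group is $A$-generated if it is given with a map from $A$ whose image generates it; $G=M/\sigma$ is $A$-generated by $a\mapsto a\sigma$. $F$-inverse covers. An inverse monoid is $F$-inverse if each $\sigma$-class has a greatest element. An $F$-inverse cover of $M$ is an $F$-inverse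 monoid $F$ with a surjective idempotent-separating homomorphism $F\to M$; it induces a surjective homomorphism $F/\sigma\to M/\sigma$ with kernel $N$, say, and $F$ is called an $F$-inverse cover via a class $\mathbf{D}$ of groups if $N\in\mathbf{D}$. Graphs. Graphs are directed; $\iota e,\tau e$ are the initial and terminal vertices of an edge (or arrow) $e$. A path on $\overline\Delta$ is a (possibly empty) path in $\Delta$ in which edges may be traversed forwards or backwards; $\langle p\rangle$ is the subgraph of $\Delta$ of all vertices and edges traversed by $p$ in either direction. Connectedness refers to the underlying undirected graph. A category is viewed as a graph (objects = vertices, arrows = edges) with composition written left to right. An inverse category is a category in which each arrow $e\in\mathcal X(i,j)$ has a unique $f=e^{-1}\in\mathcal X(j,i)$ with $efe=e$, $fef=f$; its natural partial order is $e\le f$ iff $e=fh$ for an idempotent arrow $h$. Inverse monoids are the one-object inverse categories. For a graph $\Delta$, an inverse category $\mathcal X$ is quasi-$\Delta$-generated if a graph morphism $\epsilon_{\mathcal X}\colon\Delta\to\mathcal X$ is given such that $\Delta\epsilon_{\mathcal X}$ together with all idempotent arrows generates $\mathcal X$. A dual premorphism $\psi\colon\mathcal Y\to\mathcal X$ of inverse categories is a graph morphism with $1_i\psi=1_{i\psi}$, $(e^{-1})\psi=(e\psi)^{-1}$ and $(ef)\psi\ge e\psi\cdot f\psi$ for all objects $i$ and consecutive arrows $e,f$; if both are quasi-$\Delta$-generated it is canonical if $\epsilon_{\mathcal Y}\psi=\epsilon_{\mathcal X}$. For inverse monoids, $\Delta$ is replaced by the set $A$. The graphs $\Gamma,\Gamma^I$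 and closure. Fix $I\subseteq E$ such that $A\cup I$ generates $M$. $\Gamma$ (resp. $\Gamma^I$) has vertex set $G$ and edges $(g,m,g\cdot m\sigma)$ with $g\in G$ and $m\in A$ (resp. $m\in A\cup I$); $\iota(g,m,h)=g$, $\tau(g,m,h)=h$. $\Gamma$ is the Cayley graph of $G$. $G$ acts on these graphs by left multiplication: ${}^{g}(h,m,k)=(gh,m,gk)$. For a path $p$ on $\overline{\Gamma^I}$, $\lambda(p)\in M$ is the product of the labels along $p$, an edge with label $m$ traversed backwards contributing $m^{-1}$ (empty path: $1$). For coterminal $p,q$ with $\langle p\rangle=\langle q\rangle$ one has $\lambda(p)=\lambda(q)$, so for a finite connected subgraph $\mathrm X$ of $\Gamma^I$ and vertices $i,j$ of $\mathrm X$ one defines $\lambda_{(i,j)}(\mathrm X)=\lambda(p)$ for any $(i,j)$-path $p$ with $\langle p\rangle=\mathrm X$. For finite connected $\mathrm X$, $\mathrm X^{\mathrm{cl}}$ is the union of all finite connected subgraphs $\mathrm Y$ of $\Gamma^I$ with $i,j\in V_{\mathrm Y}$ and $\lambda_{(i,j)}(\mathrm Y)\ge\lambda_{(i,j)}(\mathrm X)$ (independent of $i,j\in V_{\mathrm X}$); for an arbitrary subgraph, $\mathrm X^{\mathrm{cl}}$ is the union of all $\mathrm Y^{\mathrm{cl}}$, $\mathrm Y$ a finite connected subgraph of $\mathrm X$. This is a closure operator on subgraphs of $\Gamma^I$. For subgraphs, $\bigvee_j\mathrm X_j=(\bigcup_j\mathrm X_j)^{\mathrm{cl}}$. Write $\langle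 p\rangle^{\mathrm{cl}}$ for $(\langle p\rangle)^{\mathrm{cl}}$, and $e^{\mathrm{cl}}$ for the closure of the subgraph spanned by an edge $e$. $\mathrm{ClSub}_{\mathrm{fc}}(\Gamma^I)$ is the set of closures of finite connected subgraphs of $\Gamma^I$. The category $\mathcal{X}_{\mathrm{cl}}(\Gamma^I)$ has object set $G$, $(i,j)$-arrows the triples $(i,\mathrm X,j)$ with $\mathrm X\in\mathrm{ClSub}_{\mathrm{fc}}(\Gamma^I)$, $i,j\in V_{\mathrm X}$, and product $(i,\mathrm X,j)(j,\mathrm Y,k)=(i,\mathrm X\vee\mathrm Y,k)$. It is an inverse category, quasi-$\Gamma$-generated by $e\mapsto(\iota e,e^{\mathrm{cl}},\tau e)$. $\mathcal{X}_{\mathrm{cl}}(\Gamma^I)/G$ is the inverse monoid of pairs $(\mathrm X,g)$ with $\mathrm X\in\mathrm{ClSub}_{\mathrm{fc}}(\Gamma^I)$, $1,g\in V_{\mathrm X}$, and product $(\mathrm X,g)(\mathrm Y,h)=(\mathrm X\vee{}^{g}\mathrm Y,gh)$, quasi-$A$-generated by $a\mapsto(e_a^{\mathrm{cl}},a\sigma)$ where $e_a=(1,a,a\sigma)$. The category $F_{g\mathbf U}(\Gamma)$. Let $F_{\mathbf U}(E_\Gamma)$ be the relatively free group of $\mathbf U$ on the edge set $E_\Gamma$ of $\Gamma$; for a path $p$ on $\overline\Gamma$, $[p]_{\mathbf U}$ is the product of its edges there, edges traversed backwards contributing inverses. $F_{g\mathbf U}(\Gamma)$ has object set $G$, arrows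 $(i,[p]_{\mathbf U},j)$ with $p$ an $(i,j)$-path on $\overline\Gamma$, product $(i,[p]_{\mathbf U},j)(j,[q]_{\mathbf U},k)=(i,[pq]_{\mathbf U},k)$; it is a groupoid, $\Gamma$-generated by $e\mapsto(\iota e,[e]_{\mathbf U},\tau e)$. $G^{\mathbf U}=F_{g\mathbf U}(\Gamma)/G$ is the subgroup of $F_{\mathbf U}(E_\Gamma)\rtimes G$ (action induced by the action on $\Gamma$) of all pairs $([p]_{\mathbf U},g)$ with $p$ a $(1,g)$-path on $\overline\Gamma$; it is $A$-generated by $a\mapsto([e_a]_{\mathbf U},a\sigma)$. The graphs $P^{\mathrm{cl}}_n(x)$. For an arrow $x$ of $F_{g\mathbf U}(\Gamma)$ let $C^{\mathrm{cl}}_0(x)$ be the intersection of all $\langle p\rangle^{\mathrm{cl}}$, $p$ a $(\iota x,\tau x)$-path on $\overline\Gamma$ with $x=(\iota x,[p]_{\mathbf U},\tau x)$. For $n\ge0$, $P^{\mathrm{cl}}_n(x)$ is the connected component of $C^{\mathrm{cl}}_n(x)$ containing $\iota x$, and $C^{\mathrm{cl}}_{n+1}(x)$ is the intersection of all $P^{\mathrm{cl}}_n(x_1)\vee\cdots\vee P^{\mathrm{cl}}_n(x_k)$ over all $k\ge1$ and all consecutive arrows $x_1,\dots,x_k$ with $x=x_1\cdots x_k$. *)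

theory Defs
  imports
    "HOL-Algebra.Coset"
    "HOL-Library.Product_Order"
    "Graph_Theory.Digraph_Component"
begin

section \<open>Inverse monoids\<close>

definition inverse_monoid :: "('a, 'b) monoid_scheme \<Rightarrow> bool" where
  "inverse_monoid M \<longleftrightarrow> monoid M \<and>
     (\<forall>a\<in>carrier M. \<exists>!b. b \<in> carrier M \<and> a \<otimes>\<^bsub>M\<^esub> b \<otimes>\<^bsub>M\<^esub> a = a \<and> b \<otimes>\<^bsub>M\<^esub> a \<otimes>\<^bsub>M\<^esub> b = b)"

text \<open>The inverse in the sense of inverse monoids; the library's \<open>m_inv\<close> is the inverse of a unit.\<close>

definition vinv :: "('a, 'b) monoid_scheme \<Rightarrow> 'a \<Rightarrow> 'a" where
  "vinv M a = (THE b. b \<in> carrier M \<and> a \<otimes>\<^bsub>M\<^esub> b \<otimes>\<^bsub>M\<^esub> a = a \<and> b \<otimes>\<^bsub>M\<^esub> a \<otimes>\<^bsub>M\<^esub> b = b)"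

definition idem :: "('a, 'b) monoid_scheme \<Rightarrow> 'a set" where
  "idem M = {e \<in> carrier M. e \<otimes>\<^bsub>M\<^esub> e = e}"

definition nat_le :: "('a, 'b) monoid_scheme \<Rightarrow> 'a \<Rightarrow> 'a \<Rightarrow> bool" where
  "nat_le M a b \<longleftrightarrow> (\<exists>e\<in>idem M. a = e \<otimes>\<^bsub>M\<^esub> b)"

definition E_unitary :: "('a, 'b) monoid_scheme \<Rightarrow> bool" where
  "E_unitary M \<longleftrightarrow> (\<forall>e\<in>idem M. \<forall>m\<in>carrier M. nat_le M e m \<longrightarrow> m \<in> idem M)"

definition finite_above :: "('a, 'b) monoid_scheme \<Rightarrow> bool" where
  "finite_above M \<longleftrightarrow> (\<forall>m\<in>carrier M. finite {n \<in> carrier M. nat_le M m n})"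

definition max_minus :: "('a, 'b) monoid_scheme \<Rightarrow> 'a set" where
  "max_minus M = {m \<in> carrier M. m \<noteq> \<one>\<^bsub>M\<^esub> \<and> (\<forall>n\<in>carrier M. nat_le M m n \<longrightarrow> n = m)}"

inductive_set inv_gen :: "('a, 'b) monoid_scheme \<Rightarrow> 'a set \<Rightarrow> 'a set"
  for M :: "('a, 'b) monoid_scheme" and S :: "'a set" where
  one: "\<one>\<^bsub>M\<^esub> \<in> inv_gen M S"
| incl: "s \<in> S \<Longrightarrow> s \<in> inv_gen M S"
| mult: "a \<in> inv_gen M S \<Longrightarrow> b \<in> inv_gen M S \<Longrightarrow> a \<otimes>\<^bsub>M\<^esub> b \<in> inv_gen M S"
| inverse: "a \<in> inv_gen M S \<Longrightarrow> vinv M a \<in> inv_gen M S"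

definition quasi_generated :: "('a, 'b) monoid_scheme \<Rightarrow> 'a set \<Rightarrow> bool" where
  "quasi_generated M A \<longleftrightarrow> inv_gen M (A \<union> idem M) = carrier M"

definition quot_monoid :: "('a, 'b) monoid_scheme \<Rightarrow> ('a \<times> 'a) set \<Rightarrow> 'a set monoid" where
  "quot_monoid M \<rho> = \<lparr>carrier = carrier M // \<rho>,
     monoid.mult = (\<lambda>X Y. \<rho> `` {x \<otimes>\<^bsub>M\<^esub> y | x y. x \<in> X \<and> y \<in> Y}),
     one = \<rho> `` {\<one>\<^bsub>M\<^esub>}\<rparr>"

definition group_congruence :: "('a, 'b) monoid_scheme \<Rightarrow> ('a \<times> 'a) set \<Rightarrow> bool" where
  "group_congruence M \<rho> \<longleftrightarrow> equiv (carrier M) \<rho> \<and>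
     (\<forall>a b c d. (a, b) \<in> \<rho> \<and> (c, d) \<in> \<rho> \<longrightarrow> (a \<otimes>\<^bsub>M\<^esub> c, b \<otimes>\<^bsub>M\<^esub> d) \<in> \<rho>) \<and>
     group (quot_monoid M \<rho>)"

text \<open>On an inverse monoid the intersection of all group congruences is itself one.\<close>

definition sigma :: "('a, 'b) monoid_scheme \<Rightarrow> ('a \<times> 'a) set" where
  "sigma M = \<Inter>{\<rho>. group_congruence M \<rho>}"

abbreviation max_group :: "('a, 'b) monoid_scheme \<Rightarrow> 'a set monoid" where
  "max_group M \<equiv> quot_monoid M (sigma M)"

abbreviation sigma_class :: "('a, 'b) monoid_scheme \<Rightarrow> 'a \<Rightarrow> 'a set" where
  "sigma_class M m \<equiv> sigma M `` {m}"

definition dual_premorphism ::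
  "('a, 'c) monoid_scheme \<Rightarrow> ('b, 'd) monoid_scheme \<Rightarrow> ('a \<Rightarrow> 'b) \<Rightarrow> bool" where
  "dual_premorphism N M \<psi> \<longleftrightarrow> inverse_monoid N \<and> inverse_monoid M \<and>
     \<psi> \<in> carrier N \<rightarrow> carrier M \<and> \<psi> \<one>\<^bsub>N\<^esub> = \<one>\<^bsub>M\<^esub> \<and>
     (\<forall>e\<in>carrier N. \<psi> (vinv N e) = vinv M (\<psi> e)) \<and>
     (\<forall>e\<in>carrier N. \<forall>f\<in>carrier N. nat_le M (\<psi> e \<otimes>\<^bsub>M\<^esub> \<psi> f) (\<psi> (e \<otimes>\<^bsub>N\<^esub> f)))"

definition canonical_on :: "'s set \<Rightarrow> ('s \<Rightarrow> 'a) \<Rightarrow> ('s \<Rightarrow> 'b) \<Rightarrow> ('a \<Rightarrow> 'b) \<Rightarrow> bool" where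
  "canonical_on A \<epsilon>N \<epsilon>M \<psi> \<longleftrightarrow> (\<forall>a\<in>A. \<psi> (\<epsilon>N a) = \<epsilon>M a)"

section \<open>Group varieties and relatively free groups\<close>

text \<open>A word over \<open>'x\<close> is a list of signed letters, \<open>(x, False)\<close> standing for the inverse of
  \<open>x\<close>. A group variety is given by a set of laws in countably many variables \<open>0, 1, 2, \<dots>\<close>.\<close>

type_synonym 'x word = "('x \<times> bool) list"
type_synonym laws = "nat word set"

fun eval_word :: "('a, 'b) monoid_scheme \<Rightarrow> ('x \<Rightarrow> 'a) \<Rightarrow> 'x word \<Rightarrow> 'a" where
  "eval_word H f [] = \<one>\<^bsub>H\<^esub>"
| "eval_word H f ((x, b) # w) = (if b then f x else inv\<^bsub>H\<^esub> (f x)) \<otimes>\<^bsub>H\<^esub> eval_word H f w"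

definition in_variety :: "laws \<Rightarrow> ('a, 'b) monoid_scheme \<Rightarrow> bool" where
  "in_variety U H \<longleftrightarrow> group H \<and> (\<forall>w\<in>U. \<forall>f. range f \<subseteq> carrier H \<longrightarrow> eval_word H f w = \<one>\<^bsub>H\<^esub>)"

definition inv_word :: "'x word \<Rightarrow> 'x word" where
  "inv_word w = rev (map (\<lambda>(x, b). (x, \<not> b)) w)"

definition subst_word :: "('x \<Rightarrow> 'y word) \<Rightarrow> 'x word \<Rightarrow> 'y word" where
  "subst_word s w = concat (map (\<lambda>(x, b). if b then s x else inv_word (s x)) w)"

definition words :: "'x set \<Rightarrow> 'x word set" where
  "words X = lists (X \<times> UNIV)"

text \<open>The congruence on words over \<open>X\<close> generated by free cancellation and by all values of the
  laws of \<open>U\<close>; its quotient is the free group on \<open>X\<close> modulo the verbal subgroup of \<open>U\<close>,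
  i.e. the relatively free group of \<open>U\<close> on \<open>X\<close> (see the lemmas below).\<close>

inductive_set relfree_cong :: "laws \<Rightarrow> 'x set \<Rightarrow> ('x word \<times> 'x word) set"
  for U :: laws and X :: "'x set" where
  refl: "u \<in> words X \<Longrightarrow> (u, u) \<in> relfree_cong U X"
| sym: "(u, v) \<in> relfree_cong U X \<Longrightarrow> (v, u) \<in> relfree_cong U X"
| trans: "(u, v) \<in> relfree_cong U X \<Longrightarrow> (v, w) \<in> relfree_cong U X \<Longrightarrow> (u, w) \<in> relfree_cong U X"
| app: "(u, v) \<in> relfree_cong U X \<Longrightarrow> (u', v') \<in> relfree_cong U X \<Longrightarrow>
    (u @ u', v @ v') \<in> relfree_cong U X"
| cancel: "x \<in> X \<Longrightarrow> ([(x, b), (x, \<not> b)], []) \<in> relfree_cong U X"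
| law: "w \<in> U \<Longrightarrow> range s \<subseteq> words X \<Longrightarrow> (subst_word s w, []) \<in> relfree_cong U X"

definition word_monoid :: "'x set \<Rightarrow> 'x word monoid" where
  "word_monoid X = \<lparr>carrier = words X, monoid.mult = (@), one = []\<rparr>"

definition relfree :: "laws \<Rightarrow> 'x set \<Rightarrow> 'x word set monoid" where
  "relfree U X = quot_monoid (word_monoid X) (relfree_cong U X)"

abbreviation word_class :: "laws \<Rightarrow> 'x set \<Rightarrow> 'x word \<Rightarrow> 'x word set" where
  "word_class U X w \<equiv> relfree_cong U X `` {w}"

lemma words_simps [simp]:
  "[] \<in> words X" "u @ v \<in> words X \<longleftrightarrow> u \<in> words X \<and> v \<in> words X"
  "(x, b) # u \<in> words X \<longleftrightarrow> x \<in> X \<and> u \<in> words X" "inv_word u \<in> words X \<longleftrightarrow> u \<in> words X"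
  by (auto simp: words_def inv_word_def in_lists_conv_set)

lemma subst_word_in_words: "range s \<subseteq> words X \<Longrightarrow> subst_word s w \<in> words X"
  unfolding subst_word_def
  by (induction w) (auto simp: image_subset_iff)

lemma relfree_cong_words: "(u, v) \<in> relfree_cong U X \<Longrightarrow> u \<in> words X \<and> v \<in> words X"
  by (induction rule: relfree_cong.induct) (auto simp: subst_word_in_words)

lemma relfree_cong_equiv: "equiv (words X) (relfree_cong U X)"
proof (rule equivI)
  show "relfree_cong U X \<subseteq> words X \<times> words X" using relfree_cong_words by fast
  show "refl_on (words X) (relfree_cong U X)" by (auto simp: refl_on_def intro: relfree_cong.refl)
  show "sym (relfree_cong U X)" by (auto simp: sym_def intro: relfree_cong.sym)
  show "trans (relfree_cong U X)" by (auto simp: trans_def intro: relfree_cong.trans)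
qed

lemma relfree_carrier: "C \<in> carrier (relfree U X) \<longleftrightarrow> (\<exists>u\<in>words X. C = word_class U X u)"
  by (auto simp: relfree_def quot_monoid_def word_monoid_def quotient_def)

lemma relfree_one: "\<one>\<^bsub>relfree U X\<^esub> = word_class U X []"
  by (simp add: relfree_def quot_monoid_def word_monoid_def)

lemma word_class_eq_iff:
  "u \<in> words X \<Longrightarrow> v \<in> words X \<Longrightarrow>
     word_class U X u = word_class U X v \<longleftrightarrow> (u, v) \<in> relfree_cong U X"
  by (rule eq_equiv_class_iff[OF relfree_cong_equiv])

lemma relfree_mult:
  assumes "u \<in> words X" "v \<in> words X"
  shows "word_class U X u \<otimes>\<^bsub>relfree U X\<^esub> word_class U X v = word_class U X (u @ v)"
proof -
  have "word_class U X u \<otimes>\<^bsub>relfree U X\<^esub> word_class U X v =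
      relfree_cong U X `` {x @ y |x y. (u, x) \<in> relfree_cong U X \<and> (v, y) \<in> relfree_cong U X}"
    by (simp add: relfree_def quot_monoid_def word_monoid_def)
  also have "\<dots> = word_class U X (u @ v)"
  proof (intro equalityI subsetI)
    fix w assume "w \<in> relfree_cong U X ``
      {x @ y |x y. (u, x) \<in> relfree_cong U X \<and> (v, y) \<in> relfree_cong U X}"
    then obtain x y where "(u, x) \<in> relfree_cong U X" "(v, y) \<in> relfree_cong U X"
      "(x @ y, w) \<in> relfree_cong U X" by blast
    then show "w \<in> word_class U X (u @ v)"
      using relfree_cong.app relfree_cong.trans by blast
  next
    fix w assume "w \<in> word_class U X (u @ v)"
    then show "w \<in> relfree_cong U X ``
      {x @ y |x y. (u, x) \<in> relfree_cong U X \<and> (v, y) \<in> relfree_cong U X}"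
      using relfree_cong.refl[OF assms(1), of U] relfree_cong.refl[OF assms(2), of U] by blast
  qed
  finally show ?thesis .
qed

lemma relfree_cancel: "u \<in> words X \<Longrightarrow> (u @ inv_word u, []) \<in> relfree_cong U X"
proof (induction u)
  case Nil
  then show ?case by (simp add: inv_word_def relfree_cong.refl)
next
  case (Cons a u)
  obtain x b where a: "a = (x, b)" by fastforce
  have xu: "x \<in> X" "u \<in> words X" using Cons.prems a by auto
  have r: "([(x, c)], [(x, c)]) \<in> relfree_cong U X" for c
    using xu by (intro relfree_cong.refl) auto
  have "([(x, b)] @ (u @ inv_word u) @ [(x, \<not> b)], [(x, b)] @ [] @ [(x, \<not> b)]) \<in> relfree_cong U X"
    by (intro relfree_cong.app r Cons.IH xu)
  then show ?case
    using relfree_cong.cancel[OF xu(1), of b U] relfree_cong.trans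
    by (fastforce simp: a inv_word_def)
qed

lemma relfree_group: "group (relfree U X)"
proof (rule groupI)
  fix C assume "C \<in> carrier (relfree U X)"
  then obtain u where u: "u \<in> words X" "C = word_class U X u"
    by (auto simp: relfree_carrier)
  have "word_class U X (inv_word u) \<otimes>\<^bsub>relfree U X\<^esub> C = \<one>\<^bsub>relfree U X\<^esub>"
    using relfree_cancel[of "inv_word u" X U] u
    by (simp add: relfree_mult relfree_one word_class_eq_iff)
       (simp add: inv_word_def rev_map comp_def case_prod_beta)
  then show "\<exists>D\<in>carrier (relfree U X). D \<otimes>\<^bsub>relfree U X\<^esub> C = \<one>\<^bsub>relfree U X\<^esub>"
    using u by (intro bexI[of _ "word_class U X (inv_word u)"]) (auto simp: relfree_carrier)
next
  fix C D assume "C \<in> carrier (relfree U X)" "D \<in> carrier (relfree U X)"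
  then show "C \<otimes>\<^bsub>relfree U X\<^esub> D \<in> carrier (relfree U X)"
    by (metis relfree_carrier relfree_mult words_simps(2))
next
  show "\<one>\<^bsub>relfree U X\<^esub> \<in> carrier (relfree U X)"
    using relfree_carrier relfree_one words_simps(1) by blast
next
  fix C D E
  assume "C \<in> carrier (relfree U X)" "D \<in> carrier (relfree U X)" "E \<in> carrier (relfree U X)"
  then obtain u v w where "u \<in> words X" "C = word_class U X u" "v \<in> words X" "D = word_class U X v"
    "w \<in> words X" "E = word_class U X w" by (auto simp: relfree_carrier)
  then show "C \<otimes>\<^bsub>relfree U X\<^esub> D \<otimes>\<^bsub>relfree U X\<^esub> E =
      C \<otimes>\<^bsub>relfree U X\<^esub> (D \<otimes>\<^bsub>relfree U X\<^esub> E)"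
    by (simp add: relfree_mult)
next
  fix C assume "C \<in> carrier (relfree U X)"
  then obtain u where "u \<in> words X" "C = word_class U X u" by (auto simp: relfree_carrier)
  then show "\<one>\<^bsub>relfree U X\<^esub> \<otimes>\<^bsub>relfree U X\<^esub> C = C"
    by (simp add: relfree_one relfree_mult)
qed

lemma relfree_inv:
  assumes "u \<in> words X"
  shows "inv\<^bsub>relfree U X\<^esub> (word_class U X u) = word_class U X (inv_word u)"
proof -
  interpret group "relfree U X" by (rule relfree_group)
  have eq: "word_class U X u \<otimes>\<^bsub>relfree U X\<^esub> word_class U X (inv_word u) = \<one>\<^bsub>relfree U X\<^esub>"
    using assms by (simp add: relfree_mult relfree_one word_class_eq_iff relfree_cancel)
  have "word_class U X u \<in> carrier (relfree U X)" "word_class U X (inv_word u) \<in> carrier (relfree U X)"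
    using assms relfree_carrier words_simps(4) by blast+
  with eq show ?thesis
    by (metis inv_comm inv_equality)
qed

lemma relfree_in_variety:
  fixes X :: "'a set"
  shows "in_variety U (relfree U X)"
  unfolding in_variety_def
proof (intro conjI ballI allI impI)
  fix w and f :: "nat \<Rightarrow> 'a word set" assume w: "w \<in> U" and f: "range f \<subseteq> carrier (relfree U X)"
  have "\<exists>u. u \<in> words X \<and> f n = word_class U X u" for n
    using f relfree_carrier by fast
  then obtain s :: "nat \<Rightarrow> 'a word" where s: "\<And>n. s n \<in> words X" "\<And>n. f n = word_class U X (s n)" by metis
  have "eval_word (relfree U X) f v = word_class U X (subst_word s v)" for v
  proof (induction v)
    case (Cons a v)
    then show ?case using s subst_word_in_words[of s X v]
      by (cases a) (simp add: relfree_inv relfree_mult image_subset_iff, simp add: subst_word_def)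
  qed (simp add: relfree_one subst_word_def)
  moreover have "(subst_word s w, []) \<in> relfree_cong U X"
    using s w by (intro relfree_cong.law) auto
  ultimately show "eval_word (relfree U X) f w = \<one>\<^bsub>relfree U X\<^esub>"
    using relfree_cong_words[of "subst_word s w" "[]" U X] by (simp add: relfree_one word_class_eq_iff)
qed (rule relfree_group)

lemma eval_word_closed:
  assumes "group H" "f ` X \<subseteq> carrier H" "u \<in> words X"
  shows "eval_word H f u \<in> carrier H"
proof -
  interpret group H by fact
  show ?thesis using assms(2,3) by (induction u) (auto simp: image_subset_iff)
qed

lemma eval_word_append:
  assumes "group H" "f ` X \<subseteq> carrier H" "u \<in> words X" "v \<in> words X"
  shows "eval_word H f (u @ v) = eval_word H f u \<otimes>\<^bsub>H\<^esub> eval_word H f v"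
proof -
  interpret group H by fact
  show ?thesis using assms(3)
  proof (induction u)
    case (Cons a u)
    then show ?case using assms(2) eval_word_closed[OF assms(1,2)] assms(4)
      by (cases a) (auto simp: m_assoc image_subset_iff)
  qed (use eval_word_closed[OF assms(1,2,4)] in simp)
qed

lemma eval_word_inv_word:
  assumes "group H" "f ` X \<subseteq> carrier H" "u \<in> words X"
  shows "eval_word H f (inv_word u) = inv\<^bsub>H\<^esub> (eval_word H f u)"
proof -
  interpret group H by fact
  show ?thesis using assms(3)
  proof (induction u)
    case (Cons a u)
    obtain x b where a: "a = (x, b)" by fastforce
    have xu: "x \<in> X" "u \<in> words X" using Cons.prems a by auto
    have "eval_word H f (inv_word (a # u)) = eval_word H f (inv_word u @ [(x, \<not> b)])"
      by (simp add: a inv_word_def)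
    also have "\<dots> = inv\<^bsub>H\<^esub> (eval_word H f u) \<otimes>\<^bsub>H\<^esub> eval_word H f [(x, \<not> b)]"
      using eval_word_append[OF assms(1,2), of "inv_word u" "[(x, \<not> b)]"] xu Cons.IH by simp
    also have "\<dots> = inv\<^bsub>H\<^esub> (eval_word H f (a # u))"
      using assms(2) xu eval_word_closed[OF assms(1,2) xu(2)]
      by (auto simp: a inv_mult_group image_subset_iff)
    finally show ?case .
  qed (simp add: inv_word_def)
qed

text \<open>The universal property: every map from \<open>X\<close> into a group of the variety factors through
  \<open>relfree U X\<close>.\<close>

lemma relfree_universal:
  assumes H: "in_variety U H" and f: "f ` X \<subseteq> carrier H" and "(u, v) \<in> relfree_cong U X"
  shows "eval_word H f u = eval_word H f v"
proof -
  interpret group H using H by (simp add: in_variety_def)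
  have H': "group H" by unfold_locales
  show ?thesis using assms(3)
  proof (induction rule: relfree_cong.induct)
    case (app u v u' v')
    then show ?case
      using relfree_cong_words eval_word_append[OF H' f] by metis
  next
    case (cancel x b)
    then show ?case using f by (cases b) auto
  next
    case (law w s)
    have "eval_word H f (subst_word s z) = eval_word H (\<lambda>n. eval_word H f (s n)) z" for z
    proof (induction z)
      case (Cons a z)
      then show ?case
        using law(2) subst_word_in_words[OF law(2), of z] eval_word_inv_word[OF H' f]
          eval_word_append[OF H' f]
        by (cases a) (auto simp: subst_word_def image_subset_iff)
    qed (simp add: subst_word_def)
    moreover have "range (\<lambda>n. eval_word H f (s n)) \<subseteq> carrier H"
      using law(2) eval_word_closed[OF H' f] by auto
    ultimately show ?case using H law(1) by (simp add: in_variety_def)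
  qed simp_all
qed

section \<open>F-inverse covers\<close>

definition F_inverse :: "('a, 'b) monoid_scheme \<Rightarrow> bool" where
  "F_inverse F \<longleftrightarrow> inverse_monoid F \<and>
     (\<forall>C\<in>carrier F // sigma F. \<exists>m\<in>C. \<forall>a\<in>C. nat_le F a m)"

definition F_inverse_cover ::
  "('a, 'c) monoid_scheme \<Rightarrow> ('b, 'd) monoid_scheme \<Rightarrow> ('a \<Rightarrow> 'b) \<Rightarrow> bool" where
  "F_inverse_cover F M \<phi> \<longleftrightarrow> F_inverse F \<and>
     \<phi> \<in> hom F M \<and> \<phi> \<one>\<^bsub>F\<^esub> = \<one>\<^bsub>M\<^esub> \<and> \<phi> ` carrier F = carrier M \<and> inj_on \<phi> (idem F)"

text \<open>The induced homomorphism \<open>F/\<sigma> \<rightarrow> M/\<sigma>\<close>: the image of a \<open>\<sigma>\<close>-class of \<open>F\<close> lies in a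
  single \<open>\<sigma>\<close>-class of \<open>M\<close>.\<close>

definition induced_hom :: "('b, 'd) monoid_scheme \<Rightarrow> ('a \<Rightarrow> 'b) \<Rightarrow> 'a set \<Rightarrow> 'b set" where
  "induced_hom M \<phi> C = sigma M `` (\<phi> ` C)"

text \<open>HOL cannot quantify over types inside a formula, so the type \<open>'f\<close> from which the elements
  of the covers are drawn is a parameter. A dual premorphism \<open>\<psi>\<close> from \<open>G\<^sup>U\<close> to \<open>M\<close> yields the
  cover of all pairs \<open>(m, u)\<close> with \<open>m \<le> \<psi> u\<close>, so pairs of an element of \<open>M\<close> and one of \<open>G\<^sup>U\<close>
  form a sufficiently large type.\<close>

definition has_F_inverse_cover_via ::
  "'f itself \<Rightarrow> ('a, 'b) monoid_scheme \<Rightarrow> laws \<Rightarrow> bool" where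
  "has_F_inverse_cover_via (_ :: 'f itself) M U \<longleftrightarrow>
     (\<exists>(F :: 'f monoid) \<phi>. F_inverse_cover F M \<phi> \<and>
        in_variety U ((max_group F)
          \<lparr>carrier := kernel (max_group F) (max_group M) (induced_hom M \<phi>)\<rparr>))"

section \<open>Graphs, paths and subgraphs\<close>

text \<open>A path on the graph with reversed edges added is an initial vertex together with a word in
  the edges; \<open>(e, False)\<close> is \<open>e\<close> traversed backwards.\<close>

fun gpath :: "('v, 'e) pre_digraph \<Rightarrow> 'v \<Rightarrow> 'e word \<Rightarrow> 'v \<Rightarrow> bool" where
  "gpath D i [] j \<longleftrightarrow> i \<in> verts D \<and> i = j"
| "gpath D i ((e, b) # p) j \<longleftrightarrow> e \<in> arcs D \<and>
     i = (if b then tail D e else head D e) \<and> gpath D (if b then head D e else tail D e) p j"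

text \<open>Subgraphs of a graph \<open>D\<close> are pairs (vertex set, edge set), ordered componentwise, so that
  \<open>\<le>\<close> is inclusion, \<open>sup\<close> and \<open>Sup\<close> are unions, and \<open>Inf\<close> is intersection.\<close>

type_synonym ('v, 'e) subgr = "'v set \<times> 'e set"

definition as_graph :: "('v, 'e) pre_digraph \<Rightarrow> ('v, 'e) subgr \<Rightarrow> ('v, 'e) pre_digraph" where
  "as_graph D X = D\<lparr>verts := fst X, arcs := snd X\<rparr>"

text \<open>The library's notion of connectedness refers to the underlying undirected graph and
  excludes the empty graph.\<close>

definition conn_subgraph :: "('v, 'e) pre_digraph \<Rightarrow> ('v, 'e) subgr \<Rightarrow> bool" where
  "conn_subgraph D X \<longleftrightarrow> subgraph (as_graph D X) D \<and> connected (as_graph D X)"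

definition fin_conn :: "('v, 'e) pre_digraph \<Rightarrow> ('v, 'e) subgr \<Rightarrow> bool" where
  "fin_conn D X \<longleftrightarrow> conn_subgraph D X \<and> finite (fst X) \<and> finite (snd X)"

definition component :: "('v, 'e) pre_digraph \<Rightarrow> ('v, 'e) subgr \<Rightarrow> 'v \<Rightarrow> ('v, 'e) subgr" where
  "component D X i = Sup {Y. conn_subgraph D Y \<and> Y \<le> X \<and> i \<in> fst Y}"

definition spanned :: "('v, 'e) pre_digraph \<Rightarrow> 'v \<Rightarrow> 'e word \<Rightarrow> ('v, 'e) subgr" where
  "spanned D i p = (insert i (\<Union>(e, b)\<in>set p. {tail D e, head D e}), fst ` set p)"

section \<open>The graphs \<open>\<Gamma>\<close>, \<open>\<Gamma>\<^sup>I\<close> and the closure operator\<close>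

type_synonym 'm edge = "'m set \<times> 'm \<times> 'm set"

text \<open>\<open>cayley M A\<close> is \<open>\<Gamma>\<close> and \<open>cayley M (A \<union> I)\<close> is \<open>\<Gamma>\<^sup>I\<close>.\<close>

definition cayley :: "('m, 'b) monoid_scheme \<Rightarrow> 'm set \<Rightarrow> ('m set, 'm edge) pre_digraph" where
  "cayley M B = \<lparr>verts = carrier (max_group M),
     arcs = {(g, m, g \<otimes>\<^bsub>max_group M\<^esub> sigma_class M m) | g m. g \<in> carrier (max_group M) \<and> m \<in> B},
     tail = (\<lambda>(g, m, h). g), head = (\<lambda>(g, m, h). h)\<rparr>"

definition edge_act :: "('m, 'b) monoid_scheme \<Rightarrow> 'm set \<Rightarrow> 'm edge \<Rightarrow> 'm edge" where
  "edge_act M g = (\<lambda>(h, m, k). (g \<otimes>\<^bsub>max_group M\<^esub> h, m, g \<otimes>\<^bsub>max_group M\<^esub> k))"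

definition subgr_act :: "('m, 'b) monoid_scheme \<Rightarrow> 'm set \<Rightarrow>
    ('m set, 'm edge) subgr \<Rightarrow> ('m set, 'm edge) subgr" where
  "subgr_act M g X = ((\<lambda>h. g \<otimes>\<^bsub>max_group M\<^esub> h) ` fst X, edge_act M g ` snd X)"

fun path_label :: "('m, 'b) monoid_scheme \<Rightarrow> 'm edge word \<Rightarrow> 'm" where
  "path_label M [] = \<one>\<^bsub>M\<^esub>"
| "path_label M (((g, m, h), b) # p) = (if b then m else vinv M m) \<otimes>\<^bsub>M\<^esub> path_label M p"

definition lam :: "('m, 'b) monoid_scheme \<Rightarrow> 'm set \<Rightarrow> 'm set \<Rightarrow> 'm set \<Rightarrow>
    ('m set, 'm edge) subgr \<Rightarrow> 'm" where
  "lam M B i j X =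
     (THE m. \<exists>p. gpath (cayley M B) i p j \<and> spanned (cayley M B) i p = X \<and> m = path_label M p)"

text \<open>For finite connected \<open>X\<close>; the graphs \<open>Y\<close> that occur do not depend on the choice of the
  vertices \<open>i\<close>, \<open>j\<close> of \<open>X\<close>.\<close>

definition fc_closure :: "('m, 'b) monoid_scheme \<Rightarrow> 'm set \<Rightarrow>
    ('m set, 'm edge) subgr \<Rightarrow> ('m set, 'm edge) subgr" where
  "fc_closure M B X = Sup {Y. fin_conn (cayley M B) Y \<and>
     (\<exists>i\<in>fst X. \<exists>j\<in>fst X. i \<in> fst Y \<and> j \<in> fst Y \<and> nat_le M (lam M B i j X) (lam M B i j Y))}"

definition closure :: "('m, 'b) monoid_scheme \<Rightarrow> 'm set \<Rightarrow>
    ('m set, 'm edge) subgr \<Rightarrow> ('m set, 'm edge) subgr" where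
  "closure M B X = Sup {fc_closure M B Y | Y. fin_conn (cayley M B) Y \<and> Y \<le> X}"

definition ClSub_fc :: "('m, 'b) monoid_scheme \<Rightarrow> 'm set \<Rightarrow> ('m set, 'm edge) subgr set" where
  "ClSub_fc M B = closure M B ` {X. fin_conn (cayley M B) X}"

section \<open>Inverse categories\<close>

record ('o, 'a) category = "('o, 'a) pre_digraph" +
  ccomp :: "'a \<Rightarrow> 'a \<Rightarrow> 'a"  \<comment> \<open>composition from left to right\<close>
  cid :: "'o \<Rightarrow> 'a"

locale inverse_category =
  fixes X :: "('o, 'a) category"
  assumes tail_in: "e \<in> arcs X \<Longrightarrow> tail X e \<in> verts X"
    and head_in: "e \<in> arcs X \<Longrightarrow> head X e \<in> verts X"
    and cid_arc: "i \<in> verts X \<Longrightarrow> cid X i \<in> arcs X \<and> tail X (cid X i) = i \<and> head X (cid X i) = i"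
    and ccomp_arc: "e \<in> arcs X \<Longrightarrow> f \<in> arcs X \<Longrightarrow> head X e = tail X f \<Longrightarrow>
      ccomp X e f \<in> arcs X \<and> tail X (ccomp X e f) = tail X e \<and> head X (ccomp X e f) = head X f"
    and ccomp_assoc: "e \<in> arcs X \<Longrightarrow> f \<in> arcs X \<Longrightarrow> g \<in> arcs X \<Longrightarrow>
      head X e = tail X f \<Longrightarrow> head X f = tail X g \<Longrightarrow>
      ccomp X (ccomp X e f) g = ccomp X e (ccomp X f g)"
    and cid_left: "e \<in> arcs X \<Longrightarrow> ccomp X (cid X (tail X e)) e = e"
    and cid_right: "e \<in> arcs X \<Longrightarrow> ccomp X e (cid X (head X e)) = e"
    and inverse: "e \<in> arcs X \<Longrightarrow> \<exists>!f. f \<in> arcs X \<and> tail X f = head X e \<and> head X f = tail X e \<and>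
      ccomp X (ccomp X e f) e = e \<and> ccomp X (ccomp X f e) f = f"

definition cinv :: "('o, 'a) category \<Rightarrow> 'a \<Rightarrow> 'a" where
  "cinv X e = (THE f. f \<in> arcs X \<and> tail X f = head X e \<and> head X f = tail X e \<and>
     ccomp X (ccomp X e f) e = e \<and> ccomp X (ccomp X f e) f = f)"

definition cat_le :: "('o, 'a) category \<Rightarrow> 'a \<Rightarrow> 'a \<Rightarrow> bool" where
  "cat_le X e f \<longleftrightarrow> (\<exists>h\<in>arcs X. tail X h = head X f \<and> head X h = head X f \<and>
     ccomp X h h = h \<and> e = ccomp X f h)"

text \<open>A graph morphism is a pair (vertex map, edge map).\<close>

type_synonym ('v, 'e, 'w, 'f) gmap = "('v \<Rightarrow> 'w) \<times> ('e \<Rightarrow> 'f)"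

definition graph_morphism ::
  "('v, 'e, 'c) pre_digraph_scheme \<Rightarrow> ('w, 'f, 'd) pre_digraph_scheme \<Rightarrow>
   ('v, 'e, 'w, 'f) gmap \<Rightarrow> bool" where
  "graph_morphism D D' \<psi> \<longleftrightarrow> fst \<psi> \<in> verts D \<rightarrow> verts D' \<and> snd \<psi> \<in> arcs D \<rightarrow> arcs D' \<and>
     (\<forall>e\<in>arcs D. tail D' (snd \<psi> e) = fst \<psi> (tail D e) \<and> head D' (snd \<psi> e) = fst \<psi> (head D e))"

definition cat_dual_premorphism ::
  "('o, 'a) category \<Rightarrow> ('p, 'b) category \<Rightarrow> ('o, 'a, 'p, 'b) gmap \<Rightarrow> bool" where
  "cat_dual_premorphism Y X \<psi> \<longleftrightarrow> inverse_category Y \<and> inverse_category X \<and>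
     graph_morphism Y X \<psi> \<and>
     (\<forall>i\<in>verts Y. snd \<psi> (cid Y i) = cid X (fst \<psi> i)) \<and>
     (\<forall>e\<in>arcs Y. snd \<psi> (cinv Y e) = cinv X (snd \<psi> e)) \<and>
     (\<forall>e\<in>arcs Y. \<forall>f\<in>arcs Y. head Y e = tail Y f \<longrightarrow>
        cat_le X (ccomp X (snd \<psi> e) (snd \<psi> f)) (snd \<psi> (ccomp Y e f)))"

definition cat_canonical ::
  "('v, 'e) pre_digraph \<Rightarrow> ('v, 'e, 'o, 'a) gmap \<Rightarrow> ('v, 'e, 'p, 'b) gmap \<Rightarrow>
   ('o, 'a, 'p, 'b) gmap \<Rightarrow> bool" where
  "cat_canonical D \<epsilon>Y \<epsilon>X \<psi> \<longleftrightarrow>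
     (\<forall>v\<in>verts D. fst \<psi> (fst \<epsilon>Y v) = fst \<epsilon>X v) \<and> (\<forall>e\<in>arcs D. snd \<psi> (snd \<epsilon>Y e) = snd \<epsilon>X e)"

text \<open>\<open>factors X xs x\<close>: \<open>xs\<close> is a nonempty list of consecutive arrows with product \<open>x\<close>.\<close>

inductive factors :: "('o, 'a) category \<Rightarrow> 'a list \<Rightarrow> 'a \<Rightarrow> bool" for X :: "('o, 'a) category" where
  single: "x \<in> arcs X \<Longrightarrow> factors X [x] x"
| cons: "x \<in> arcs X \<Longrightarrow> factors X xs y \<Longrightarrow> head X x = tail X y \<Longrightarrow> factors X (x # xs) (ccomp X x y)"

section \<open>The categories and monoids built from \<open>\<Gamma>\<close> and \<open>\<Gamma>\<^sup>I\<close>\<close>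

type_synonym 'm cl_arrow = "'m set \<times> ('m set, 'm edge) subgr \<times> 'm set"
type_synonym 'm rf_arrow = "'m set \<times> 'm edge word set \<times> 'm set"

definition Xcl :: "('m, 'b) monoid_scheme \<Rightarrow> 'm set \<Rightarrow> ('m set, 'm cl_arrow) category" where
  "Xcl M B = \<lparr>verts = carrier (max_group M),
     arcs = {(i, X, j). X \<in> ClSub_fc M B \<and> i \<in> fst X \<and> j \<in> fst X},
     tail = (\<lambda>(i, X, j). i), head = (\<lambda>(i, X, j). j),
     ccomp = (\<lambda>(i, X, j) (j', Y, k). (i, closure M B (sup X Y), k)),
     cid = (\<lambda>i. (i, closure M B ({i}, {}), i))\<rparr>"

definition Xcl_gen :: "('m, 'b) monoid_scheme \<Rightarrow> 'm set \<Rightarrow>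
    ('m set, 'm edge, 'm set, 'm cl_arrow) gmap" where
  "Xcl_gen M B = (id, \<lambda>e. (tail (cayley M B) e,
     closure M B ({tail (cayley M B) e, head (cayley M B) e}, {e}), head (cayley M B) e))"

definition XclG :: "('m, 'b) monoid_scheme \<Rightarrow> 'm set \<Rightarrow>
    (('m set, 'm edge) subgr \<times> 'm set) monoid" where
  "XclG M B = \<lparr>carrier = {(X, g). X \<in> ClSub_fc M B \<and> \<one>\<^bsub>max_group M\<^esub> \<in> fst X \<and> g \<in> fst X},
     monoid.mult = (\<lambda>(X, g) (Y, h). (closure M B (sup X (subgr_act M g Y)), g \<otimes>\<^bsub>max_group M\<^esub> h)),
     one = (closure M B ({\<one>\<^bsub>max_group M\<^esub>}, {}), \<one>\<^bsub>max_group M\<^esub>)\<rparr>"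

definition base_edge :: "('m, 'b) monoid_scheme \<Rightarrow> 'm \<Rightarrow> 'm edge" where
  "base_edge M a = (\<one>\<^bsub>max_group M\<^esub>, a, sigma_class M a)"

definition XclG_gen :: "('m, 'b) monoid_scheme \<Rightarrow> 'm set \<Rightarrow> 'm \<Rightarrow>
    ('m set, 'm edge) subgr \<times> 'm set" where
  "XclG_gen M B a =
     (closure M B ({\<one>\<^bsub>max_group M\<^esub>, sigma_class M a}, {base_edge M a}), sigma_class M a)"

definition Fg :: "('m, 'b) monoid_scheme \<Rightarrow> 'm set \<Rightarrow> laws \<Rightarrow> ('m set, 'm rf_arrow) category" where
  "Fg M A U = \<lparr>verts = carrier (max_group M),
     arcs = {(i, word_class U (arcs (cayley M A)) p, j) | i p j. gpath (cayley M A) i p j},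
     tail = (\<lambda>(i, u, j). i), head = (\<lambda>(i, u, j). j),
     ccomp = (\<lambda>(i, u, j) (j', v, k). (i, u \<otimes>\<^bsub>relfree U (arcs (cayley M A))\<^esub> v, k)),
     cid = (\<lambda>i. (i, \<one>\<^bsub>relfree U (arcs (cayley M A))\<^esub>, i))\<rparr>"

definition Fg_gen :: "('m, 'b) monoid_scheme \<Rightarrow> 'm set \<Rightarrow> laws \<Rightarrow>
    ('m set, 'm edge, 'm set, 'm rf_arrow) gmap" where
  "Fg_gen M A U = (id, \<lambda>e. (tail (cayley M A) e,
     word_class U (arcs (cayley M A)) [(e, True)], head (cayley M A) e))"

text \<open>The action of \<open>G\<close> on \<open>F\<^sub>U(E\<^sub>\<Gamma>)\<close> is elementwise on classes of words.\<close>

definition GU :: "('m, 'b) monoid_scheme \<Rightarrow> 'm set \<Rightarrow> laws \<Rightarrow>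
    ('m edge word set \<times> 'm set) monoid" where
  "GU M A U = \<lparr>carrier = {(word_class U (arcs (cayley M A)) p, g) | p g.
        gpath (cayley M A) \<one>\<^bsub>max_group M\<^esub> p g},
     monoid.mult = (\<lambda>(u, g) (v, h).
       (u \<otimes>\<^bsub>relfree U (arcs (cayley M A))\<^esub> (map (apfst (edge_act M g)) ` v),
        g \<otimes>\<^bsub>max_group M\<^esub> h)),
     one = (\<one>\<^bsub>relfree U (arcs (cayley M A))\<^esub>, \<one>\<^bsub>max_group M\<^esub>)\<rparr>"

definition GU_gen :: "('m, 'b) monoid_scheme \<Rightarrow> 'm set \<Rightarrow> laws \<Rightarrow> 'm \<Rightarrow>
    'm edge word set \<times> 'm set" where
  "GU_gen M A U a =
     (word_class U (arcs (cayley M A)) [(base_edge M a, True)], sigma_class M a)"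

section \<open>The graphs \<open>C\<^sub>n\<close> and \<open>P\<^sub>n\<close>\<close>

primrec Ccl :: "('m, 'b) monoid_scheme \<Rightarrow> 'm set \<Rightarrow> 'm set \<Rightarrow> laws \<Rightarrow> nat \<Rightarrow> 'm rf_arrow \<Rightarrow>
    ('m set, 'm edge) subgr" where
  "Ccl M A I U 0 x =
     Inf {closure M (A \<union> I) (spanned (cayley M A) (tail (Fg M A U) x) p) | p.
       gpath (cayley M A) (tail (Fg M A U) x) p (head (Fg M A U) x) \<and>
       x = (tail (Fg M A U) x, word_class U (arcs (cayley M A)) p, head (Fg M A U) x)}"
| "Ccl M A I U (Suc n) x =
     Inf {closure M (A \<union> I) (Sup ((\<lambda>y. component (cayley M (A \<union> I)) (Ccl M A I U n y)
         (tail (Fg M A U) y)) ` set xs)) | xs. factors (Fg M A U) xs x}"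

definition Pcl :: "('m, 'b) monoid_scheme \<Rightarrow> 'm set \<Rightarrow> 'm set \<Rightarrow> laws \<Rightarrow> nat \<Rightarrow> 'm rf_arrow \<Rightarrow>
    ('m set, 'm edge) subgr" where
  "Pcl M A I U n x = component (cayley M (A \<union> I)) (Ccl M A I U n x) (tail (Fg M A U) x)"

end

theory Submission
  imports Defs
begin

text \<open>The connected closed subgraphs of \<open>\<Gamma>\<^sup>I\<close> are the Schuetzenberger graphs \<open>S i e\<close> of the idempotents
  \<open>e\<close> of \<open>M\<close>, drawn from a vertex \<open>i\<close>. Hence \<open>X\<^sub>c\<^sub>l(\<Gamma>\<^sup>I)/G\<close> is isomorphic to \<open>M\<close>, and the arrows of
  \<open>X\<^sub>c\<^sub>l(\<Gamma>\<^sup>I)\<close> are pairs of a vertex and an element of \<open>M\<close>. In these terms (2)--(5) all amount to a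
  function \<open>\<mu>\<close> on the arrows of \<open>F\<^sub>g\<^sub>U(\<Gamma>)\<close> with values in \<open>M\<close> that is lax, \<open>\<mu>(x) \<mu>(y) \<le> \<mu>(xy)\<close>, and
  lies above the labels of all paths representing an arrow; on edges it is then the label, because
  the elements of \<open>A\<close> are maximal.

  The meet of all such functions exists since \<open>M\<close> is finite-above, and it is invariant under \<open>G\<close>
  and under inversion, so it descends to \<open>G\<^sup>U\<close>. The graphs \<open>P\<^sub>n(x)\<close> contain the graph of every
  \<open>\<mu>(x)\<close>; conversely, if they always contain the head of \<open>x\<close>, they are the graphs of elements
  \<open>m\<^sub>n(x)\<close> with \<open>m\<^sub>n(x) m\<^sub>n(y) \<le> m\<^sub>n\<^sub>+\<^sub>1(xy)\<close>, increasing in \<open>n\<close>, whose eventual value is lax. The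
  greatest elements of the \<open>\<sigma>\<close>-classes of an F-inverse cover give a lax function, and a dual
  premorphism \<open>\<psi>\<close> from \<open>G\<^sup>U\<close> gives the cover of all pairs \<open>(m, u)\<close> with \<open>m \<le> \<psi>(u)\<close>.\<close>

section \<open>Inverse monoids\<close>

text \<open>E-unitarity makes graphs as good as elements: \<open>m\<close> is determined by
  \<open>s m\<close> and \<open>dom m\<close>, and on a \<sigma>-class the order is that of the
  values of \<open>dom\<close>. A path from \<open>i\<close> stays in \<open>S i e\<close> exactly
  when \<open>e\<close> lies below \<open>dom\<close> of its label, so inclusion of graphs drawn
  from one vertex is the reversed order of idempotents, and closures become computations in
  \<open>M\<close>.

  Laxness asks neither for compatibility with inversion nor for invariance under translation,
  although dual premorphisms out of \<open>F\<^sub>g\<^sub>U(\<Gamma>)\<close> need the first and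
  those out of \<open>G\<^sup>U\<close> need both. Both come for free from the meet: the set of lax
  functions is stable under these symmetries.

  The obstacle in (5) is that the intersections \<open>C\<^sub>n(x)\<close> may fall apart. Only the
  component of the tail is a graph \<open>S i f\<close>: a path in the intersection has its
  \<open>dom\<close> in a finite set of idempotents, whose meet is \<open>f\<close>. Whether the
  head lies in that component is the content of (5).

  In (1) the laws hold only in the kernel, while labels of edges live in the whole group of the
  cover; a section of the group homomorphism bridges the gap.\<close>

locale inv_monoid =
  fixes M :: "('a, 'b) monoid_scheme" (structure)
  assumes inverse_monoid: "inverse_monoid M"
begin

sublocale monoid M
  using inverse_monoid by (simp add: inverse_monoid_def)

abbreviation E where "E \<equiv> idem M"

abbreviation dag :: "'a \<Rightarrow> 'a" (\<open>_\<dagger>\<close> [999] 1000) where "a\<dagger> \<equiv> vinv M a"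

abbreviation le :: "'a \<Rightarrow> 'a \<Rightarrow> bool" (infix \<open>\<preceq>\<close> 50) where "a \<preceq> b \<equiv> nat_le M a b"

text \<open>The least idempotent that fixes \<open>a\<close> from the left. Elements are
  \<R>-related exactly when their values of \<open>dom\<close> agree.\<close>

definition dom :: "'a \<Rightarrow> 'a" where "dom a = a \<otimes> a\<dagger>"

lemma ex1_inverse: "a \<in> carrier M \<Longrightarrow> \<exists>!b. b \<in> carrier M \<and> a \<otimes> b \<otimes> a = a \<and> b \<otimes> a \<otimes> b = b"
  using inverse_monoid by (simp add: inverse_monoid_def)

lemma dag_spec:
  assumes "a \<in> carrier M"
  shows "a\<dagger> \<in> carrier M \<and> a \<otimes> a\<dagger> \<otimes> a = a \<and> a\<dagger> \<otimes> a \<otimes> a\<dagger> = a\<dagger>"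
  unfolding vinv_def by (rule theI'[OF ex1_inverse[OF assms]])

lemma dag_closed [simp]: "a \<in> carrier M \<Longrightarrow> a\<dagger> \<in> carrier M"
  using dag_spec by blast

lemma dag_simps [simp]:
  assumes "a \<in> carrier M"
  shows "a \<otimes> (a\<dagger> \<otimes> a) = a" "a\<dagger> \<otimes> (a \<otimes> a\<dagger>) = a\<dagger>"
  using dag_spec[OF assms] assms by (simp_all add: m_assoc)

lemma dag_simps' [simp]:
  assumes "a \<in> carrier M" "z \<in> carrier M"
  shows "a \<otimes> (a\<dagger> \<otimes> (a \<otimes> z)) = a \<otimes> z" "a\<dagger> \<otimes> (a \<otimes> (a\<dagger> \<otimes> z)) = a\<dagger> \<otimes> z"
  using dag_simps[OF assms(1)] assms by (metis dag_closed m_assoc m_closed)+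

lemma dag_eqI:
  assumes "a \<in> carrier M" "b \<in> carrier M" "a \<otimes> (b \<otimes> a) = a" "b \<otimes> (a \<otimes> b) = b"
  shows "a\<dagger> = b"
  unfolding vinv_def by (rule the1_equality[OF ex1_inverse[OF assms(1)]]) (use assms in \<open>simp add: m_assoc\<close>)

lemma dag_dag [simp]: "a \<in> carrier M \<Longrightarrow> a\<dagger>\<dagger> = a"
  by (rule dag_eqI) auto

lemma idem_carrier [simp]: "e \<in> E \<Longrightarrow> e \<in> carrier M"
  and idem_mult [simp]: "e \<in> E \<Longrightarrow> e \<otimes> e = e"
  by (auto simp: idem_def)

lemma idem_mult' [simp]: "e \<in> E \<Longrightarrow> z \<in> carrier M \<Longrightarrow> e \<otimes> (e \<otimes> z) = e \<otimes> z"
  by (metis idem_carrier idem_mult m_assoc)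

lemma idemI: "e \<in> carrier M \<Longrightarrow> e \<otimes> e = e \<Longrightarrow> e \<in> E"
  unfolding idem_def by simp

lemma one_idem [simp]: "\<one> \<in> E"
  by (simp add: idemI)

lemma idem_dag [simp]: "e \<in> E \<Longrightarrow> e\<dagger> = e"
  by (rule dag_eqI) auto

text \<open>The inverse of \<open>ef\<close> is the idempotent \<open>f (ef)\<dagger> e\<close>, hence \<open>ef\<close> is its own inverse.\<close>

lemma idem_closed [simp]:
  assumes e: "e \<in> E" and f: "f \<in> E"
  shows "e \<otimes> f \<in> E"
proof -
  define x where "x = (e \<otimes> f)\<dagger>"
  have x: "x \<in> carrier M" using e f by (simp add: x_def)
  have 1: "e \<otimes> (f \<otimes> (x \<otimes> (e \<otimes> f))) = e \<otimes> f" "x \<otimes> (e \<otimes> (f \<otimes> x)) = x"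
  proof -
    have "e \<otimes> f \<otimes> (x \<otimes> (e \<otimes> f)) = e \<otimes> f" "x \<otimes> (e \<otimes> f \<otimes> x) = x"
      using e f by (simp_all add: x_def)
    then show "e \<otimes> (f \<otimes> (x \<otimes> (e \<otimes> f))) = e \<otimes> f" "x \<otimes> (e \<otimes> (f \<otimes> x)) = x"
      using e f x by (simp_all add: m_assoc)
  qed
  have 2: "x \<otimes> (e \<otimes> (f \<otimes> (x \<otimes> e))) = x \<otimes> e"
    using 1(2) e f x by (metis idem_carrier m_assoc m_closed)
  have "x = f \<otimes> (x \<otimes> e)" unfolding x_def
    by (rule dag_eqI) (use e f x 1 2 in \<open>simp_all add: m_assoc flip: x_def\<close>)
  moreover have "f \<otimes> (x \<otimes> e) \<in> E"
    by (rule idemI) (use e f x 2 in \<open>simp_all add: m_assoc\<close>)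
  ultimately have "x \<in> E" by simp
  then have "x\<dagger> \<in> E" by simp
  then show ?thesis using e f by (simp add: x_def)
qed

text \<open>\<open>f \<otimes> e\<close> is an inverse of \<open>e \<otimes> f\<close>, and an
  idempotent is its own inverse; uniqueness of inverses does the rest.\<close>

lemma idem_commute:
  assumes e: "e \<in> E" and f: "f \<in> E"
  shows "e \<otimes> f = f \<otimes> e"
proof -
  have "e \<otimes> f \<in> E" "f \<otimes> e \<in> E" using e f by auto
  then have "e \<otimes> f \<otimes> (e \<otimes> f) = e \<otimes> f" "f \<otimes> e \<otimes> (f \<otimes> e) = f \<otimes> e" by simp_all
  then have "e \<otimes> (f \<otimes> (e \<otimes> f)) = e \<otimes> f" "f \<otimes> (e \<otimes> (f \<otimes> e)) = f \<otimes> e"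
    using e f by (simp_all add: m_assoc del: idem_mult idem_mult')
  then have "(e \<otimes> f)\<dagger> = f \<otimes> e"
    by (intro dag_eqI) (use e f in \<open>simp_all add: m_assoc\<close>)
  then show ?thesis using e f idem_dag[of "e \<otimes> f"] by simp
qed

lemma idem_left_commute:
  "e \<in> E \<Longrightarrow> f \<in> E \<Longrightarrow> z \<in> carrier M \<Longrightarrow> e \<otimes> (f \<otimes> z) = f \<otimes> (e \<otimes> z)"
  by (metis idem_carrier idem_commute m_assoc)

lemma dom_idem [simp]: "a \<in> carrier M \<Longrightarrow> dom a \<in> E"
  by (rule idemI) (auto simp: dom_def m_assoc)

lemma dom_dag_idem: "a \<in> carrier M \<Longrightarrow> a\<dagger> \<otimes> a \<in> E"
  by (rule idemI) (auto simp: m_assoc)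

lemma dom_closed [simp]: "a \<in> carrier M \<Longrightarrow> dom a \<in> carrier M"
  by auto

lemma dom_mult_self [simp]: "a \<in> carrier M \<Longrightarrow> dom a \<otimes> a = a"
  by (simp add: dom_def m_assoc)

lemma dom_of_idem [simp]: "e \<in> E \<Longrightarrow> dom e = e"
  by (simp add: dom_def)

lemma conj_idem [simp]:
  assumes "a \<in> carrier M" "e \<in> E"
  shows "a \<otimes> (e \<otimes> a\<dagger>) \<in> E"
proof (rule idemI)
  have "a \<otimes> (e \<otimes> a\<dagger>) \<otimes> (a \<otimes> (e \<otimes> a\<dagger>)) = a \<otimes> (e \<otimes> ((a\<dagger> \<otimes> a) \<otimes> (e \<otimes> a\<dagger>)))"
    using assms by (simp add: m_assoc)
  also have "\<dots> = a \<otimes> (e \<otimes> (e \<otimes> ((a\<dagger> \<otimes> a) \<otimes> a\<dagger>)))"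
    using assms idem_left_commute[OF dom_dag_idem[OF assms(1)] assms(2), of "a\<dagger>"] by simp
  also have "\<dots> = a \<otimes> (e \<otimes> a\<dagger>)" using assms by (simp add: m_assoc)
  finally show "a \<otimes> (e \<otimes> a\<dagger>) \<otimes> (a \<otimes> (e \<otimes> a\<dagger>)) = a \<otimes> (e \<otimes> a\<dagger>)" .
qed (use assms in auto)

text \<open>Conjugation carries an idempotent from the right of \<open>a\<close> to the left. With
  \<open>idem_mult_conv\<close>, which goes the other way, this makes the left and right
  descriptions of the order agree.\<close>

lemma mult_idem:
  assumes "a \<in> carrier M" "e \<in> E"
  shows "a \<otimes> e = a \<otimes> (e \<otimes> a\<dagger>) \<otimes> a"
proof -
  have "a \<otimes> (e \<otimes> a\<dagger>) \<otimes> a = a \<otimes> (e \<otimes> (a\<dagger> \<otimes> a))"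
    using assms by (simp add: m_assoc)
  also have "\<dots> = a \<otimes> ((a\<dagger> \<otimes> a) \<otimes> e)"
    using idem_commute[OF assms(2) dom_dag_idem[OF assms(1)]] by simp
  also have "\<dots> = a \<otimes> e" using assms by (simp add: m_assoc)
  finally show ?thesis by simp
qed

lemma idem_mult_conv:
  assumes "a \<in> carrier M" "e \<in> E"
  shows "e \<otimes> a = a \<otimes> (a\<dagger> \<otimes> (e \<otimes> a))"
proof -
  have "a \<otimes> (a\<dagger> \<otimes> (e \<otimes> a)) = dom a \<otimes> (e \<otimes> a)"
    using assms by (simp add: m_assoc dom_def)
  also have "\<dots> = e \<otimes> (dom a \<otimes> a)"
    using assms by (intro idem_left_commute) auto
  finally show ?thesis using assms by simp
qed

text \<open>Both computations hinge on commuting the idempotents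
  \<open>a\<dagger> \<otimes> a\<close> and \<open>b \<otimes> b\<dagger>\<close>.\<close>

lemma dag_mult:
  assumes "a \<in> carrier M" "b \<in> carrier M"
  shows "(a \<otimes> b)\<dagger> = b\<dagger> \<otimes> a\<dagger>"
proof (rule dag_eqI)
  have "a \<otimes> b \<otimes> (b\<dagger> \<otimes> a\<dagger> \<otimes> (a \<otimes> b)) = a \<otimes> ((b \<otimes> b\<dagger>) \<otimes> ((a\<dagger> \<otimes> a) \<otimes> b))"
    using assms by (simp add: m_assoc)
  also have "\<dots> = a \<otimes> ((a\<dagger> \<otimes> a) \<otimes> ((b \<otimes> b\<dagger>) \<otimes> b))"
    using idem_left_commute[OF dom_idem dom_dag_idem] assms by (simp add: dom_def)
  also have "\<dots> = a \<otimes> b" using assms by (simp add: m_assoc)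
  finally show "a \<otimes> b \<otimes> (b\<dagger> \<otimes> a\<dagger> \<otimes> (a \<otimes> b)) = a \<otimes> b" .
  have "b\<dagger> \<otimes> a\<dagger> \<otimes> (a \<otimes> b \<otimes> (b\<dagger> \<otimes> a\<dagger>)) = b\<dagger> \<otimes> ((a\<dagger> \<otimes> a) \<otimes> ((b \<otimes> b\<dagger>) \<otimes> a\<dagger>))"
    using assms by (simp add: m_assoc)
  also have "\<dots> = b\<dagger> \<otimes> ((b \<otimes> b\<dagger>) \<otimes> ((a\<dagger> \<otimes> a) \<otimes> a\<dagger>))"
    using idem_left_commute[OF dom_idem dom_dag_idem] assms by (simp add: dom_def)
  also have "\<dots> = b\<dagger> \<otimes> a\<dagger>" using assms by (simp add: m_assoc)
  finally show "b\<dagger> \<otimes> a\<dagger> \<otimes> (a \<otimes> b \<otimes> (b\<dagger> \<otimes> a\<dagger>)) = b\<dagger> \<otimes> a\<dagger>" .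
qed (use assms in auto)

lemma dom_mult: "a \<in> carrier M \<Longrightarrow> b \<in> carrier M \<Longrightarrow> dom (a \<otimes> b) = a \<otimes> (dom b \<otimes> a\<dagger>)"
  by (simp add: dom_def dag_mult m_assoc)

lemma dom_idem_mult:
  assumes "a \<in> carrier M" "e \<in> E"
  shows "dom (e \<otimes> a) = e \<otimes> dom a"
proof -
  have "dom (e \<otimes> a) = e \<otimes> (dom a \<otimes> e)" using assms by (simp add: dom_mult)
  then show ?thesis using assms idem_commute[of "dom a" e] by simp
qed

subsection \<open>The natural partial order\<close>

lemma leI: "e \<in> E \<Longrightarrow> a = e \<otimes> b \<Longrightarrow> a \<preceq> b"
  by (auto simp: nat_le_def)

text \<open>The existential witness in the order can be replaced by the canonical
  \<open>dom a\<close>, so that comparisons become equations.\<close>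

lemma le_iff_dom:
  assumes "b \<in> carrier M"
  shows "a \<preceq> b \<longleftrightarrow> a \<in> carrier M \<and> a = dom a \<otimes> b"
proof
  assume "a \<preceq> b"
  then obtain e where e: "e \<in> E" "a = e \<otimes> b" by (auto simp: nat_le_def)
  have "dom a \<otimes> b = e \<otimes> (dom b \<otimes> b)"
    unfolding e(2) dom_idem_mult[OF assms e(1)] using e(1) assms by (simp add: m_assoc)
  then show "a \<in> carrier M \<and> a = dom a \<otimes> b" using e assms by simp
next
  assume "a \<in> carrier M \<and> a = dom a \<otimes> b"
  then show "a \<preceq> b" using leI[of "dom a" a b] by auto
qed

lemma le_carrier: "a \<preceq> b \<Longrightarrow> b \<in> carrier M \<Longrightarrow> a \<in> carrier M"
  by (simp add: le_iff_dom)

lemma le_right_iff: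
  assumes "b \<in> carrier M"
  shows "a \<preceq> b \<longleftrightarrow> (\<exists>e\<in>E. a = b \<otimes> e)"
proof
  assume "a \<preceq> b"
  then obtain e where e: "e \<in> E" "a = e \<otimes> b" by (auto simp: nat_le_def)
  then have "a = b \<otimes> (b\<dagger> \<otimes> (e \<otimes> b))" using idem_mult_conv[OF assms] by simp
  moreover have "b\<dagger> \<otimes> (e \<otimes> b) \<in> E" using conj_idem[of "b\<dagger>" e] assms e by simp
  ultimately show "\<exists>e\<in>E. a = b \<otimes> e" by blast
next
  assume "\<exists>e\<in>E. a = b \<otimes> e"
  then show "a \<preceq> b" using mult_idem[OF assms] conj_idem[OF assms] leI by blast
qed

lemma le_refl [simp]: "a \<in> carrier M \<Longrightarrow> a \<preceq> a"
  by (rule leI[of \<one>]) auto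

lemma le_trans:
  assumes "a \<preceq> b" "b \<preceq> c" "c \<in> carrier M"
  shows "a \<preceq> c"
proof -
  obtain e f where "e \<in> E" "a = e \<otimes> b" "f \<in> E" "b = f \<otimes> c" using assms by (auto simp: nat_le_def)
  then show ?thesis using assms by (intro leI[of "e \<otimes> f"]) (auto simp: m_assoc)
qed

lemma le_antisym:
  assumes "a \<preceq> b" "b \<preceq> a" "a \<in> carrier M" "b \<in> carrier M"
  shows "a = b"
proof -
  have a: "a = dom a \<otimes> b" and b: "b = dom b \<otimes> a" using assms by (simp_all add: le_iff_dom)
  have "dom a = dom a \<otimes> dom b" "dom b = dom b \<otimes> dom a"
    using arg_cong[OF a, of dom] arg_cong[OF b, of dom] assms by (simp_all add: dom_idem_mult)
  then have "dom a = dom b" using idem_commute[of "dom a" "dom b"] assms by simp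
  then show ?thesis using a assms by simp
qed

lemma le_mult:
  assumes "a \<preceq> b" "c \<preceq> d" "b \<in> carrier M" "d \<in> carrier M"
  shows "a \<otimes> c \<preceq> b \<otimes> d"
proof -
  obtain e f where e: "e \<in> E" "a = e \<otimes> b" and f: "f \<in> E" "c = f \<otimes> d"
    using assms by (auto simp: nat_le_def)
  have "a \<otimes> c = e \<otimes> ((b \<otimes> f) \<otimes> d)" using e f assms by (simp add: m_assoc)
  also have "\<dots> = (e \<otimes> (b \<otimes> (f \<otimes> b\<dagger>))) \<otimes> (b \<otimes> d)"
    unfolding mult_idem[OF assms(3) f(1)] using e f assms by (simp add: m_assoc)
  finally show ?thesis using e f assms by (intro leI) auto
qed

lemma le_dag:
  assumes "a \<preceq> b" "b \<in> carrier M"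
  shows "a\<dagger> \<preceq> b\<dagger>"
proof -
  obtain e where "e \<in> E" "a = e \<otimes> b" using assms by (auto simp: nat_le_def)
  then show ?thesis using assms by (auto simp: le_right_iff dag_mult)
qed

lemma idem_le_iff: "e \<in> E \<Longrightarrow> f \<in> E \<Longrightarrow> e \<preceq> f \<longleftrightarrow> e \<otimes> f = e"
  by (auto simp: le_iff_dom)

lemma dom_mono: "a \<preceq> b \<Longrightarrow> b \<in> carrier M \<Longrightarrow> dom a \<preceq> dom b"
  unfolding dom_def by (intro le_mult le_dag) auto

lemma idem_le_one: "e \<in> E \<Longrightarrow> e \<preceq> \<one>"
  by (auto intro: leI)

lemma idem_mult_le: "e \<in> E \<Longrightarrow> a \<in> carrier M \<Longrightarrow> e \<otimes> a \<preceq> a"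
  by (auto intro: leI)

lemma mult_idem_le: "e \<in> E \<Longrightarrow> a \<in> carrier M \<Longrightarrow> a \<otimes> e \<preceq> a"
  by (auto simp: le_right_iff)

lemma dom_mult_le: "a \<in> carrier M \<Longrightarrow> b \<in> carrier M \<Longrightarrow> dom (a \<otimes> b) \<preceq> dom a"
  using le_mult[of a a "dom b \<otimes> a\<dagger>" "a\<dagger>"] idem_mult_le[of "dom b" "a\<dagger>"]
  by (simp add: dom_mult dom_def[of a])

lemma one_le_imp_eq:
  assumes "\<one> \<preceq> m" "m \<in> carrier M"
  shows "m = \<one>"
proof -
  have "\<one> = dom \<one> \<otimes> m" using assms le_iff_dom[of m] by simp
  also have "\<dots> = m" using assms(2) by simp
  finally show ?thesis ..
qed

subsection \<open>The least group congruence\<close>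

text \<open>Stated for any congruence: it is applied to \<open>srel\<close> and, in identifying
  \<open>sigma\<close>, to every group congruence.\<close>

lemma quot_mult:
  assumes "equiv (carrier M) \<rho>"
    and cong: "\<And>a b c d. (a, b) \<in> \<rho> \<Longrightarrow> (c, d) \<in> \<rho> \<Longrightarrow> (a \<otimes> c, b \<otimes> d) \<in> \<rho>"
    and "a \<in> carrier M" "b \<in> carrier M"
  shows "\<rho> `` {a} \<otimes>\<^bsub>quot_monoid M \<rho>\<^esub> \<rho> `` {b} = \<rho> `` {a \<otimes> b}"
proof -
  have refl: "(a, a) \<in> \<rho>" "(b, b) \<in> \<rho>" using assms by (auto simp: equiv_def refl_on_def)
  have tr: "trans \<rho>" using assms by (auto simp: equiv_def)
  show ?thesis
  proof (intro equalityI subsetI)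
    fix z assume "z \<in> \<rho> `` {a} \<otimes>\<^bsub>quot_monoid M \<rho>\<^esub> \<rho> `` {b}"
    then obtain x y where "(a, x) \<in> \<rho>" "(b, y) \<in> \<rho>" "(x \<otimes> y, z) \<in> \<rho>"
      by (auto simp: quot_monoid_def)
    then show "z \<in> \<rho> `` {a \<otimes> b}" using cong transD[OF tr] by blast
  next
    fix z assume "z \<in> \<rho> `` {a \<otimes> b}"
    then show "z \<in> \<rho> `` {a} \<otimes>\<^bsub>quot_monoid M \<rho>\<^esub> \<rho> `` {b}"
      using refl by (auto simp: quot_monoid_def)
  qed
qed

lemma quot_carrier: "x \<in> carrier (quot_monoid M \<rho>) \<longleftrightarrow> (\<exists>a\<in>carrier M. x = \<rho> `` {a})"
  and quot_one: "\<one>\<^bsub>quot_monoid M \<rho>\<^esub> = \<rho> `` {\<one>}"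
  by (auto simp: quot_monoid_def quotient_def)

text \<open>The explicit form of \<sigma>: the element \<open>e \<otimes> a = e \<otimes> b\<close>
  is a common lower bound, and any common lower bound arises in this way
  (\<open>srel_iff_le\<close>).\<close>

definition srel :: "('a \<times> 'a) set" where
  "srel = {(a, b). a \<in> carrier M \<and> b \<in> carrier M \<and> (\<exists>e\<in>E. e \<otimes> a = e \<otimes> b)}"

lemma srel_iff_le:
  assumes "a \<in> carrier M" "b \<in> carrier M"
  shows "(a, b) \<in> srel \<longleftrightarrow> (\<exists>c. c \<preceq> a \<and> c \<preceq> b)"
proof
  assume "(a, b) \<in> srel"
  then show "\<exists>c. c \<preceq> a \<and> c \<preceq> b" by (auto simp: srel_def intro: leI)
next
  assume "\<exists>c. c \<preceq> a \<and> c \<preceq> b"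
  then obtain c where "c \<in> carrier M" "c = dom c \<otimes> a" "c = dom c \<otimes> b"
    using assms by (auto simp: le_iff_dom)
  then show "(a, b) \<in> srel"
    using assms unfolding srel_def by (auto intro!: bexI[of _ "dom c"])
qed

lemma srel_equiv: "equiv (carrier M) srel"
proof (rule equivI)
  show "srel \<subseteq> carrier M \<times> carrier M" by (auto simp: srel_def)
  show "refl_on (carrier M) srel" by (auto simp: refl_on_def srel_def intro: one_idem)
  show "sym srel" by (auto simp: sym_def srel_def; metis)
  show "trans srel"
  proof (rule transI)
    fix a b c assume "(a, b) \<in> srel" "(b, c) \<in> srel"
    then obtain e f where *: "a \<in> carrier M" "b \<in> carrier M" "c \<in> carrier M" "e \<in> E" "f \<in> E"
      "e \<otimes> a = e \<otimes> b" "f \<otimes> b = f \<otimes> c" by (auto simp: srel_def)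
    have "f \<otimes> (e \<otimes> a) = e \<otimes> (f \<otimes> c)"
      using * idem_left_commute[of f e b] by simp
    then have "f \<otimes> e \<otimes> a = f \<otimes> e \<otimes> c"
      using * idem_left_commute[of f e c] by (simp add: m_assoc)
    then show "(a, c) \<in> srel" using * by (auto simp: srel_def)
  qed
qed

lemma srel_mult:
  assumes "(a, b) \<in> srel" "(c, d) \<in> srel"
  shows "(a \<otimes> c, b \<otimes> d) \<in> srel"
proof -
  have *: "a \<in> carrier M" "b \<in> carrier M" "c \<in> carrier M" "d \<in> carrier M"
    using assms by (auto simp: srel_def)
  obtain x y where "x \<preceq> a" "x \<preceq> b" "y \<preceq> c" "y \<preceq> d"
    using assms * srel_iff_le by metis
  then have "x \<otimes> y \<preceq> a \<otimes> c" "x \<otimes> y \<preceq> b \<otimes> d" using * by (auto intro: le_mult)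
  then show ?thesis using * srel_iff_le by blast
qed

lemma srel_idem: "e \<in> E \<Longrightarrow> (e, \<one>) \<in> srel"
  by (auto simp: srel_def intro: bexI[of _ e])

lemma srel_group: "group (quot_monoid M srel)" (is "group ?Q")
proof (rule groupI)
  note mult = quot_mult[OF srel_equiv srel_mult]
  note eq = equiv_class_eq[OF srel_equiv]
  show "x \<otimes>\<^bsub>?Q\<^esub> y \<in> carrier (?Q)"
    if "x \<in> carrier (?Q)" "y \<in> carrier (?Q)" for x y
    using that by (auto simp: quot_carrier mult)
  show "\<one>\<^bsub>?Q\<^esub> \<in> carrier (?Q)"
    by (auto simp: quot_carrier quot_one)
  show "x \<otimes>\<^bsub>?Q\<^esub> y \<otimes>\<^bsub>?Q\<^esub> z =
      x \<otimes>\<^bsub>?Q\<^esub> (y \<otimes>\<^bsub>?Q\<^esub> z)"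
    if "x \<in> carrier (?Q)" "y \<in> carrier (?Q)"
      "z \<in> carrier (?Q)" for x y z
    using that by (auto simp: quot_carrier mult m_assoc)
  show "\<one>\<^bsub>?Q\<^esub> \<otimes>\<^bsub>?Q\<^esub> x = x"
    if "x \<in> carrier (?Q)" for x
    using that by (auto simp: quot_carrier quot_one mult)
  show "\<exists>y\<in>carrier (?Q). y \<otimes>\<^bsub>?Q\<^esub> x = \<one>\<^bsub>?Q\<^esub>"
    if x: "x \<in> carrier (?Q)" for x
  proof -
    obtain a where a: "a \<in> carrier M" "x = srel `` {a}" using x by (auto simp: quot_carrier)
    then have "srel `` {a\<dagger>} \<otimes>\<^bsub>?Q\<^esub> x = \<one>\<^bsub>?Q\<^esub>"
      by (auto simp: mult quot_one intro!: eq srel_idem dom_dag_idem)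
    then show ?thesis using a quot_carrier dag_closed by blast
  qed
qed

text \<open>A group has only one idempotent, so any group congruence sends every idempotent to the
  identity class; from \<open>e \<otimes> a = e \<otimes> b\<close> it must therefore identify
  \<open>a\<close> and \<open>b\<close>.\<close>

lemma sigma_eq: "sigma M = srel"
proof
  have "group_congruence M srel"
    unfolding group_congruence_def using srel_equiv srel_mult srel_group by blast
  then show "sigma M \<subseteq> srel" by (auto simp: sigma_def)
  show "srel \<subseteq> sigma M"
    unfolding sigma_def
  proof (rule subsetI, rule InterI)
    fix z \<rho> assume z: "z \<in> srel" and "\<rho> \<in> {\<rho>. group_congruence M \<rho>}"
    then have eq: "equiv (carrier M) \<rho>" and g: "group (quot_monoid M \<rho>)"
      and mult: "\<And>a b c d. (a, b) \<in> \<rho> \<Longrightarrow> (c, d) \<in> \<rho> \<Longrightarrow> (a \<otimes> c, b \<otimes> d) \<in> \<rho>"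
      by (auto simp: group_congruence_def)
    interpret Q: group "quot_monoid M \<rho>" by fact
    obtain a b e where ab: "z = (a, b)" "a \<in> carrier M" "b \<in> carrier M" "e \<in> E" "e \<otimes> a = e \<otimes> b"
      using z by (auto simp: srel_def)
    have cl: "\<rho> `` {c} \<in> carrier (quot_monoid M \<rho>)" if "c \<in> carrier M" for c
      using that by (auto simp: quot_carrier)
    have "\<rho> `` {e} \<otimes>\<^bsub>quot_monoid M \<rho>\<^esub> \<rho> `` {e} = \<rho> `` {e}"
      using quot_mult[OF eq mult, of e e] ab by simp
    then have e1: "\<rho> `` {e} = \<one>\<^bsub>quot_monoid M \<rho>\<^esub>" using cl[of e] ab
      by (metis Q.l_cancel_one' idem_carrier)
    have "\<rho> `` {c} = \<rho> `` {e \<otimes> c}" if "c \<in> carrier M" for c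
      using quot_mult[OF eq mult, of e c] that ab e1 cl[OF that] by simp
    from this[of a] this[of b] have "\<rho> `` {a} = \<rho> `` {b}" using ab by simp
    then show "z \<in> \<rho>" using eq_equiv_class[OF _ eq ab(3)] ab(1) by simp
  qed
qed

section \<open>The maximal group image\<close>

abbreviation G where "G \<equiv> max_group M"
abbreviation s :: "'a \<Rightarrow> 'a set" where "s a \<equiv> sigma_class M a"

abbreviation gone (\<open>\<one>\<^sub>G\<close>) where "\<one>\<^sub>G \<equiv> \<one>\<^bsub>G\<^esub>"
abbreviation gmult (infixl \<open>\<cdot>\<close> 70) where "g \<cdot> h \<equiv> g \<otimes>\<^bsub>G\<^esub> h"
abbreviation ginv (\<open>inv\<^sub>G _\<close> [81] 80) where "inv\<^sub>G g \<equiv> inv\<^bsub>G\<^esub> g"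

lemma max_group_group: "group G"
  using srel_group by (simp add: sigma_eq)

sublocale G: group G by (rule max_group_group)

lemma G_carrier: "x \<in> carrier G \<longleftrightarrow> (\<exists>a\<in>carrier M. x = s a)"
  by (rule quot_carrier)

lemma s_closed [simp]: "a \<in> carrier M \<Longrightarrow> s a \<in> carrier G"
  by (auto simp: G_carrier)

lemma s_mult [simp]: "a \<in> carrier M \<Longrightarrow> b \<in> carrier M \<Longrightarrow> s (a \<otimes> b) = s a \<otimes>\<^bsub>G\<^esub> s b"
  by (simp add: sigma_eq quot_mult[OF srel_equiv srel_mult])

lemma s_one: "\<one>\<^sub>G = s \<one>"
  by (simp add: quot_one)

lemma s_eq_iff:
  assumes "a \<in> carrier M" "b \<in> carrier M"
  shows "s a = s b \<longleftrightarrow> (\<exists>c. c \<preceq> a \<and> c \<preceq> b)"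
  using eq_equiv_class_iff[OF srel_equiv assms] assms by (simp add: sigma_eq srel_iff_le)

lemma s_idem [simp]: "e \<in> E \<Longrightarrow> s e = \<one>\<^sub>G"
  using equiv_class_eq[OF srel_equiv srel_idem] unfolding s_one unfolding sigma_eq .

lemma s_le: "a \<preceq> b \<Longrightarrow> b \<in> carrier M \<Longrightarrow> s a = s b"
  using s_eq_iff le_carrier le_refl by blast

lemma s_dag [simp]:
  assumes "a \<in> carrier M"
  shows "s (a\<dagger>) = inv\<^sub>G s a"
proof (rule G.inv_equality[symmetric])
  have "s (a\<dagger> \<otimes> a) = \<one>\<^sub>G" by (rule s_idem[OF dom_dag_idem[OF assms]])
  then show "s (a\<dagger>) \<otimes>\<^bsub>G\<^esub> s a = \<one>\<^sub>G" using assms by simp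
qed (use assms in auto)

end

section \<open>E-unitary inverse monoids\<close>

locale eunitary = inv_monoid +
  assumes E_unitary: "E_unitary M"
begin

text \<open>A common lower bound \<open>c\<close> puts the idempotent
  \<open>c\<dagger> \<otimes> c\<close> below \<open>a\<dagger> \<otimes> b\<close>. All later uses
  of E-unitarity go through this.\<close>

lemma compatible:
  assumes "a \<in> carrier M" "b \<in> carrier M" "s a = s b"
  shows "a\<dagger> \<otimes> b \<in> E"
proof -
  obtain c where c: "c \<preceq> a" "c \<preceq> b" using assms s_eq_iff by blast
  have "c \<in> carrier M" using c assms le_carrier by blast
  then have "c\<dagger> \<otimes> c \<in> E" "c\<dagger> \<otimes> c \<preceq> a\<dagger> \<otimes> b"
    using c assms by (auto intro: dom_dag_idem le_mult le_dag)
  then show ?thesis using E_unitary assms unfolding E_unitary_def by (blast intro: m_closed dag_closed)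
qed

text \<open>\<open>dom a \<otimes> b = a \<otimes> (a\<dagger> \<otimes> b)\<close> lies below
  \<open>a\<close>, as \<open>a\<dagger> \<otimes> b\<close> is idempotent; having the same
  \<open>dom\<close> as \<open>a\<close>, it equals \<open>a\<close>.\<close>

lemma le_iff:
  assumes a: "a \<in> carrier M" and b: "b \<in> carrier M"
  shows "a \<preceq> b \<longleftrightarrow> s a = s b \<and> dom a \<preceq> dom b"
proof
  assume R: "s a = s b \<and> dom a \<preceq> dom b"
  have "dom a \<otimes> b = a \<otimes> (a\<dagger> \<otimes> b)" using a b by (simp add: dom_def m_assoc)
  then have le: "dom a \<otimes> b \<preceq> a" using compatible[OF a b] R a by (simp add: mult_idem_le)
  have "dom (dom a \<otimes> b) = dom a" using R a b by (simp add: dom_idem_mult idem_le_iff)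
  then have "a = dom a \<otimes> b" using le a by (simp add: le_iff_dom)
  then show "a \<preceq> b" using a dom_idem leI by blast
qed (use assms s_le dom_mono in auto)

lemma eq_if_s_dom:
  assumes "a \<in> carrier M" "b \<in> carrier M" "s a = s b" "dom a = dom b"
  shows "a = b"
  by (rule le_antisym) (use assms le_iff[of a b] le_iff[of b a] in simp_all)

lemma meet:
  assumes a: "a \<in> carrier M" and b: "b \<in> carrier M" and "s a = s b"
  shows "dom a \<otimes> b \<preceq> a" "dom a \<otimes> b \<preceq> b" "c \<preceq> a \<Longrightarrow> c \<preceq> b \<Longrightarrow> c \<preceq> dom a \<otimes> b"
proof -
  have "dom a \<otimes> dom b \<preceq> dom a" using a b by (simp add: mult_idem_le)
  then show "dom a \<otimes> b \<preceq> a" using assms le_iff[of "dom a \<otimes> b" a] by (simp add: dom_idem_mult)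
  show "dom a \<otimes> b \<preceq> b" using assms by (simp add: idem_mult_le)
  assume c: "c \<preceq> a" "c \<preceq> b"
  then have cc: "c \<in> carrier M" using a le_carrier by simp
  have "dom c \<otimes> c \<preceq> dom a \<otimes> b" using c a b by (auto intro: le_mult dom_mono)
  then show "c \<preceq> dom a \<otimes> b" using cc by simp
qed

text \<open>A running meet stays in the common \<sigma>-class, being below its members, so
  \<open>meet\<close> can be applied again.\<close>

lemma finite_glb:
  assumes "finite T" "T \<noteq> {}" "T \<subseteq> carrier M" "\<And>a b. a \<in> T \<Longrightarrow> b \<in> T \<Longrightarrow> s a = s b"
  shows "\<exists>m\<in>carrier M. (\<forall>t\<in>T. m \<preceq> t) \<and> (\<forall>c. (\<forall>t\<in>T. c \<preceq> t) \<longrightarrow> c \<preceq> m)"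
  using assms
proof (induction rule: finite_ne_induct)
  case (singleton x)
  then show ?case by (intro bexI[of _ x]) auto
next
  case (insert x T)
  then obtain m where m: "m \<in> carrier M" "\<forall>t\<in>T. m \<preceq> t" "\<forall>c. (\<forall>t\<in>T. c \<preceq> t) \<longrightarrow> c \<preceq> m" by auto
  obtain t where t: "t \<in> T" using insert by auto
  have x: "x \<in> carrier M" and T: "T \<subseteq> carrier M" using insert by auto
  have "s m = s t" using m t T s_le by blast
  also have "s t = s x" using insert t by auto
  finally have "s x = s m" by simp
  note meet = meet[OF x m(1) this]
  show ?case
  proof (intro bexI[of _ "dom x \<otimes> m"] conjI ballI allI impI)
    fix u assume "u \<in> Set.insert x T"
    then show "dom x \<otimes> m \<preceq> u" using meet m T le_trans by blast
  next
    fix c assume "\<forall>t\<in>Set.insert x T. c \<preceq> t"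
    then show "c \<preceq> dom x \<otimes> m" using meet m by auto
  qed (use x m in auto)
qed

end

section \<open>Paths and connected subgraphs\<close>

lemma inv_word_simps [simp]:
  "inv_word [] = []" "inv_word ((e, b) # p) = inv_word p @ [(e, \<not> b)]"
  "inv_word (p @ q) = inv_word q @ inv_word p" "inv_word (inv_word p) = p"
  by (simp_all add: inv_word_def rev_map comp_def case_prod_beta)

lemma set_inv_word: "set (inv_word p) = (\<lambda>(e, b). (e, \<not> b)) ` set p"
  by (simp add: inv_word_def)

text \<open>The same notion as the library's subgraphs, applied to \<open>as_graph D X\<close> (see
  \<open>subgr_iff\<close>), in a form that speaks of sets only.\<close>

definition subgr :: "('v, 'e) pre_digraph \<Rightarrow> ('v, 'e) subgr \<Rightarrow> bool" where
  "subgr D X \<longleftrightarrow> fst X \<subseteq> verts D \<and> snd X \<subseteq> arcs D \<and> (\<forall>e\<in>snd X. tail D e \<in> fst X \<and> head D e \<in> fst X)"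

context wf_digraph
begin

lemma gpath_verts: "gpath G i p j \<Longrightarrow> i \<in> verts G \<and> j \<in> verts G"
proof (induction p arbitrary: i)
  case (Cons x p)
  then show ?case by (cases x) (auto split: if_splits)
qed simp

lemma gpath_append: "gpath G i (p @ q) k \<longleftrightarrow> (\<exists>j. gpath G i p j \<and> gpath G j q k)"
proof (induction p arbitrary: i)
  case Nil
  then show ?case using gpath_verts by auto
next
  case (Cons x p)
  then show ?case by (cases x) auto
qed

lemma gpath_inv: "gpath G i p j \<Longrightarrow> gpath G j (inv_word p) i"
proof (induction p arbitrary: i)
  case (Cons x p)
  then show ?case by (cases x) (auto simp: gpath_append split: if_splits)
qed simp

lemma gpath_words: "gpath G i p j \<Longrightarrow> p \<in> words (arcs G)"
proof (induction p arbitrary: i)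
  case (Cons x p)
  then show ?case by (cases x) auto
qed simp

lemma start_in_spanned [simp]: "i \<in> fst (spanned G i p)"
  by (simp add: spanned_def)

lemma spanned_append:
  "gpath G i p j \<Longrightarrow> spanned G i (p @ q) = sup (spanned G i p) (spanned G j q)"
proof (induction p arbitrary: i)
  case (Cons x p)
  obtain e b where x: "x = (e, b)" by fastforce
  have "spanned G i (x # r) = sup ({i, tail G e, head G e}, {e})
      (spanned G (if b then head G e else tail G e) r)" for r
    by (auto simp: spanned_def x)
  moreover have "gpath G (if b then head G e else tail G e) p j" using Cons.prems x by simp
  ultimately show ?case using Cons.IH by (simp add: sup_assoc)
qed (auto simp: spanned_def)

lemma spanned_end: "gpath G i p j \<Longrightarrow> j \<in> fst (spanned G i p)"
  using spanned_append[of i p j "[]"] by (metis append_Nil2 fst_sup in_mono start_in_spanned sup_ge2)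

lemma spanned_inv: "gpath G i p j \<Longrightarrow> spanned G j (inv_word p) = spanned G i p"
proof -
  assume p: "gpath G i p j"
  have "spanned G j (inv_word p) = (insert j (\<Union>(e, b)\<in>set p. {tail G e, head G e}), fst ` set p)"
    by (auto simp: spanned_def set_inv_word image_iff split: prod.splits) force+
  moreover have "i \<in> fst (spanned G j (inv_word p))" "j \<in> fst (spanned G i p)"
    using spanned_end gpath_inv p by blast+
  ultimately show ?thesis by (auto simp: spanned_def)
qed

lemma spanned_le_iff:
  assumes "subgr G X" "gpath G i p j"
  shows "spanned G i p \<le> X \<longleftrightarrow> i \<in> fst X \<and> fst ` set p \<subseteq> snd X"
  using assms by (auto simp: subgr_def spanned_def less_eq_prod_def)

lemma spanned_Cons_le_iff:
  assumes "gpath G i ((e, b) # p) j"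
  shows "spanned G i ((e, b) # p) \<le> X \<longleftrightarrow>
    i \<in> fst X \<and> e \<in> snd X \<and> spanned G (if b then head G e else tail G e) p \<le> X"
  using assms by (auto simp: spanned_def less_eq_prod_def)

lemma subgr_spanned: "gpath G i p j \<Longrightarrow> subgr G (spanned G i p)"
  using gpath_verts[of i p j] gpath_words[of i p j]
  by (fastforce simp: subgr_def spanned_def words_def in_lists_conv_set)

lemma subgr_iff: "subgr G X \<longleftrightarrow> subgraph (as_graph G X) G"
  using wf_digraph
  by (auto simp: subgr_def subgraph_def as_graph_def compatible_def wf_digraph_def)

lemma subgr_path_rtrancl:
  assumes X: "subgr G X" and "gpath G i p j" "spanned G i p \<le> X"
  shows "(i, j) \<in> rtrancl_on (fst X) (parcs (mk_symmetric (as_graph G X)))"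
  using assms(2,3)
proof (induction p arbitrary: i)
  case Nil
  then show ?case by (simp add: spanned_def less_eq_prod_def)
next
  case (Cons x p)
  obtain e b where x: "x = (e, b)" by fastforce
  let ?k = "if b then head G e else tail G e"
  have *: "i \<in> fst X" "e \<in> snd X" "spanned G ?k p \<le> X" "gpath G ?k p j"
    using Cons.prems spanned_Cons_le_iff[of i e b p j X] by (auto simp: x)
  have "(i, ?k) \<in> parcs (mk_symmetric (as_graph G X))"
    using Cons.prems * by (auto simp: x parcs_mk_symmetric as_graph_def)
  then show ?case using Cons.IH[OF *(4,3)] *(1) converse_rtrancl_on_into_rtrancl_on by metis
qed

lemma rtrancl_subgr_path:
  assumes X: "subgr G X" and "(i, j) \<in> rtrancl_on (fst X) (parcs (mk_symmetric (as_graph G X)))"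
  shows "\<exists>p. gpath G i p j \<and> spanned G i p \<le> X"
  using assms(2)
proof (induction rule: converse_rtrancl_on_induct)
  case base
  then show ?case using X by (intro exI[of _ "[]"]) (auto simp: subgr_def spanned_def less_eq_prod_def)
next
  case (step x y)
  then obtain p where p: "gpath G y p j" "spanned G y p \<le> X" by blast
  obtain e b where "e \<in> snd X" "x = (if b then tail G e else head G e)" "y = (if b then head G e else tail G e)"
  proof -
    obtain e where "e \<in> snd X" "(x, y) = (tail G e, head G e) \<or> (x, y) = (head G e, tail G e)"
      using step(1) by (auto simp: parcs_mk_symmetric as_graph_def)
    then show thesis using that[of e True] that[of e False] by auto
  qed
  then have "gpath G x ((e, b) # p) j" "spanned G x ((e, b) # p) \<le> X"
    using p X step spanned_Cons_le_iff[of x e b p j X] by (auto simp: subgr_def)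
  then show ?case by blast
qed

text \<open>Turns reachability in the symmetrised graph into signed edge words, the form of path on
  which labels are defined.\<close>

lemma conn_subgraph_iff:
  "conn_subgraph G X \<longleftrightarrow> subgr G X \<and> fst X \<noteq> {} \<and>
     (\<forall>i\<in>fst X. \<forall>j\<in>fst X. \<exists>p. gpath G i p j \<and> spanned G i p \<le> X)"
proof -
  have "arcs_ends (with_proj (mk_symmetric H)) = parcs (mk_symmetric H)" for H :: "('a, 'b) pre_digraph"
    by (auto simp: arcs_ends_conv)
  then have "conn_subgraph G X \<longleftrightarrow> subgr G X \<and> fst X \<noteq> {} \<and>
     (\<forall>i\<in>fst X. \<forall>j\<in>fst X. (i, j) \<in> rtrancl_on (fst X) (parcs (mk_symmetric (as_graph G X))))"
    unfolding conn_subgraph_def connected_def strongly_connected_def subgr_iff[symmetric]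
      reachable_def by (simp add: as_graph_def)
  then show ?thesis using subgr_path_rtrancl rtrancl_subgr_path by metis
qed

lemma conn_subgraphI:
  assumes "subgr G X" "i \<in> fst X"
    and "\<And>j. j \<in> fst X \<Longrightarrow> \<exists>p. gpath G i p j \<and> spanned G i p \<le> X"
  shows "conn_subgraph G X"
  unfolding conn_subgraph_iff
proof (intro conjI ballI)
  fix j k assume "j \<in> fst X" "k \<in> fst X"
  then obtain p q where "gpath G i p j" "spanned G i p \<le> X" "gpath G i q k" "spanned G i q \<le> X"
    using assms(3) by blast
  then have "gpath G j (inv_word p @ q) k \<and> spanned G j (inv_word p @ q) \<le> X"
    using gpath_inv[of i p j] by (auto simp: gpath_append spanned_append spanned_inv)
  then show "\<exists>p. gpath G j p k \<and> spanned G j p \<le> X" by blast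
qed (use assms in auto)

lemma fin_conn_spanned:
  assumes "gpath G i p j"
  shows "fin_conn G (spanned G i p)"
  unfolding fin_conn_def
proof (intro conjI conn_subgraphI[of _ i])
  fix k assume "k \<in> fst (spanned G i p)"
  then show "\<exists>q. gpath G i q k \<and> spanned G i q \<le> spanned G i p"
    using assms
  \<comment> \<open>The last edge is peeled off because it can add only the end vertex
    \<open>j\<close> of the whole path to the vertices already reached.\<close>
  proof (induction p arbitrary: j rule: rev_induct)
    case Nil
    then show ?case by (intro exI[of _ "[]"]) (auto simp: spanned_def)
  next
    case (snoc x p)
    obtain e b where x: "x = (e, b)" by fastforce
    obtain l where l: "gpath G i p l" "gpath G l [x] j" using snoc.prems by (auto simp: gpath_append)
    consider "k \<in> fst (spanned G i p)" | "k = j"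
      using snoc.prems(1) l spanned_end[OF l(1)] unfolding spanned_append[OF l(1)]
      by (auto simp: spanned_def[of G l] x split: if_splits)
    then show ?case
    proof cases
      case 1
      then obtain q where "gpath G i q k" "spanned G i q \<le> spanned G i p"
        using snoc.IH l(1) by auto
      then show ?thesis using l by (auto simp: spanned_append intro: le_supI1)
    next
      case 2
      then show ?thesis using snoc.prems by blast
    qed
  qed
qed (use assms in \<open>auto simp: subgr_spanned, auto simp: spanned_def\<close>)

text \<open>Finiteness permits a single walk: from \<open>i\<close> make an excursion out and back
  for each vertex and for each edge in turn, then go to \<open>j\<close>. This is what makes
  \<open>lam\<close> meaningful on every finite connected graph.\<close>

lemma fin_conn_cover:
  assumes X: "fin_conn G X" and ij: "i \<in> fst X" "j \<in> fst X"
  shows "\<exists>p. gpath G i p j \<and> spanned G i p = X"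
proof -
  have c: "conn_subgraph G X" "finite (fst X)" "finite (snd X)" using X by (auto simp: fin_conn_def)
  then have sub: "subgr G X" by (simp add: conn_subgraph_iff)
  have path: "\<exists>p. gpath G k p l \<and> spanned G k p \<le> X" if "k \<in> fst X" "l \<in> fst X" for k l
    using c that by (simp add: conn_subgraph_iff)
  have V: "\<exists>p. gpath G i p i \<and> spanned G i p \<le> X \<and> W \<subseteq> fst (spanned G i p)"
    if "finite W" "W \<subseteq> fst X" for W
    using that
  proof (induction W rule: finite_induct)
    case empty
    then show ?case using path ij by blast
  next
    case (insert v W)
    obtain p where p: "gpath G i p i" "spanned G i p \<le> X" "W \<subseteq> fst (spanned G i p)"
      using insert by auto
    obtain q where q: "gpath G i q v" "spanned G i q \<le> X" using path insert ij by blast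
    have "gpath G i (p @ q @ inv_word q) i" "spanned G i (p @ q @ inv_word q) \<le> X"
      "Set.insert v W \<subseteq> fst (spanned G i (p @ q @ inv_word q))"
      using p q gpath_inv[OF q(1)] spanned_end[OF q(1)]
      by (auto simp: gpath_append spanned_append spanned_inv)
    then show ?case by blast
  qed
  have A: "\<exists>p. gpath G i p i \<and> spanned G i p \<le> X \<and> W \<subseteq> snd (spanned G i p)"
    if "finite W" "W \<subseteq> snd X" for W
    using that
  proof (induction W rule: finite_induct)
    case empty
    then show ?case using path ij by blast
  next
    case (insert e W)
    obtain p where p: "gpath G i p i" "spanned G i p \<le> X" "W \<subseteq> snd (spanned G i p)"
      using insert by auto
    have e: "e \<in> snd X" "tail G e \<in> fst X" "e \<in> arcs G" using insert sub by (auto simp: subgr_def)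
    obtain q where q: "gpath G i q (tail G e)" "spanned G i q \<le> X" using path e ij by blast
    let ?q = "q @ [(e, True)]"
    have q': "gpath G i ?q (head G e)" using q e by (auto simp: gpath_append)
    then have q'': "spanned G i ?q \<le> X" using q e ij sub by (auto simp: spanned_le_iff)
    have "e \<in> snd (spanned G i ?q)" by (auto simp: spanned_def)
    then have "gpath G i (p @ ?q @ inv_word ?q) i" "spanned G i (p @ ?q @ inv_word ?q) \<le> X"
      "Set.insert e W \<subseteq> snd (spanned G i (p @ ?q @ inv_word ?q))"
      using p q' q'' gpath_inv[OF q'] spanned_append[OF p(1), of "?q @ inv_word ?q"]
        spanned_append[OF q', of "inv_word ?q"] spanned_inv[OF q']
        gpath_append[of i p "?q @ inv_word ?q" i] gpath_append[of i ?q "inv_word ?q" i]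
      by (auto simp del: inv_word_simps)
    then show ?case by blast
  qed
  obtain p where p: "gpath G i p i" "spanned G i p \<le> X" "fst X \<subseteq> fst (spanned G i p)" using V c by blast
  obtain q where q: "gpath G i q i" "spanned G i q \<le> X" "snd X \<subseteq> snd (spanned G i q)" using A c by blast
  obtain r where r: "gpath G i r j" "spanned G i r \<le> X" using path ij by blast
  have "gpath G i (p @ q @ r) j" using p q r by (auto simp: gpath_append)
  moreover have "spanned G i (p @ q @ r) = X"
  proof (rule antisym)
    show "spanned G i (p @ q @ r) \<le> X" using p q r by (simp add: spanned_append)
    show "X \<le> spanned G i (p @ q @ r)"
      using p q by (auto simp: spanned_append less_eq_prod_def)
  qed
  ultimately show ?thesis by blast
qed

text \<open>An edge is reached by a path to its tail followed by the edge itself, so a connected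
  graph is exhausted by the paths out of one vertex. Containments between possibly infinite closed
  graphs are thereby checked path by path.\<close>

lemma conn_leI:
  assumes X: "conn_subgraph G X" "i \<in> fst X"
    and le: "\<And>p j. gpath G i p j \<Longrightarrow> spanned G i p \<le> X \<Longrightarrow> spanned G i p \<le> Z"
  shows "X \<le> Z"
proof -
  have sub: "subgr G X" and path: "\<And>v. v \<in> fst X \<Longrightarrow> \<exists>p. gpath G i p v \<and> spanned G i p \<le> X"
    using X by (auto simp: conn_subgraph_iff)
  have "v \<in> fst Z" if "v \<in> fst X" for v
    using path[OF that] le spanned_end by (fastforce simp: less_eq_prod_def)
  moreover have "e \<in> snd Z" if e: "e \<in> snd X" for e
  proof -
    have e': "e \<in> arcs G" "tail G e \<in> fst X" using e sub by (auto simp: subgr_def)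
    then obtain p where p: "gpath G i p (tail G e)" "spanned G i p \<le> X" using path by blast
    then have q: "gpath G i (p @ [(e, True)]) (head G e)" using e' by (auto simp: gpath_append)
    then have "spanned G i (p @ [(e, True)]) \<le> Z"
      using p e sub X(2) by (intro le[OF q]) (auto simp: spanned_le_iff)
    then show ?thesis by (auto simp: spanned_def less_eq_prod_def)
  qed
  ultimately show ?thesis by (auto simp: less_eq_prod_def)
qed

end

section \<open>Cayley graphs\<close>

lemma cayley_simps [simp]:
  "verts (cayley M C) = carrier (max_group M)"
  "tail (cayley M C) (g, m, h) = g" "head (cayley M C) (g, m, h) = h"
  "(g, m, h) \<in> arcs (cayley M C) \<longleftrightarrow>
     g \<in> carrier (max_group M) \<and> m \<in> C \<and> h = g \<otimes>\<^bsub>max_group M\<^esub> sigma_class M m"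
  by (auto simp: cayley_def)

lemma tail_cayley: "tail (cayley M C) = fst" and head_cayley: "head (cayley M C) = snd \<circ> snd"
  by (auto simp: cayley_def)

text \<open>Tail and head are read off the triple, so a path spans the same subgraph in \<Gamma> and
  in \<open>\<Gamma>\<^sup>I\<close>; the definition of \<open>Ccl\<close> mixes the two.\<close>

lemma spanned_cayley: "spanned (cayley M C) = spanned (cayley M D)"
  by (simp add: spanned_def fun_eq_iff tail_cayley head_cayley)

definition gact :: "('m, 'b) monoid_scheme \<Rightarrow> 'm set \<Rightarrow> 'm edge word \<Rightarrow> 'm edge word" where
  "gact M g = map (apfst (edge_act M g))"

lemma gact_simps [simp]:
  "gact M g [] = []" "gact M g (p @ q) = gact M g p @ gact M g q"
  "gact M g ((e, b) # p) = (edge_act M g e, b) # gact M g p"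
  by (simp_all add: gact_def)

lemma gact_inv: "gact M g (inv_word p) = inv_word (gact M g p)"
  by (induction p) auto

lemma path_label_gact [simp]: "path_label M (gact M g p) = path_label M p"
  by (induction p) (auto simp: edge_act_def)

context inv_monoid
begin

lemma G_cancel [simp]:
  assumes "g \<in> carrier G" "h \<in> carrier G"
  shows "g \<cdot> (inv\<^sub>G g \<cdot> h) = h" "inv\<^sub>G g \<cdot> (g \<cdot> h) = h"
  using assms by (simp_all add: G.m_assoc[symmetric])

lemma gpath_mono: "gpath (cayley M C) i p j \<Longrightarrow> C \<subseteq> D \<Longrightarrow> gpath (cayley M D) i p j"
proof (induction p arbitrary: i)
  case (Cons x p)
  then show ?case by (cases x; cases "fst x") auto
qed simp

lemma path_label_closed [simp]:
  assumes "C \<subseteq> carrier M"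
  shows "gpath (cayley M C) i p j \<Longrightarrow> path_label M p \<in> carrier M"
proof (induction p arbitrary: i)
  case (Cons x p)
  then show ?case using assms by (cases x; cases "fst x") auto
qed simp

end

locale cayley_graph = inv_monoid +
  fixes C :: "'a set"
  assumes C_sub: "C \<subseteq> carrier M"
begin

abbreviation \<Gamma> where "\<Gamma> \<equiv> cayley M C"
abbreviation lab where "lab \<equiv> path_label M"

sublocale D: wf_digraph \<Gamma>
  using C_sub by unfold_locales (auto simp: cayley_def)

lemma label_closed [simp]: "gpath \<Gamma> i p j \<Longrightarrow> lab p \<in> carrier M"
  using C_sub by simp

lemma label_append:
  assumes "gpath \<Gamma> i p j" "gpath \<Gamma> j q k"
  shows "lab (p @ q) = lab p \<otimes> lab q"
  using assms
proof (induction p arbitrary: i)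
  case (Cons x p)
  obtain g m h b where x: "x = ((g, m, h), b)" by (cases x) auto
  have "m \<in> carrier M" using Cons.prems C_sub by (auto simp: x)
  then show ?case using Cons label_closed by (auto simp: x m_assoc)
qed simp

lemma label_inv: "gpath \<Gamma> i p j \<Longrightarrow> lab (inv_word p) = (lab p)\<dagger>"
proof (induction p arbitrary: i)
  case (Cons x p)
  obtain g m h b where x: "x = ((g, m, h), b)" by (cases x) auto
  have m: "m \<in> carrier M" using Cons.prems C_sub by (auto simp: x)
  obtain k where k: "gpath \<Gamma> i [x] k" "gpath \<Gamma> k p j"
    using Cons.prems D.gpath_append[of i "[x]" p j] by auto
  have "lab (inv_word (x # p)) = lab (inv_word p @ inv_word [x])"
    by (simp add: x)
  also have "\<dots> = lab (inv_word p) \<otimes> lab (inv_word [x])"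
    using k D.gpath_inv label_append by blast
  also have "\<dots> = (lab (x # p))\<dagger>"
    using Cons.IH[OF k(2)] m label_closed[OF k(2)] by (auto simp: x dag_mult)
  finally show ?case .
qed simp

lemma end_eq: "gpath \<Gamma> i p j \<Longrightarrow> j = i \<cdot> s (lab p)"
proof (induction p arbitrary: i)
  case Nil
  then show ?case by auto
next
  case (Cons x p)
  obtain g m h b where x: "x = ((g, m, h), b)" by (cases x) auto
  let ?k = "if b then h else g"
  have *: "gpath \<Gamma> ?k p j" "m \<in> carrier M" "g \<in> carrier G" "h = g \<cdot> s m" "i = (if b then g else h)"
    using Cons.prems C_sub by (auto simp: x)
  show ?case using Cons.IH[OF *(1)] * label_closed[OF *(1)]
    by (auto simp: x G.m_assoc)
qed

lemma edge_act_arcs [simp]: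
  "g \<in> carrier G \<Longrightarrow> e \<in> arcs \<Gamma> \<Longrightarrow> edge_act M g e \<in> arcs \<Gamma>"
  using C_sub by (cases e) (auto simp: edge_act_def G.m_assoc)

lemma edge_act_act:
  "g \<in> carrier G \<Longrightarrow> h \<in> carrier G \<Longrightarrow> e \<in> arcs \<Gamma> \<Longrightarrow>
     edge_act M g (edge_act M h e) = edge_act M (g \<cdot> h) e"
  using C_sub by (cases e) (auto simp: edge_act_def G.m_assoc)

lemma edge_act_one [simp]: "e \<in> arcs \<Gamma> \<Longrightarrow> edge_act M \<one>\<^sub>G e = e"
  using C_sub by (cases e) (auto simp: edge_act_def)

lemma gact_words: "g \<in> carrier G \<Longrightarrow> p \<in> words (arcs \<Gamma>) \<Longrightarrow> gact M g p \<in> words (arcs \<Gamma>)"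
proof (induction p)
  case (Cons x p)
  then show ?case by (cases x) auto
qed simp

lemma gact_gact:
  "g \<in> carrier G \<Longrightarrow> h \<in> carrier G \<Longrightarrow> p \<in> words (arcs \<Gamma>) \<Longrightarrow>
     gact M g (gact M h p) = gact M (g \<cdot> h) p"
proof (induction p)
  case (Cons x p)
  then show ?case by (cases x) (auto simp: edge_act_act)
qed simp

lemma gact_one [simp]: "p \<in> words (arcs \<Gamma>) \<Longrightarrow> gact M \<one>\<^sub>G p = p"
proof (induction p)
  case (Cons x p)
  then show ?case by (cases x) auto
qed simp

lemma gpath_gact:
  assumes g: "g \<in> carrier G"
  shows "gpath \<Gamma> i p j \<Longrightarrow> gpath \<Gamma> (g \<cdot> i) (gact M g p) (g \<cdot> j)"
proof (induction p arbitrary: i)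
  case Nil
  then show ?case using g by auto
next
  case (Cons x p)
  obtain a m h b where x: "x = ((a, m, h), b)" by (cases x) auto
  have "edge_act M g (a, m, h) \<in> arcs \<Gamma>" using Cons.prems g by (intro edge_act_arcs) (auto simp: x)
  then show ?case using Cons.IH[of "if b then h else a"] Cons.prems
    by (auto simp: x edge_act_def)
qed

end

section \<open>Closed subgraphs\<close>

locale generated = cayley_graph M B + eunitary M for M (structure) and B +
  assumes B_gen: "inv_gen M B = carrier M"
begin

abbreviation cl where "cl \<equiv> closure M B"

text \<open>The Schuetzenberger graph of the idempotent \<open>e\<close>, drawn in \<open>\<Gamma>\<^sup>I\<close> from the vertex \<open>i\<close>: as \<open>M\<close>
  is \<open>E\<close>-unitary, \<open>\<sigma>\<close> is injective on the \<open>\<R>\<close>-class \<open>{m. dom m = e}\<close>.\<close>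

definition S :: "'a set \<Rightarrow> 'a \<Rightarrow> ('a set, 'a edge) subgr" where
  "S i e = ({i \<cdot> s m | m. m \<in> carrier M \<and> dom m = e},
     {(i \<cdot> s m, b, i \<cdot> s m \<cdot> s b) | m b. m \<in> carrier M \<and> dom m = e \<and> b \<in> B \<and> dom (m \<otimes> b) = e})"

lemma S_vert: "v \<in> fst (S i e) \<longleftrightarrow> (\<exists>m\<in>carrier M. dom m = e \<and> v = i \<cdot> s m)"
  and S_arc: "(g, b, h) \<in> snd (S i e) \<longleftrightarrow>
    (\<exists>m\<in>carrier M. dom m = e \<and> b \<in> B \<and> dom (m \<otimes> b) = e \<and> g = i \<cdot> s m \<and> h = i \<cdot> s m \<cdot> s b)"
  by (auto simp: S_def)

lemma B_carrier: "b \<in> B \<Longrightarrow> b \<in> carrier M"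
  using C_sub by auto

lemma base_in_S [simp]: "i \<in> carrier G \<Longrightarrow> e \<in> E \<Longrightarrow> i \<in> fst (S i e)"
  unfolding S_vert by (rule bexI[of _ e]) simp_all

lemma S_subgr: "i \<in> carrier G \<Longrightarrow> subgr \<Gamma> (S i e)"
  using B_carrier
  by (auto simp: subgr_def S_vert S_arc G.m_assoc) (auto simp flip: s_mult)

section \<open>Labels of paths and containment in the graphs \<open>S i e\<close>\<close>

lemma path_ex:
  assumes "m \<in> carrier M"
  shows "i \<in> carrier G \<Longrightarrow> \<exists>p. gpath \<Gamma> i p (i \<cdot> s m) \<and> lab p = m"
proof -
  have "m \<in> inv_gen M B" using assms B_gen by simp
  then show "i \<in> carrier G \<Longrightarrow> \<exists>p. gpath \<Gamma> i p (i \<cdot> s m) \<and> lab p = m"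
  proof (induction arbitrary: i)
    case one
    then show ?case by (intro exI[of _ "[]"]) auto
  next
    case (incl b)
    then show ?case using B_carrier by (intro exI[of _ "[((i, b, i \<cdot> s b), True)]"]) auto
  next
    case (mult a b)
    have ab: "a \<in> carrier M" "b \<in> carrier M" using mult B_gen by auto
    then have ia: "i \<cdot> s a \<in> carrier G" using mult.prems by simp
    obtain p q where "gpath \<Gamma> i p (i \<cdot> s a)" "lab p = a"
      "gpath \<Gamma> (i \<cdot> s a) q (i \<cdot> s a \<cdot> s b)" "lab q = b"
      using mult.IH(1)[OF mult.prems] mult.IH(2)[OF ia] by blast
    then show ?case using ab mult.prems
      by (intro exI[of _ "p @ q"]) (auto simp: D.gpath_append label_append G.m_assoc)
  next
    case (inverse a)
    have a: "a \<in> carrier M" using inverse B_gen by auto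
    \<comment> \<open>The path for \<open>a\<close> starts at
      \<open>i \<cdot> inv\<^sub>G s a\<close>, so that it ends at \<open>i\<close> and its reversal
      starts there.\<close>
    obtain p where "gpath \<Gamma> (i \<cdot> inv\<^sub>G s a) p (i \<cdot> inv\<^sub>G s a \<cdot> s a)" "lab p = a"
      using inverse.IH[of "i \<cdot> inv\<^sub>G s a"] inverse.prems a by auto
    then show ?case using a inverse.prems D.gpath_inv label_inv
      by (intro exI[of _ "inv_word p"]) (auto simp: G.m_assoc)
  qed
qed

text \<open>Along a path \<open>dom\<close> of the accumulated product can only decrease, so if the
  initial value survives to the end, it was there at every step between.\<close>

lemma dom_mult_eq:
  assumes "m \<in> carrier M" "x \<in> carrier M" "y \<in> carrier M" "dom (m \<otimes> x \<otimes> y) = dom m"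
  shows "dom (m \<otimes> x) = dom m"
proof (rule le_antisym)
  show "dom m \<preceq> dom (m \<otimes> x)" using dom_mult_le[of "m \<otimes> x" y] assms by simp
qed (use assms dom_mult_le in auto)

text \<open>The induction keeps the base vertex \<open>i\<close> fixed and lets \<open>m\<close>
  move: after a step with signed label \<open>c\<close> the current vertex belongs to
  \<open>m \<otimes> c\<close>.\<close>

lemma S_path_iff:
  assumes "i \<in> carrier G"
  shows "m \<in> carrier M \<Longrightarrow> gpath \<Gamma> (i \<cdot> s m) p j \<Longrightarrow>
    spanned \<Gamma> (i \<cdot> s m) p \<le> S i (dom m) \<longleftrightarrow> dom (m \<otimes> lab p) = dom m"
proof (induction p arbitrary: m)
  case Nil
  then show ?case by (auto simp: spanned_def less_eq_prod_def S_vert)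
next
  case (Cons x p)
  obtain g b h t where x: "x = ((g, b, h), t)" by (cases x) auto
  define k where "k = (if t then h else g)"
  define c where "c = (if t then b else b\<dagger>)"
  have b: "b \<in> B" "b \<in> carrier M" and g: "g \<in> carrier G" "h = g \<cdot> s b" and gp: "gpath \<Gamma> k p j"
    and im: "i \<cdot> s m = (if t then g else h)"
    using Cons.prems B_carrier by (auto simp: x k_def)
  have c: "c \<in> carrier M" using b by (simp add: c_def)
  have k: "k = i \<cdot> s (m \<otimes> c)"
    using im b g Cons.prems assms by (auto simp: k_def c_def G.m_assoc[symmetric] G.inv_solve_right split: if_splits)
  have p: "lab p \<in> carrier M" using gp by simp
  \<comment> \<open>\<open>S\<close> records an edge through the element \<open>n\<close> at its
    tail. Since \<sigma> is injective on the \<R>-class, \<open>n = m\<close> for a forward step and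
    \<open>n \<otimes> b = m\<close> for a backward one.\<close>
  have edge: "(g, b, h) \<in> snd (S i (dom m)) \<longleftrightarrow> dom (m \<otimes> c) = dom m"
  proof
    assume "(g, b, h) \<in> snd (S i (dom m))"
    then obtain n where n: "n \<in> carrier M" "dom n = dom m" "dom (n \<otimes> b) = dom m" "g = i \<cdot> s n"
      by (auto simp: S_arc)
    show "dom (m \<otimes> c) = dom m"
    proof (cases t)
      case True
      then have "s n = s m" using im n assms Cons.prems by auto
      then have "n = m" using n eq_if_s_dom Cons.prems by blast
      then show ?thesis using n True by (simp add: c_def)
    next
      case False
      then have "i \<cdot> s (n \<otimes> b) = i \<cdot> s m" using im n assms Cons.prems g b by (auto simp: G.m_assoc)
      then have "s (n \<otimes> b) = s m" using n b assms Cons.prems by (simp del: s_mult)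
      then have "n \<otimes> b = m" using n b eq_if_s_dom[of "n \<otimes> b" m] Cons.prems by simp
      then have "m \<otimes> c = n \<otimes> (b \<otimes> b\<dagger>)" using n b False by (auto simp: c_def m_assoc)
      then have "m \<otimes> c = n \<otimes> dom b" by (simp add: dom_def)
      then have "dom (m \<otimes> c) = dom (n \<otimes> b)"
        using n b by (simp add: dom_mult)
      then show ?thesis using n by simp
    qed
  next
    assume dom: "dom (m \<otimes> c) = dom m"
    show "(g, b, h) \<in> snd (S i (dom m))"
    proof (cases t)
      case True
      then show ?thesis using dom im b g Cons.prems by (auto simp: c_def S_arc)
    next
      case False
      have "m \<otimes> c \<otimes> b = m \<otimes> dom (b\<dagger>)"
        using b Cons.prems False by (simp add: c_def m_assoc dom_def)
      then have "dom (m \<otimes> c \<otimes> b) = dom (m \<otimes> c)"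
        using Cons.prems b False by (simp add: dom_mult c_def)
      then show ?thesis using dom k c b g Cons.prems False
        unfolding S_arc by (intro bexI[of _ "m \<otimes> c"]) (auto simp: k_def G.m_assoc)
    qed
  qed
  have lab: "m \<otimes> lab (x # p) = m \<otimes> c \<otimes> lab p"
    using Cons.prems c p by (simp add: x c_def m_assoc)
  have start: "i \<cdot> s m \<in> fst (S i (dom m))" using Cons.prems by (auto simp: S_vert)
  have "spanned \<Gamma> (i \<cdot> s m) (x # p) \<le> S i (dom m) \<longleftrightarrow>
      dom (m \<otimes> c) = dom m \<and> spanned \<Gamma> k p \<le> S i (dom m)"
    using D.spanned_Cons_le_iff[of "i \<cdot> s m" "(g, b, h)" t p j] Cons.prems start edge
    by (auto simp: x k_def)
  also have "\<dots> \<longleftrightarrow> dom (m \<otimes> c) = dom m \<and> dom (m \<otimes> c \<otimes> lab p) = dom m"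
    using Cons.IH[of "m \<otimes> c"] gp k c Cons.prems by auto
  also have "\<dots> \<longleftrightarrow> dom (m \<otimes> lab (x # p)) = dom m"
    unfolding lab using dom_mult_eq[OF Cons.prems(1) c p] by auto
  finally show ?case .
qed

text \<open>The dictionary between graphs and order: start \<open>S_path_iff\<close> at
  \<open>e\<close> itself and use
  \<open>dom (e \<otimes> lab p) = e \<otimes> dom (lab p)\<close>.\<close>

lemma spanned_le_S:
  assumes "gpath \<Gamma> i p j" "e \<in> E"
  shows "spanned \<Gamma> i p \<le> S i e \<longleftrightarrow> e \<preceq> dom (lab p)"
proof -
  have i: "i \<in> carrier G" using D.gpath_verts assms by auto
  have l: "lab p \<in> carrier M" using assms by simp
  show ?thesis using S_path_iff[of i e p j] i assms l by (auto simp: dom_idem_mult idem_le_iff)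
qed

lemma spanned_self_le_S: "gpath \<Gamma> i p j \<Longrightarrow> spanned \<Gamma> i p \<le> S i (dom (lab p))"
  using spanned_le_S[of i p j "dom (lab p)"] by simp

text \<open>Left multiplication by \<open>e\<close> takes the \<R>-class of \<open>f\<close> into
  that of \<open>e\<close> without changing \<sigma>-classes, hence without moving vertices.\<close>

lemma S_mono:
  assumes "i \<in> carrier G" "e \<in> E" "f \<in> E" "e \<preceq> f"
  shows "S i f \<le> S i e"
proof -
  have *: "dom (e \<otimes> m) = e \<and> s (e \<otimes> m) = s m" if "m \<in> carrier M" "dom m = f" for m
    using that assms by (simp add: dom_idem_mult idem_le_iff)
  show ?thesis unfolding less_eq_prod_def
  proof (intro conjI subsetI)
    fix v assume "v \<in> fst (S i f)"
    then obtain m where "m \<in> carrier M" "dom m = f" "v = i \<cdot> s m" by (auto simp: S_vert)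
    then show "v \<in> fst (S i e)" using * assms unfolding S_vert by (intro bexI[of _ "e \<otimes> m"]) auto
  next
    fix x assume "x \<in> snd (S i f)"
    then obtain m b where "m \<in> carrier M" "dom m = f" "b \<in> B" "dom (m \<otimes> b) = f"
      "x = (i \<cdot> s m, b, i \<cdot> s m \<cdot> s b)" by (auto simp: S_def)
    then show "x \<in> snd (S i e)" using *[of m] *[of "m \<otimes> b"] assms B_carrier[of b]
      by (cases x) (simp add: S_arc m_assoc, intro bexI[of _ "e \<otimes> m"], simp_all add: m_assoc)
  qed
qed

text \<open>Left multiplication by \<open>m\<dagger>\<close> takes the \<R>-class of
  \<open>m\<close> to that of \<open>m\<dagger>\<close> and compensates the shift of the base
  vertex. The reverse inclusion is the same one for \<open>m\<dagger>\<close>.\<close>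

lemma S_rebase:
  assumes "i \<in> carrier G" "m \<in> carrier M"
  shows "S i (dom m) = S (i \<cdot> s m) (dom (m\<dagger>))"
proof -
  have le: "S i (dom m) \<le> S (i \<cdot> s m) (dom (m\<dagger>))"
    if "i \<in> carrier G" "m \<in> carrier M" for i m
  proof -
    have *: "dom (m\<dagger> \<otimes> n) = dom (m\<dagger>)" if "n \<in> carrier M" "dom n = dom m" for n
      using that \<open>m \<in> carrier M\<close> by (simp add: dom_mult) (simp add: dom_def m_assoc)
    have **: "i \<cdot> s m \<cdot> s (m\<dagger> \<otimes> n) = i \<cdot> s n" if "n \<in> carrier M" for n
      using that \<open>m \<in> carrier M\<close> \<open>i \<in> carrier G\<close> by (simp add: G.m_assoc)
    show ?thesis unfolding less_eq_prod_def
    proof (intro conjI subsetI)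
      fix v assume "v \<in> fst (S i (dom m))"
      then obtain n where "n \<in> carrier M" "dom n = dom m" "v = i \<cdot> s n" by (auto simp: S_vert)
      then show "v \<in> fst (S (i \<cdot> s m) (dom (m\<dagger>)))"
        using * ** that unfolding S_vert by (intro bexI[of _ "m\<dagger> \<otimes> n"]) (auto simp del: s_mult)
    next
      fix x assume "x \<in> snd (S i (dom m))"
      then obtain n b where n: "n \<in> carrier M" "dom n = dom m" "b \<in> B" "dom (n \<otimes> b) = dom m"
        "x = (i \<cdot> s n, b, i \<cdot> s n \<cdot> s b)" by (auto simp: S_def)
      have "dom (m\<dagger> \<otimes> n \<otimes> b) = dom (m\<dagger>)"
        using *[of "n \<otimes> b"] n that B_carrier[OF n(3)] by (simp add: m_assoc)
      then show "x \<in> snd (S (i \<cdot> s m) (dom (m\<dagger>)))" using *[of n] **[of n] n that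
        by (cases x) (auto simp: S_arc simp del: s_mult intro!: bexI[of _ "m\<dagger> \<otimes> n"])
    qed
  qed
  have "S (i \<cdot> s m) (dom (m\<dagger>)) \<le> S (i \<cdot> s m \<cdot> s (m\<dagger>)) (dom (m\<dagger>\<dagger>))"
    using assms by (intro le) auto
  also have "\<dots> = S i (dom m)" using assms by (simp add: G.m_assoc)
  finally show ?thesis using le assms by (intro antisym) auto
qed

lemma S_conn:
  assumes "i \<in> carrier G" "e \<in> E"
  shows "conn_subgraph \<Gamma> (S i e)"
proof (rule D.conn_subgraphI)
  fix v assume "v \<in> fst (S i e)"
  then obtain m where m: "m \<in> carrier M" "dom m = e" "v = i \<cdot> s m" by (auto simp: S_vert)
  then obtain p where "gpath \<Gamma> i p v" "lab p = m" using path_ex assms by blast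
  then show "\<exists>p. gpath \<Gamma> i p v \<and> spanned \<Gamma> i p \<le> S i e" using spanned_self_le_S m by blast
qed (use assms S_subgr in auto)

text \<open>A path from \<open>i\<close> with label \<open>f\<close> lies in \<open>S i f\<close>,
  and its presence in \<open>S i e\<close> means \<open>e \<preceq> f\<close>.\<close>

lemma S_le_iff:
  assumes "i \<in> carrier G" "e \<in> E" "f \<in> E"
  shows "S i f \<le> S i e \<longleftrightarrow> e \<preceq> f"
proof
  assume le: "S i f \<le> S i e"
  obtain p where p: "gpath \<Gamma> i p (i \<cdot> s f)" "lab p = f" using path_ex assms by (metis idem_carrier)
  have "spanned \<Gamma> i p \<le> S i e" using spanned_self_le_S[OF p(1)] le p assms by auto
  then show "e \<preceq> f" using spanned_le_S[OF p(1)] p assms by simp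
qed (use assms S_mono in auto)

lemma S_inj: "i \<in> carrier G \<Longrightarrow> e \<in> E \<Longrightarrow> f \<in> E \<Longrightarrow> S i e = S i f \<Longrightarrow> e = f"
  by (metis S_le_iff idem_carrier le_antisym order_refl)

text \<open>Minimality of the graph drawn from a path: move the base of \<open>S i e\<close> to the
  start \<open>k\<close> and compare idempotents.\<close>

lemma S_le_S_if_spanned:
  assumes i: "i \<in> carrier G" and e: "e \<in> E" and p: "gpath \<Gamma> k p l" and le: "spanned \<Gamma> k p \<le> S i e"
  shows "S k (dom (lab p)) \<le> S i e"
proof -
  have "k \<in> fst (S i e)" using le by (auto simp: less_eq_prod_def)
  then obtain m where m: "m \<in> carrier M" "dom m = e" "k = i \<cdot> s m" by (auto simp: S_vert)
  then have eq: "S i e = S k (dom (m\<dagger>))" using S_rebase i by blast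
  have "dom (m\<dagger>) \<preceq> dom (lab p)" using le spanned_le_S[OF p] m unfolding eq by simp
  then show ?thesis unfolding eq using m i p by (intro S_mono) auto
qed

lemma S_le_if_paths:
  assumes "i \<in> carrier G" "e \<in> E"
    and "\<And>p j. gpath \<Gamma> i p j \<Longrightarrow> e \<preceq> dom (lab p) \<Longrightarrow> spanned \<Gamma> i p \<le> Z"
  shows "S i e \<le> Z"
  using assms spanned_le_S by (intro D.conn_leI[OF S_conn[OF assms(1,2)] base_in_S]) blast+

section \<open>Labels of connected graphs and the closure operator\<close>

lemma coterminal_le:
  assumes p: "gpath \<Gamma> i p j" and q: "gpath \<Gamma> i q j"
  shows "lab p \<preceq> lab q \<longleftrightarrow> dom (lab p) \<preceq> dom (lab q)"
proof -
  have "i \<in> carrier G" using D.gpath_verts p by auto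
  moreover have "i \<cdot> s (lab p) = i \<cdot> s (lab q)" using end_eq p q by metis
  ultimately have "s (lab p) = s (lab q)" using p q by simp
  then show ?thesis using p q by (simp add: le_iff[of "lab p" "lab q"])
qed

text \<open>Each path lies in the graph \<open>S\<close> drawn from the label of the other one, so
  the labels bound each other. This is the well-definedness of \<open>lam\<close>.\<close>

lemma coterminal_label_eq:
  assumes p: "gpath \<Gamma> i p j" and q: "gpath \<Gamma> i q j" and "spanned \<Gamma> i p = spanned \<Gamma> i q"
  shows "lab p = lab q"
proof -
  have "lab p \<preceq> lab q" "lab q \<preceq> lab p"
    using coterminal_le[OF p q] coterminal_le[OF q p] p q assms(3)
      spanned_le_S[OF p, of "dom (lab q)"] spanned_le_S[OF q, of "dom (lab p)"]
      spanned_self_le_S[OF p] spanned_self_le_S[OF q] by auto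
  then show ?thesis using p q by (intro le_antisym) auto
qed

lemma lam_spanned:
  assumes "gpath \<Gamma> i p j"
  shows "lam M B i j (spanned \<Gamma> i p) = lab p"
  unfolding lam_def using assms coterminal_label_eq by (intro the_equality) blast+

text \<open>A graph \<open>Y\<close> occurring in the closure shares two vertices with the spanned
  graph; walks through both graphs between these vertices have comparable labels, which puts
  \<open>Y\<close> inside \<open>S\<close>. Conversely every path of \<open>S\<close> from
  \<open>i\<close> spans a graph that occurs.\<close>

lemma fc_closure_spanned:
  assumes p: "gpath \<Gamma> i p j"
  shows "fc_closure M B (spanned \<Gamma> i p) = S i (dom (lab p))"
proof (rule antisym)
  let ?X = "spanned \<Gamma> i p" and ?e = "dom (lab p)"
  have i: "i \<in> carrier G" using D.gpath_verts p by auto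
  have e: "?e \<in> E" using p by simp
  have X: "fin_conn \<Gamma> ?X" by (rule D.fin_conn_spanned[OF p])
  show "fc_closure M B ?X \<le> S i ?e"
    unfolding fc_closure_def
  proof (rule Sup_least, clarify)
    fix Y1 Y2 k l assume Y: "fin_conn \<Gamma> (Y1, Y2)" and kl: "k \<in> fst ?X" "l \<in> fst ?X"
      "k \<in> fst (Y1, Y2)" "l \<in> fst (Y1, Y2)" and le: "lam M B k l ?X \<preceq> lam M B k l (Y1, Y2)"
    obtain q where q: "gpath \<Gamma> k q l" "spanned \<Gamma> k q = ?X" using D.fin_conn_cover[OF X kl(1,2)] by blast
    obtain r where r: "gpath \<Gamma> k r l" "spanned \<Gamma> k r = (Y1, Y2)" using D.fin_conn_cover[OF Y kl(3,4)] by blast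
    have "lab q \<preceq> lab r" using le lam_spanned q r by metis
    then have "(Y1, Y2) \<le> S k (dom (lab q))"
      using spanned_le_S[OF r(1)] r coterminal_le[OF q(1) r(1)] q(1) by simp
    also have "\<dots> \<le> S i ?e"
      using S_le_S_if_spanned[OF i e q(1)] q(2) spanned_self_le_S[OF p] by simp
    finally show "(Y1, Y2) \<le> S i ?e" .
  qed
  show "S i ?e \<le> fc_closure M B ?X"
  proof (rule S_le_if_paths[OF i e])
    fix r j assume r: "gpath \<Gamma> i r j" "?e \<preceq> dom (lab r)"
    let ?Y = "spanned \<Gamma> i r"
    have Y: "fin_conn \<Gamma> ?Y" by (rule D.fin_conn_spanned[OF r(1)])
    \<comment> \<open>The end of \<open>r\<close> need not be a vertex of \<open>?X\<close>, so
      labels are compared for closed walks at \<open>i\<close> that span the two graphs.\<close>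
    obtain q where q: "gpath \<Gamma> i q i" "spanned \<Gamma> i q = ?X" using D.fin_conn_cover[OF X D.start_in_spanned D.start_in_spanned] by blast
    obtain t where t: "gpath \<Gamma> i t i" "spanned \<Gamma> i t = ?Y" using D.fin_conn_cover[OF Y D.start_in_spanned D.start_in_spanned] by blast
    have "?Y \<le> S i ?e" using spanned_le_S[OF r(1) e] r by simp
    also have "\<dots> \<le> S i (dom (lab q))"
      using S_le_S_if_spanned[OF i _ p, of "dom (lab q)"] spanned_self_le_S[OF q(1)] q by simp
    finally have "dom (lab q) \<preceq> dom (lab t)"
      using spanned_le_S[OF t(1), of "dom (lab q)"] t q(1) by simp
    then have "lam M B i i ?X \<preceq> lam M B i i ?Y"
      using lam_spanned[OF q(1)] lam_spanned[OF t(1)] q t coterminal_le by simp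
    moreover have "i \<in> fst ?X" "i \<in> fst ?Y" by simp_all
    ultimately show "?Y \<le> fc_closure M B ?X"
      unfolding fc_closure_def using Y by (intro Sup_upper) blast
  qed
qed

lemma closure_mono: "X \<le> Y \<Longrightarrow> cl X \<le> cl Y"
  unfolding closure_def by (rule Sup_subset_mono) (auto intro: order_trans)

text \<open>Any finite connected part of \<open>X\<close> is spanned by a closed walk, whose closed
  graph stays in \<open>S i e\<close> by minimality; \<open>X\<close> itself may be
  disconnected.\<close>

lemma closure_le_S:
  assumes i: "i \<in> carrier G" and e: "e \<in> E" and le: "X \<le> S i e"
  shows "cl X \<le> S i e"
  unfolding closure_def
proof (rule Sup_least)
  fix Z assume "Z \<in> {fc_closure M B Y |Y. fin_conn \<Gamma> Y \<and> Y \<le> X}"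
  then obtain Y where Y: "fin_conn \<Gamma> Y" "Y \<le> X" "Z = fc_closure M B Y" by blast
  then have "fst Y \<noteq> {}" by (auto simp: fin_conn_def D.conn_subgraph_iff)
  then obtain k where "k \<in> fst Y" by auto
  then obtain p where p: "gpath \<Gamma> k p k" "spanned \<Gamma> k p = Y" using D.fin_conn_cover Y by blast
  then have "Z = S k (dom (lab p))" using fc_closure_spanned[OF p(1)] Y by simp
  then show "Z \<le> S i e" using S_le_S_if_spanned[OF i e p(1)] p Y le by simp
qed

lemma S_le_closure:
  assumes "gpath \<Gamma> i p j" "spanned \<Gamma> i p \<le> X"
  shows "S i (dom (lab p)) \<le> cl X"
  unfolding closure_def fc_closure_spanned[OF assms(1), symmetric]
  by (rule Sup_upper) (use assms D.fin_conn_spanned in blast)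

lemma closure_spanned:
  assumes "gpath \<Gamma> i p j"
  shows "cl (spanned \<Gamma> i p) = S i (dom (lab p))"
proof (rule antisym)
  have "i \<in> carrier G" using D.gpath_verts assms by auto
  then show "cl (spanned \<Gamma> i p) \<le> S i (dom (lab p))"
    using closure_le_S spanned_self_le_S assms by simp
qed (use S_le_closure assms in blast)

lemma loop_ex:
  assumes "i \<in> carrier G" "e \<in> E"
  shows "\<exists>p. gpath \<Gamma> i p i \<and> lab p = e"
  using path_ex[of e i] assms by auto

text \<open>Both graphs contain \<open>i\<close>, so loops at \<open>i\<close> with labels
  \<open>e\<close> and \<open>f\<close> can be run one after the other; the concatenation has label
  \<open>e \<otimes> f\<close> and stays in the union.\<close>

lemma closure_join:
  assumes i: "i \<in> carrier G" and e: "e \<in> E" "f \<in> E"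
  shows "cl (sup (S i e) (S i f)) = S i (e \<otimes> f)"
proof (rule antisym)
  have "e \<otimes> f \<preceq> e" "e \<otimes> f \<preceq> f" using e by (auto intro: mult_idem_le idem_mult_le)
  then show "cl (sup (S i e) (S i f)) \<le> S i (e \<otimes> f)"
    using i e by (intro closure_le_S le_supI S_mono) auto
  obtain p q where p: "gpath \<Gamma> i p i" "lab p = e" and q: "gpath \<Gamma> i q i" "lab q = f"
    using loop_ex i e by blast
  have "gpath \<Gamma> i (p @ q) i" using p q by (auto simp: D.gpath_append)
  moreover have "spanned \<Gamma> i (p @ q) \<le> sup (S i e) (S i f)"
    using spanned_self_le_S[OF p(1)] spanned_self_le_S[OF q(1)] p q e D.spanned_append[OF p(1)]
    by (auto intro: le_supI1 le_supI2)
  moreover have "dom (lab (p @ q)) = e \<otimes> f" using p q e label_append[OF p(1) q(1)] by simp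
  ultimately show "S i (e \<otimes> f) \<le> cl (sup (S i e) (S i f))" using S_le_closure by metis
qed

lemma closure_vertex: "i \<in> carrier G \<Longrightarrow> cl ({i}, {}) = S i \<one>"
  using closure_spanned[of i "[]" i] by (simp add: spanned_def)

lemma closure_edge:
  assumes "i \<in> carrier G" "b \<in> B"
  shows "cl ({i, i \<cdot> s b}, {(i, b, i \<cdot> s b)}) = S i (dom b)"
  using closure_spanned[of i "[((i, b, i \<cdot> s b), True)]" "i \<cdot> s b"] assms B_carrier
  by (simp add: spanned_def insert_commute)

section \<open>Closed connected graphs and their joins in terms of \<open>M\<close>\<close>

lemma ClSub_iff: "X \<in> ClSub_fc M B \<longleftrightarrow> (\<exists>i\<in>carrier G. \<exists>e\<in>E. X = S i e)"
proof
  assume "X \<in> ClSub_fc M B"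
  then obtain Y where Y: "fin_conn \<Gamma> Y" "X = cl Y" by (auto simp: ClSub_fc_def)
  then have "fst Y \<noteq> {}" by (auto simp: fin_conn_def D.conn_subgraph_iff)
  then obtain k where k: "k \<in> fst Y" by auto
  then obtain p where p: "gpath \<Gamma> k p k" "spanned \<Gamma> k p = Y" using D.fin_conn_cover Y by blast
  have "X = S k (dom (lab p))" using closure_spanned[OF p(1)] Y(2) p(2) by simp
  moreover have "k \<in> carrier G" "dom (lab p) \<in> E"
    using D.gpath_verts[OF p(1)] label_closed[OF p(1)] by simp_all
  ultimately show "\<exists>i\<in>carrier G. \<exists>e\<in>E. X = S i e" by blast
next
  assume "\<exists>i\<in>carrier G. \<exists>e\<in>E. X = S i e"
  then obtain i e where ie: "i \<in> carrier G" "e \<in> E" "X = S i e" by blast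
  then obtain p where "gpath \<Gamma> i p i" "lab p = e" using loop_ex by blast
  then show "X \<in> ClSub_fc M B"
    unfolding ClSub_fc_def using closure_spanned[of i p i] D.fin_conn_spanned[of i p i] ie
    by (auto intro!: image_eqI[of _ _ "spanned \<Gamma> i p"])
qed

text \<open>If the graph is drawn from \<open>k\<close>, and \<open>i\<close>, \<open>j\<close> are
  the vertices of \<open>m\<close> and \<open>n\<close>, then the element leading from
  \<open>i\<close> to \<open>j\<close> is \<open>m\<dagger> \<otimes> n\<close>.\<close>

lemma ClSub_rooted:
  assumes "X \<in> ClSub_fc M B" "i \<in> fst X" "j \<in> fst X"
  shows "i \<in> carrier G \<and> (\<exists>m\<in>carrier M. X = S i (dom m) \<and> j = i \<cdot> s m)"
proof -
  obtain k e where X: "k \<in> carrier G" "e \<in> E" "X = S k e" using assms ClSub_iff by blast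
  then obtain m n where mn: "m \<in> carrier M" "dom m = e" "i = k \<cdot> s m" "n \<in> carrier M" "dom n = e" "j = k \<cdot> s n"
    using assms by (auto simp: S_vert)
  have "X = S i (dom (m\<dagger>))" using S_rebase[of k m] X mn by simp
  moreover have "dom (m\<dagger> \<otimes> n) = dom (m\<dagger>)"
    using mn by (simp add: dom_mult) (simp add: dom_def m_assoc flip: mn(2))
  moreover have "j = i \<cdot> s (m\<dagger> \<otimes> n)" using X mn by (simp add: G.m_assoc)
  ultimately show ?thesis using mn X by (metis G.m_closed dag_closed m_closed s_closed)
qed

lemma S_dom_in_ClSub:
  assumes im: "i \<in> carrier G" "m \<in> carrier M"
  shows "S i (dom m) \<in> ClSub_fc M B" "i \<in> fst (S i (dom m))" "i \<cdot> s m \<in> fst (S i (dom m))"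
proof -
  show "S i (dom m) \<in> ClSub_fc M B" using im ClSub_iff dom_idem by blast
  show "i \<in> fst (S i (dom m))" using im by simp
  show "i \<cdot> s m \<in> fst (S i (dom m))" using im S_vert by blast
qed

text \<open>Draw both graphs from the middle vertex, join them there, and draw the result from
  \<open>i\<close> again. The way back uses \<open>m \<otimes> dom n\<close> instead of
  \<open>m \<otimes> n\<close>: it has the same \<open>dom\<close> but leads to the middle
  vertex.\<close>

lemma closure_S_mult:
  assumes "i \<in> carrier G" "m \<in> carrier M" "n \<in> carrier M"
  shows "cl (sup (S i (dom m)) (S (i \<cdot> s m) (dom n))) = S i (dom (m \<otimes> n))"
proof -
  let ?k = "i \<cdot> s m" and ?e = "dom (m\<dagger>)"
  have "cl (sup (S i (dom m)) (S ?k (dom n))) = S ?k (?e \<otimes> dom n)"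
    unfolding S_rebase[OF assms(1,2)] using assms by (intro closure_join) auto
  also have "?e \<otimes> dom n = dom ((m \<otimes> dom n)\<dagger>)"
    using assms idem_commute[of ?e "dom n"] idem_mult_conv
    by (simp add: dag_mult dom_mult)
  also have "S ?k (dom ((m \<otimes> dom n)\<dagger>)) = S (i \<cdot> s (m \<otimes> dom n)) (dom ((m \<otimes> dom n)\<dagger>))"
    using assms by simp
  also have "S (i \<cdot> s (m \<otimes> dom n)) (dom ((m \<otimes> dom n)\<dagger>)) = S i (dom (m \<otimes> dom n))"
    using S_rebase[of i "m \<otimes> dom n"] assms by simp
  also have "dom (m \<otimes> dom n) = dom (m \<otimes> n)" using assms by (simp add: dom_mult)
  finally show ?thesis .
qed

lemma subgr_act_S:
  assumes "g \<in> carrier G" "i \<in> carrier G"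
  shows "subgr_act M g (S i e) = S (g \<cdot> i) e"
proof (rule prod_eqI)
  show "fst (subgr_act M g (S i e)) = fst (S (g \<cdot> i) e)"
    using assms by (auto simp: subgr_act_def S_def setcompr_eq_image image_image G.m_assoc intro!: image_cong)
  have *: "g \<cdot> (i \<cdot> s m) = g \<cdot> i \<cdot> s m" if "m \<in> carrier M" for m
    using that assms by (simp add: G.m_assoc)
  have **: "g \<cdot> (i \<cdot> s m \<cdot> s b) = g \<cdot> i \<cdot> s m \<cdot> s b" if "m \<in> carrier M" "b \<in> B" for m b
    using that assms B_carrier by (simp add: G.m_assoc)
  show "snd (subgr_act M g (S i e)) = snd (S (g \<cdot> i) e)"
  proof (intro equalityI subsetI)
    fix x assume "x \<in> snd (subgr_act M g (S i e))"
    then obtain m b where "m \<in> carrier M" "dom m = e" "b \<in> B" "dom (m \<otimes> b) = e"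
      "x = edge_act M g (i \<cdot> s m, b, i \<cdot> s m \<cdot> s b)" by (auto simp: subgr_act_def S_def)
    then show "x \<in> snd (S (g \<cdot> i) e)" using *[of m] **[of m b] by (auto simp: S_def edge_act_def)
  next
    fix x assume "x \<in> snd (S (g \<cdot> i) e)"
    then obtain m b where m: "m \<in> carrier M" "dom m = e" "b \<in> B" "dom (m \<otimes> b) = e"
      "x = (g \<cdot> i \<cdot> s m, b, g \<cdot> i \<cdot> s m \<cdot> s b)" by (auto simp: S_def)
    then have "x = edge_act M g (i \<cdot> s m, b, i \<cdot> s m \<cdot> s b)"
      using *[of m] **[of m b] by (simp add: edge_act_def)
    moreover have "(i \<cdot> s m, b, i \<cdot> s m \<cdot> s b) \<in> snd (S i e)" using m by (auto simp: S_def)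
    ultimately show "x \<in> snd (subgr_act M g (S i e))" by (simp add: subgr_act_def)
  qed
qed

text \<open>Only finitely many closed connected graphs rooted at \<open>i\<close> lie inside a given one; \<open>f\<close> is the
  least idempotent above all of \<open>K\<close>, a meet of finitely many elements.\<close>

lemma component_Inf:
  assumes fin: "finite_above M" and i: "i \<in> carrier G" and K: "K \<subseteq> E" "K \<noteq> {}"
  shows "\<exists>f\<in>E. component \<Gamma> (Inf (S i ` K)) i = S i f"
proof -
  define F where "F = {f \<in> E. \<forall>e\<in>K. e \<preceq> f}"
  obtain e0 where e0: "e0 \<in> K" using K by auto
  then have "finite {n \<in> carrier M. e0 \<preceq> n}" using fin K by (auto simp: finite_above_def)
  then have "finite F" by (rule rev_finite_subset) (use e0 in \<open>auto simp: F_def\<close>)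
  moreover have one: "\<one> \<in> F" using K by (auto simp: F_def intro: idem_le_one)
  ultimately obtain f where f: "f \<in> carrier M" "\<And>t. t \<in> F \<Longrightarrow> f \<preceq> t" "\<And>c. \<forall>t\<in>F. c \<preceq> t \<Longrightarrow> c \<preceq> f"
  proof -
    assume fin: "finite F" "\<one> \<in> F"
    have "\<exists>m\<in>carrier M. (\<forall>t\<in>F. m \<preceq> t) \<and> (\<forall>c. (\<forall>t\<in>F. c \<preceq> t) \<longrightarrow> c \<preceq> m)"
      by (rule finite_glb) (use fin in \<open>auto simp: F_def intro: one_idem\<close>)
    then show thesis using that by blast
  qed
  have "f \<preceq> \<one>" using f one by simp
  then have "dom f \<otimes> \<one> = f" unfolding le_iff_dom[OF one_closed] by metis
  then have fE: "f \<in> E" using dom_idem[OF f(1)] f(1) by simp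
  have Kf: "e \<preceq> f" if "e \<in> K" for e using that f(3) by (auto simp: F_def)
  have "component \<Gamma> (Inf (S i ` K)) i = S i f"
  proof (rule antisym)
    show "S i f \<le> component \<Gamma> (Inf (S i ` K)) i"
      unfolding component_def
      by (rule Sup_upper) (use i K Kf fE S_conn in \<open>auto intro!: INF_greatest S_mono\<close>)
    show "component \<Gamma> (Inf (S i ` K)) i \<le> S i f"
      unfolding component_def
    proof (rule Sup_least, clarify)
      fix Y1 Y2 assume Y: "conn_subgraph \<Gamma> (Y1, Y2)" "(Y1, Y2) \<le> Inf (S i ` K)" "i \<in> fst (Y1, Y2)"
      show "(Y1, Y2) \<le> S i f"
      proof (rule D.conn_leI[OF Y(1,3)])
        fix p j assume p: "gpath \<Gamma> i p j" "spanned \<Gamma> i p \<le> (Y1, Y2)"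
        \<comment> \<open>However the intersection looks away from \<open>i\<close>, a path inside
          it sees only one idempotent, \<open>dom\<close> of its label, and this lies above all of
          \<open>K\<close>.\<close>
        have "e \<preceq> dom (lab p)" if "e \<in> K" for e
        proof -
          have "spanned \<Gamma> i p \<le> S i e"
            using p(2) Y(2) INF_lower[OF that, of "S i"] by (blast intro: order_trans)
          then show ?thesis using spanned_le_S p(1) K that by blast
        qed
        then have "dom (lab p) \<in> F" using p(1) by (auto simp: F_def)
        then show "spanned \<Gamma> i p \<le> S i f" using spanned_le_S[OF p(1) fE] f(2) by blast
      qed
    qed
  qed
  then show ?thesis using fE by blast
qed

end

section \<open>Relatively free groups on the edges of a Cayley graph\<close>

lemma map_inv_word: "map (apfst f) (inv_word u) = inv_word (map (apfst f) u)"
  by (induction u) auto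

lemma relfree_cong_map:
  assumes "f ` X \<subseteq> Y"
  shows "(u, v) \<in> relfree_cong U X \<Longrightarrow> (map (apfst f) u, map (apfst f) v) \<in> relfree_cong U Y"
proof (induction rule: relfree_cong.induct)
  case (refl u)
  then have "map (apfst f) u \<in> words Y" using assms
    by (induction u) (auto simp: words_def image_subset_iff)
  then show ?case by (rule relfree_cong.refl)
next
  case (law w s)
  have "map (apfst f) (subst_word s z) = subst_word (\<lambda>n. map (apfst f) (s n)) z" for z
    by (induction z) (auto simp: subst_word_def map_inv_word)
  moreover have "range (\<lambda>n. map (apfst f) (s n)) \<subseteq> words Y"
    using law(2) assms by (fastforce simp: words_def in_lists_conv_set image_subset_iff)
  ultimately show ?case using relfree_cong.law[OF law(1)] by simp
next
  case (cancel x b)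
  then show ?case using relfree_cong.cancel[of "f x" Y b U] assms by auto
qed (auto intro: relfree_cong.sym relfree_cong.trans relfree_cong.app)

lemma relfree_cong_inv:
  assumes "(u, v) \<in> relfree_cong U X"
  shows "(inv_word u, inv_word v) \<in> relfree_cong U X"
proof -
  have uv: "u \<in> words X" "v \<in> words X" using relfree_cong_words[OF assms] by auto
  then have "word_class U X u = word_class U X v"
    using assms by (simp add: word_class_eq_iff)
  then show ?thesis using uv by (metis relfree_inv word_class_eq_iff words_simps(4))
qed

lemma group_vinv_unique:
  assumes "group H" "a \<in> carrier H" "b \<in> carrier H" "a \<otimes>\<^bsub>H\<^esub> b \<otimes>\<^bsub>H\<^esub> a = a"
  shows "b = inv\<^bsub>H\<^esub> a"
proof -
  interpret H: group H by fact
  have "a \<otimes>\<^bsub>H\<^esub> b = \<one>\<^bsub>H\<^esub>" using assms H.r_cancel_one by (metis H.m_closed)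
  then show ?thesis using assms by (metis H.inv_equality H.inv_comm)
qed

lemma group_inverse_monoid:
  assumes "group H"
  shows "inverse_monoid H"
proof -
  interpret H: group H by fact
  show ?thesis unfolding inverse_monoid_def
  proof (intro conjI ballI)
    fix a assume "a \<in> carrier H"
    then show "\<exists>!b. b \<in> carrier H \<and> a \<otimes>\<^bsub>H\<^esub> b \<otimes>\<^bsub>H\<^esub> a = a \<and> b \<otimes>\<^bsub>H\<^esub> a \<otimes>\<^bsub>H\<^esub> b = b"
      using group_vinv_unique[OF assms] by (intro ex1I[of _ "inv\<^bsub>H\<^esub> a"]) auto
  qed unfold_locales
qed

lemma group_vinv:
  assumes "group H" "a \<in> carrier H"
  shows "vinv H a = inv\<^bsub>H\<^esub> a"
proof -
  interpret H: group H by fact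
  interpret inv_monoid H by unfold_locales (rule group_inverse_monoid[OF assms(1)])
  show ?thesis using assms(2) by (intro dag_eqI) auto
qed

locale free_cayley = cayley_graph M A for M (structure) and A +
  fixes U :: laws
begin

abbreviation "W \<equiv> words (arcs \<Gamma>)"
abbreviation "R \<equiv> relfree U (arcs \<Gamma>)"
abbreviation pc :: "'a edge word \<Rightarrow> 'a edge word set" where "pc p \<equiv> word_class U (arcs \<Gamma>) p"

sublocale R: group R by (rule relfree_group)

lemma pc_mult [simp]: "p \<in> W \<Longrightarrow> q \<in> W \<Longrightarrow> pc p \<otimes>\<^bsub>R\<^esub> pc q = pc (p @ q)"
  by (rule relfree_mult)

lemma pc_carrier [simp]: "p \<in> W \<Longrightarrow> pc p \<in> carrier R"
  using relfree_carrier by blast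

lemma pc_inv [simp]: "p \<in> W \<Longrightarrow> inv\<^bsub>R\<^esub> pc p = pc (inv_word p)"
  by (rule relfree_inv)

lemma pc_one: "\<one>\<^bsub>R\<^esub> = pc []"
  by (rule relfree_one)

lemma pc_cancel [simp]: "p \<in> W \<Longrightarrow> pc (p @ inv_word p) = pc []" "p \<in> W \<Longrightarrow> pc (inv_word p @ p) = pc []"
  using R.r_inv[of "pc p"] R.l_inv[of "pc p"] by (simp_all add: pc_one)

lemma pc_cancel3 [simp]:
  assumes "p \<in> W"
  shows "pc (p @ inv_word p @ p) = pc p" "pc (inv_word p @ p @ inv_word p) = pc (inv_word p)"
  using pc_mult[of p "inv_word p @ p"] pc_mult[of p "[]"]
    pc_mult[of "inv_word p" "p @ inv_word p"] pc_mult[of "inv_word p" "[]"] assms by simp_all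

text \<open>The image of a class lies in one class because renaming letters preserves cancellation
  and laws; it is the whole class because the inverse of \<open>g\<close> acts too.\<close>

lemma gact_image:
  assumes g: "g \<in> carrier G" and p: "p \<in> W"
  shows "map (apfst (edge_act M g)) ` pc p = pc (gact M g p)"
  unfolding gact_def[symmetric]
proof (intro equalityI subsetI)
  have *: "(gact M g u, gact M g v) \<in> relfree_cong U (arcs \<Gamma>)"
    if "(u, v) \<in> relfree_cong U (arcs \<Gamma>)" "g \<in> carrier G" for g u v
    unfolding gact_def using that by (intro relfree_cong_map[of _ "arcs \<Gamma>"]) auto
  {
    fix w assume "w \<in> gact M g ` pc p"
    then show "w \<in> pc (gact M g p)" using * g by auto
  next
    fix w assume w: "w \<in> pc (gact M g p)"
    then have "w \<in> W" using relfree_cong_words by auto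
    have "(gact M (inv\<^sub>G g) (gact M g p), gact M (inv\<^sub>G g) w) \<in> relfree_cong U (arcs \<Gamma>)"
      using * w g by auto
    then have "gact M (inv\<^sub>G g) w \<in> pc p" using g p by (simp add: gact_gact)
    moreover have "w = gact M g (gact M (inv\<^sub>G g) w)" using g \<open>w \<in> W\<close> by (simp add: gact_gact)
    ultimately show "w \<in> gact M g ` pc p" by blast
  }
qed

lemma inv_word_image:
  assumes "p \<in> W"
  shows "inv_word ` pc p = pc (inv_word p)"
proof (intro equalityI subsetI)
  fix w assume "w \<in> pc (inv_word p)"
  then have "inv_word w \<in> pc p" using relfree_cong_inv[of "inv_word p" w] by auto
  then show "w \<in> inv_word ` pc p" by (metis image_eqI inv_word_simps(4))
qed (use relfree_cong_inv in blast)

subsection \<open>The category \<open>F\<^sub>g\<^sub>U(\<Gamma>)\<close> and the group \<open>G\<^sup>U\<close>\<close>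

abbreviation "F \<equiv> Fg M A U"

lemma Fg_simps [simp]:
  "verts F = carrier G" "tail F (i, u, j) = i" "head F (i, u, j) = j"
  "ccomp F (i, u, j) (j', v, k) = (i, u \<otimes>\<^bsub>R\<^esub> v, k)" "cid F i = (i, pc [], i)"
  by (auto simp: Fg_def pc_one)

lemma Fg_arcs: "x \<in> arcs F \<longleftrightarrow> (\<exists>i p j. gpath \<Gamma> i p j \<and> x = (i, pc p, j))"
  by (auto simp: Fg_def)

lemma Fg_arcI [simp]: "gpath \<Gamma> i p j \<Longrightarrow> (i, pc p, j) \<in> arcs F"
  using Fg_arcs by blast

lemma Fg_category: "inverse_category F"
proof
  fix e assume e: "e \<in> arcs F"
  then obtain i p j where p: "gpath \<Gamma> i p j" "e = (i, pc p, j)" by (auto simp: Fg_arcs)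
  have pW: "p \<in> W" using D.gpath_words p by blast
  have v: "i \<in> carrier G" "j \<in> carrier G" using D.gpath_verts p by auto
  show "tail F e \<in> verts F" "head F e \<in> verts F" using p v by auto
  show "ccomp F (cid F (tail F e)) e = e" "ccomp F e (cid F (head F e)) = e" using p pW by auto
  let ?f = "(j, pc (inv_word p), i)"
  show "\<exists>!f. f \<in> arcs F \<and> tail F f = head F e \<and> head F f = tail F e \<and>
      ccomp F (ccomp F e f) e = e \<and> ccomp F (ccomp F f e) f = f"
  proof (rule ex1I[of _ "?f"])
    show "?f \<in> arcs F \<and> tail F ?f = head F e \<and>
      head F ?f = tail F e \<and>
      ccomp F (ccomp F e ?f) e = e \<and>
      ccomp F (ccomp F ?f e) ?f = ?f"
      using p pW D.gpath_inv[OF p(1)] by simp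
    fix f assume f: "f \<in> arcs F \<and> tail F f = head F e \<and> head F f = tail F e \<and>
      ccomp F (ccomp F e f) e = e \<and> ccomp F (ccomp F f e) f = f"
    then obtain q where "gpath \<Gamma> j q i" and f': "f = (j, pc q, i)" using p by (auto simp: Fg_arcs)
    then have q: "q \<in> W" using D.gpath_words by blast
    have "pc p \<otimes>\<^bsub>R\<^esub> pc q \<otimes>\<^bsub>R\<^esub> pc p = pc p" using f p q f' pW by simp
    then have "pc q = inv\<^bsub>R\<^esub> pc p"
      by (rule group_vinv_unique[OF relfree_group pc_carrier[OF pW] pc_carrier[OF q]])
    then show "f = ?f" by (simp only: f' pc_inv[OF pW])
  qed
  fix f assume f: "f \<in> arcs F" "head F e = tail F f"
  obtain l q k where "gpath \<Gamma> l q k" "f = (l, pc q, k)" using f(1) by (auto simp: Fg_arcs)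
  then have q: "gpath \<Gamma> j q k" "f = (j, pc q, k)" using f(2) p by simp_all
  have qW: "q \<in> W" using D.gpath_words q by blast
  have pq: "gpath \<Gamma> i (p @ q) k" using p q by (auto simp: D.gpath_append)
  show "ccomp F e f \<in> arcs F \<and> tail F (ccomp F e f) = tail F e \<and> head F (ccomp F e f) = head F f"
    using p q pq pW qW by simp
  fix g assume g: "g \<in> arcs F" "head F f = tail F g"
  obtain m r n where "gpath \<Gamma> m r n" "g = (m, pc r, n)" using g(1) by (auto simp: Fg_arcs)
  then have r: "gpath \<Gamma> k r n" "g = (k, pc r, n)" using g(2) q by simp_all
  have "r \<in> W" using D.gpath_words r by blast
  then show "ccomp F (ccomp F e f) g = ccomp F e (ccomp F f g)" using p q r pW qW by simp
next
  fix i assume "i \<in> verts F"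
  then show "cid F i \<in> arcs F \<and> tail F (cid F i) = i \<and> head F (cid F i) = i"
    using Fg_arcI[of i "[]" i] by simp
qed

lemma Fg_cinv:
  assumes p: "gpath \<Gamma> i p j"
  shows "cinv F (i, pc p, j) = (j, pc (inv_word p), i)" (is "cinv F ?e = ?f")
  unfolding cinv_def
proof (rule the1_equality[OF inverse_category.inverse[OF Fg_category]])
  have "p \<in> W" using D.gpath_words p by blast
  then show "?f \<in> arcs F \<and> tail F ?f = head F ?e \<and>
      head F ?f = tail F ?e \<and>
      ccomp F (ccomp F ?e ?f) ?e = ?e \<and>
      ccomp F (ccomp F ?f ?e) ?f = ?f"
    using p D.gpath_inv[OF p] by simp
qed (use p in simp)

abbreviation "H \<equiv> GU M A U"

lemma GU_carrier: "x \<in> carrier H \<longleftrightarrow> (\<exists>p g. gpath \<Gamma> \<one>\<^sub>G p g \<and> x = (pc p, g))"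
  by (auto simp: GU_def)

lemma GU_carrierI [simp]: "gpath \<Gamma> \<one>\<^sub>G p g \<Longrightarrow> (pc p, g) \<in> carrier H"
  using GU_carrier by blast

lemma GU_one: "\<one>\<^bsub>H\<^esub> = (pc [], \<one>\<^sub>G)"
  by (simp add: GU_def pc_one)

lemma GU_mult:
  assumes "p \<in> W" "q \<in> W" "g \<in> carrier G"
  shows "(pc p, g) \<otimes>\<^bsub>H\<^esub> (pc q, h) = (pc (p @ gact M g q), g \<cdot> h)"
  using assms by (simp add: GU_def gact_image gact_words)

lemma gpath_gact_one:
  assumes "gpath \<Gamma> \<one>\<^sub>G q h" "g \<in> carrier G"
  shows "gpath \<Gamma> g (gact M g q) (g \<cdot> h)"
  using gpath_gact[OF assms(2,1)] assms(2) by simp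

text \<open>The reversed path starts at \<open>g\<close>; translating by the inverse of
  \<open>g\<close> moves its start back to the identity vertex.\<close>

lemma GU_inv_path:
  assumes "gpath \<Gamma> \<one>\<^sub>G p g"
  shows "gpath \<Gamma> \<one>\<^sub>G (gact M (inv\<^sub>G g) (inv_word p)) (inv\<^sub>G g)"
  using gpath_gact[OF _ D.gpath_inv[OF assms], of "inv\<^sub>G g"] D.gpath_verts[OF assms] by simp

lemma GU_group: "group H"
proof (rule groupI)
  fix x assume x: "x \<in> carrier H"
  then obtain p g where p: "gpath \<Gamma> \<one>\<^sub>G p g" "x = (pc p, g)" by (auto simp: GU_carrier)
  have pW: "p \<in> W" and g: "g \<in> carrier G" using D.gpath_words D.gpath_verts p by fastforce+
  show "\<one>\<^bsub>H\<^esub> \<otimes>\<^bsub>H\<^esub> x = x" using p pW g by (simp add: GU_one GU_mult)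
  have "(pc (gact M (inv\<^sub>G g) (inv_word p)), inv\<^sub>G g) \<otimes>\<^bsub>H\<^esub> x = \<one>\<^bsub>H\<^esub>"
    using p pW g by (simp add: GU_mult gact_words GU_one gact_inv)
  then show "\<exists>y\<in>carrier H. y \<otimes>\<^bsub>H\<^esub> x = \<one>\<^bsub>H\<^esub>" using GU_inv_path[OF p(1)] GU_carrierI by blast
  fix y assume "y \<in> carrier H"
  then obtain q h where q: "gpath \<Gamma> \<one>\<^sub>G q h" "y = (pc q, h)" by (auto simp: GU_carrier)
  have qW: "q \<in> W" and h: "h \<in> carrier G" using D.gpath_words D.gpath_verts q by fastforce+
  have "gpath \<Gamma> \<one>\<^sub>G (p @ gact M g q) (g \<cdot> h)"
    using p gpath_gact_one[OF q(1) g] by (auto simp: D.gpath_append)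
  then show "x \<otimes>\<^bsub>H\<^esub> y \<in> carrier H" using p q pW qW g by (simp add: GU_mult)
  fix z assume "z \<in> carrier H"
  then obtain r k where r: "gpath \<Gamma> \<one>\<^sub>G r k" "z = (pc r, k)" by (auto simp: GU_carrier)
  have "r \<in> W" "k \<in> carrier G" using D.gpath_words D.gpath_verts r by fastforce+
  then show "x \<otimes>\<^bsub>H\<^esub> y \<otimes>\<^bsub>H\<^esub> z = x \<otimes>\<^bsub>H\<^esub> (y \<otimes>\<^bsub>H\<^esub> z)"
    using p q r pW qW g h by (simp add: GU_mult gact_words gact_gact G.m_assoc)
next
  show "\<one>\<^bsub>H\<^esub> \<in> carrier H" unfolding GU_one by (rule GU_carrierI) simp
qed

sublocale H: group H by (rule GU_group)

lemma GU_vinv: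
  assumes p: "gpath \<Gamma> \<one>\<^sub>G p g"
  shows "vinv H (pc p, g) = (pc (gact M (inv\<^sub>G g) (inv_word p)), inv\<^sub>G g)"
proof -
  have pW: "p \<in> W" and g: "g \<in> carrier G" using D.gpath_words D.gpath_verts p by fastforce+
  have "(pc (gact M (inv\<^sub>G g) (inv_word p)), inv\<^sub>G g) \<otimes>\<^bsub>H\<^esub> (pc p, g) = \<one>\<^bsub>H\<^esub>"
    using p pW g by (simp add: GU_mult gact_words GU_one gact_inv)
  then show ?thesis
    using H.inv_equality[of _ "(pc p, g)"] GU_inv_path[OF p] p group_vinv[OF GU_group] GU_carrierI by metis
qed

subsection \<open>Lax functions\<close>

text \<open>All conditions (2)--(5) are equivalent to the existence of such a function, the label of the
  image of an arrow of \<open>F\<^sub>g\<^sub>U(\<Gamma>)\<close> under a canonical dual premorphism.\<close>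

definition lax :: "('a rf_arrow \<Rightarrow> 'a) \<Rightarrow> bool" where
  "lax \<mu> \<longleftrightarrow>
    (\<forall>i p j. gpath \<Gamma> i p j \<longrightarrow> \<mu> (i, pc p, j) \<in> carrier M \<and> lab p \<preceq> \<mu> (i, pc p, j)) \<and>
    (\<forall>i p j q k. gpath \<Gamma> i p j \<longrightarrow> gpath \<Gamma> j q k \<longrightarrow>
       \<mu> (i, pc p, j) \<otimes> \<mu> (j, pc q, k) \<preceq> \<mu> (i, pc (p @ q), k))"

text \<open>Functions obtained from canonical dual premorphisms are prescribed on edges only;
  reading a path letter by letter gives the bound by its label.\<close>

lemma laxI:
  assumes closed: "\<And>i p j. gpath \<Gamma> i p j \<Longrightarrow> \<mu> (i, pc p, j) \<in> carrier M"
    and id: "\<And>i. i \<in> carrier G \<Longrightarrow> \<mu> (i, pc [], i) = \<one>"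
    and edge: "\<And>g a. g \<in> carrier G \<Longrightarrow> a \<in> A \<Longrightarrow> \<mu> (g, pc [((g, a, g \<cdot> s a), True)], g \<cdot> s a) = a"
    and dag: "\<And>i p j. gpath \<Gamma> i p j \<Longrightarrow> \<mu> (j, pc (inv_word p), i) = (\<mu> (i, pc p, j))\<dagger>"
    and mult: "\<And>i p j q k. gpath \<Gamma> i p j \<Longrightarrow> gpath \<Gamma> j q k \<Longrightarrow>
       \<mu> (i, pc p, j) \<otimes> \<mu> (j, pc q, k) \<preceq> \<mu> (i, pc (p @ q), k)"
  shows "lax \<mu>"
proof -
  have "lab p \<preceq> \<mu> (i, pc p, j)" if "gpath \<Gamma> i p j" for i p j
    using that
  proof (induction p arbitrary: i)
    case Nil
    then show ?case using id by auto
  next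
    case (Cons x p)
    obtain g a h b where x: "x = ((g, a, h), b)" by (cases x) auto
    let ?k = "if b then h else g" and ?a = "if b then a else a\<dagger>"
    have *: "g \<in> carrier G" "a \<in> A" "h = g \<cdot> s a" "i = (if b then g else h)" "gpath \<Gamma> ?k p j"
      using Cons.prems by (auto simp: x)
    have x1: "gpath \<Gamma> i [x] ?k" using Cons.prems D.gpath_verts[OF *(5)] by (auto simp: x)
    have "gpath \<Gamma> g [((g, a, h), True)] h" using * C_sub by auto
    then have \<mu>x: "\<mu> (i, pc [x], ?k) = ?a" using edge[of g a] dag[of g "[((g, a, h), True)]" h] * by (auto simp: x)
    have "lab (x # p) = ?a \<otimes> lab p" by (simp add: x)
    also have "\<dots> \<preceq> \<mu> (i, pc [x], ?k) \<otimes> \<mu> (?k, pc p, j)"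
      using Cons.IH[OF *(5)] closed[OF *(5)] closed[OF x1] \<mu>x by (intro le_mult) auto
    finally show ?case
      using le_trans[OF _ mult[OF x1 *(5)]] closed[OF Cons.prems] by simp
  qed
  then show ?thesis using closed mult by (auto simp: lax_def)
qed

lemma lax_closed: "lax \<mu> \<Longrightarrow> gpath \<Gamma> i p j \<Longrightarrow> \<mu> (i, pc p, j) \<in> carrier M"
  and lax_label: "lax \<mu> \<Longrightarrow> gpath \<Gamma> i p j \<Longrightarrow> lab p \<preceq> \<mu> (i, pc p, j)"
  and lax_mult: "lax \<mu> \<Longrightarrow> gpath \<Gamma> i p j \<Longrightarrow> gpath \<Gamma> j q k \<Longrightarrow>
       \<mu> (i, pc p, j) \<otimes> \<mu> (j, pc q, k) \<preceq> \<mu> (i, pc (p @ q), k)"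
  unfolding lax_def by blast+

lemma lax_s:
  assumes "lax \<mu>" "gpath \<Gamma> i p j"
  shows "s (\<mu> (i, pc p, j)) = s (lab p)"
  using s_le[OF lax_label[OF assms]] lax_closed[OF assms] by simp

lemma lax_head: "lax \<mu> \<Longrightarrow> gpath \<Gamma> i p j \<Longrightarrow> j = i \<cdot> s (\<mu> (i, pc p, j))"
  using lax_s end_eq by metis

lemma lax_one: "lax \<mu> \<Longrightarrow> i \<in> carrier G \<Longrightarrow> \<mu> (i, pc [], i) = \<one>"
  using lax_label[of \<mu> i "[]" i] lax_closed[of \<mu> i "[]" i] one_le_imp_eq by simp

lemma lax_edge:
  assumes "lax \<mu>" "A \<subseteq> max_minus M" "g \<in> carrier G" "a \<in> A"
  shows "\<mu> (g, pc [((g, a, g \<cdot> s a), True)], g \<cdot> s a) = a"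
proof -
  have a: "a \<in> carrier M" using assms C_sub by auto
  have p: "gpath \<Gamma> g [((g, a, g \<cdot> s a), True)] (g \<cdot> s a)" using assms a by auto
  show ?thesis using lax_label[OF assms(1) p] lax_closed[OF assms(1) p] assms a
    by (auto simp: max_minus_def)
qed

lemma lax_act:
  assumes \<mu>: "lax \<mu>" and g: "g \<in> carrier G"
  shows "lax (\<lambda>(i, c, j). \<mu> (g \<cdot> i, map (apfst (edge_act M g)) ` c, g \<cdot> j))"
  using \<mu> gpath_gact[OF g] lax_closed[OF \<mu>] lax_label[OF \<mu>] lax_mult[OF \<mu>]
  unfolding lax_def
  by (auto simp: gact_image[OF g] D.gpath_words) (metis path_label_gact)

text \<open>Inversion preserves the order and reverses products both in the groupoid and in
  \<open>M\<close>, so the two reversals cancel.\<close>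

lemma lax_inv:
  assumes \<mu>: "lax \<mu>"
  shows "lax (\<lambda>(i, c, j). (\<mu> (j, inv_word ` c, i))\<dagger>)" (is "lax ?\<mu>")
  unfolding lax_def
proof (intro conjI allI impI)
  fix i p j assume p: "gpath \<Gamma> i p j"
  note p' = D.gpath_words[OF p] D.gpath_inv[OF p]
  show "?\<mu> (i, pc p, j) \<in> carrier M"
    using p' lax_closed[OF \<mu>] by (simp add: inv_word_image)
  have "(lab p)\<dagger> \<preceq> \<mu> (j, pc (inv_word p), i)"
    using lax_label[OF \<mu> p'(2)] p by (simp add: label_inv)
  then show "lab p \<preceq> ?\<mu> (i, pc p, j)"
    using p' p lax_closed[OF \<mu> p'(2)] le_dag[of "(lab p)\<dagger>"] by (simp add: inv_word_image)
  fix q k assume q: "gpath \<Gamma> j q k"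
  note q' = D.gpath_words[OF q] D.gpath_inv[OF q]
  have pq: "gpath \<Gamma> k (inv_word (p @ q)) i" using p' q' by (auto simp: D.gpath_append)
  have "(\<mu> (k, pc (inv_word q), j) \<otimes> \<mu> (j, pc (inv_word p), i))\<dagger> \<preceq> (\<mu> (k, pc (inv_word (p @ q)), i))\<dagger>"
    using lax_mult[OF \<mu> q'(2) p'(2)] lax_closed[OF \<mu> pq] by (intro le_dag) auto
  then show "?\<mu> (i, pc p, j) \<otimes>
      ?\<mu> (j, pc q, k)
    \<preceq> ?\<mu> (i, pc (p @ q), k)"
    using p' q' lax_closed[OF \<mu> p'(2)] lax_closed[OF \<mu> q'(2)]
    by (simp add: inv_word_image[of p] inv_word_image[of q] inv_word_image[of "p @ q"] dag_mult)
qed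

text \<open>An arrow starting at \<open>i\<close> is translated by the inverse of \<open>i\<close>
  so as to start at the identity; its class and its end then form an element of
  \<open>H\<close>.\<close>

lemma lax_of_GU:
  assumes \<psi>: "dual_premorphism H M \<psi>" and can: "canonical_on A (GU_gen M A U) id \<psi>"
  shows "lax (\<lambda>(i, c, j). \<psi> (map (apfst (edge_act M (inv\<^sub>G i))) ` c, inv\<^sub>G i \<cdot> j))" (is "lax ?\<mu>")
proof -
  have \<mu>: "?\<mu> (i, pc p, j) = \<psi> (pc (gact M (inv\<^sub>G i) p), inv\<^sub>G i \<cdot> j)"
    and path: "gpath \<Gamma> \<one>\<^sub>G (gact M (inv\<^sub>G i) p) (inv\<^sub>G i \<cdot> j)"
    and v: "i \<in> carrier G" "j \<in> carrier G" "p \<in> W" "gact M (inv\<^sub>G i) p \<in> W"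
    if p: "gpath \<Gamma> i p j" for i p j
  proof -
    show v: "i \<in> carrier G" "j \<in> carrier G" "p \<in> W" using D.gpath_verts[OF p] D.gpath_words[OF p] by auto
    then show "gact M (inv\<^sub>G i) p \<in> W" by (simp add: gact_words)
    show "?\<mu> (i, pc p, j) = \<psi> (pc (gact M (inv\<^sub>G i) p), inv\<^sub>G i \<cdot> j)" using v by (simp add: gact_image)
    show "gpath \<Gamma> \<one>\<^sub>G (gact M (inv\<^sub>G i) p) (inv\<^sub>G i \<cdot> j)"
      using gpath_gact[OF _ p, of "inv\<^sub>G i"] v by simp
  qed
  show ?thesis
  proof (rule laxI)
    fix i p j assume p: "gpath \<Gamma> i p j"
    show "?\<mu> (i, pc p, j) \<in> carrier M"
      unfolding \<mu>[OF p] using \<psi> path[OF p] by (auto simp: dual_premorphism_def)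
    have "\<psi> (vinv H (pc (gact M (inv\<^sub>G i) p), inv\<^sub>G i \<cdot> j)) = (?\<mu> (i, pc p, j))\<dagger>"
      unfolding \<mu>[OF p] using \<psi> path[OF p] by (auto simp: dual_premorphism_def)
    also have "vinv H (pc (gact M (inv\<^sub>G i) p), inv\<^sub>G i \<cdot> j)
        = (pc (gact M (inv\<^sub>G j) (inv_word p)), inv\<^sub>G j \<cdot> i)"
      unfolding GU_vinv[OF path[OF p]] using v[OF p]
      by (simp add: gact_gact G.inv_mult_group G.m_assoc flip: gact_inv)
    finally show "?\<mu> (j, pc (inv_word p), i) = (?\<mu> (i, pc p, j))\<dagger>"
      using \<mu>[OF D.gpath_inv[OF p]] by simp
    fix q k assume q: "gpath \<Gamma> j q k"
    have pq: "gpath \<Gamma> i (p @ q) k" using p q by (auto simp: D.gpath_append)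
    have "(pc (gact M (inv\<^sub>G i) p), inv\<^sub>G i \<cdot> j) \<otimes>\<^bsub>H\<^esub> (pc (gact M (inv\<^sub>G j) q), inv\<^sub>G j \<cdot> k)
      = (pc (gact M (inv\<^sub>G i) (p @ q)), inv\<^sub>G i \<cdot> k)"
      using v[OF p] v[OF q] by (simp add: GU_mult gact_gact G.m_assoc)
    then show "?\<mu> (i, pc p, j) \<otimes> ?\<mu> (j, pc q, k) \<preceq> ?\<mu> (i, pc (p @ q), k)"
      unfolding \<mu>[OF p] \<mu>[OF q] \<mu>[OF pq]
      using \<psi> path[OF p] path[OF q] unfolding dual_premorphism_def by (metis GU_carrierI)
  next
    fix i assume i: "i \<in> carrier G"
    then have "gpath \<Gamma> i [] i" by simp
    from \<mu>[OF this] show "?\<mu> (i, pc [], i) = \<one>" using i \<psi> by (simp add: dual_premorphism_def GU_one)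
  next
    fix g a assume g: "g \<in> carrier G" "a \<in> A"
    then have a: "a \<in> carrier M" using C_sub by auto
    have "gpath \<Gamma> g [((g, a, g \<cdot> s a), True)] (g \<cdot> s a)" using g a by auto
    from \<mu>[OF this] show "?\<mu> (g, pc [((g, a, g \<cdot> s a), True)], g \<cdot> s a) = a"
      using can g a by (simp add: canonical_on_def GU_gen_def base_edge_def edge_act_def)
  qed
qed

lemma GU_label_le:
  assumes "dual_premorphism H M \<psi>" "canonical_on A (GU_gen M A U) id \<psi>" "gpath \<Gamma> \<one>\<^sub>G p g"
  shows "lab p \<preceq> \<psi> (pc p, g)"
  using lax_label[OF lax_of_GU[OF assms(1,2)] assms(3)] D.gpath_verts[OF assms(3)] D.gpath_words[OF assms(3)]
  by (simp add: gact_image)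

text \<open>The pointwise meet of all lax functions is lax, and it is invariant under every
  transformation preserving laxness: translations by \<open>G\<close> and inversion.\<close>

lemma invariant_lax:
  assumes E: "eunitary M" and fin: "finite_above M" and ex: "\<exists>\<mu>. lax \<mu>"
  obtains \<nu> where "lax \<nu>"
    and "\<And>i p j. gpath \<Gamma> i p j \<Longrightarrow> \<nu> (j, pc (inv_word p), i) = (\<nu> (i, pc p, j))\<dagger>"
    and "\<And>g i p j. gpath \<Gamma> i p j \<Longrightarrow> g \<in> carrier G \<Longrightarrow>
       \<nu> (g \<cdot> i, pc (gact M g p), g \<cdot> j) = \<nu> (i, pc p, j)"
proof -
  interpret eunitary M by fact
  have glb: "\<exists>m\<in>carrier M. (\<forall>\<mu>. lax \<mu> \<longrightarrow> m \<preceq> \<mu> (i, pc p, j)) \<and>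
      (\<forall>c. (\<forall>\<mu>. lax \<mu> \<longrightarrow> c \<preceq> \<mu> (i, pc p, j)) \<longrightarrow> c \<preceq> m)" if p: "gpath \<Gamma> i p j" for i p j
  proof -
    let ?T = "{\<mu> (i, pc p, j) | \<mu>. lax \<mu>}"
    have "finite {n \<in> carrier M. lab p \<preceq> n}" using fin p by (auto simp: finite_above_def)
    then have "finite ?T" by (rule rev_finite_subset) (use p in \<open>auto simp: lax_closed lax_label\<close>)
    then have "\<exists>m\<in>carrier M. (\<forall>t\<in>?T. m \<preceq> t) \<and> (\<forall>c. (\<forall>t\<in>?T. c \<preceq> t) \<longrightarrow> c \<preceq> m)"
    proof (rule finite_glb)
      show "?T \<noteq> {}" "?T \<subseteq> carrier M" using ex p lax_closed by auto
      show "s a = s b" if ab: "a \<in> ?T" "b \<in> ?T" for a b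
      proof -
        obtain \<mu> \<mu>' where "lax \<mu>" "lax \<mu>'" "a = \<mu> (i, pc p, j)" "b = \<mu>' (i, pc p, j)" using ab by blast
        then show ?thesis using lax_s[of \<mu> i p j] lax_s[of \<mu>' i p j] p by simp
      qed
    qed
    then show ?thesis unfolding setcompr_eq_image by simp
  qed
  \<comment> \<open>The meet is chosen for arrows rather than paths, so that \<nu> does not depend
    on the path representing an arrow.\<close>
  have "\<forall>x\<in>arcs F. \<exists>m. m \<in> carrier M \<and> (\<forall>\<mu>. lax \<mu> \<longrightarrow> m \<preceq> \<mu> x) \<and>
      (\<forall>c. (\<forall>\<mu>. lax \<mu> \<longrightarrow> c \<preceq> \<mu> x) \<longrightarrow> c \<preceq> m)"
  proof (intro ballI)
    fix x assume "x \<in> arcs F"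
    then obtain i p j where "gpath \<Gamma> i p j" and x: "x = (i, pc p, j)" by (auto simp: Fg_arcs)
    from glb[OF this(1)] show "\<exists>m. m \<in> carrier M \<and> (\<forall>\<mu>. lax \<mu> \<longrightarrow> m \<preceq> \<mu> x) \<and>
      (\<forall>c. (\<forall>\<mu>. lax \<mu> \<longrightarrow> c \<preceq> \<mu> x) \<longrightarrow> c \<preceq> m)" unfolding x by blast
  qed
  from bchoice[OF this] obtain \<nu> where "\<forall>x\<in>arcs F. \<nu> x \<in> carrier M \<and> (\<forall>\<mu>. lax \<mu> \<longrightarrow> \<nu> x \<preceq> \<mu> x) \<and>
      (\<forall>c. (\<forall>\<mu>. lax \<mu> \<longrightarrow> c \<preceq> \<mu> x) \<longrightarrow> c \<preceq> \<nu> x)" ..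
  then have \<nu>: "\<nu> (i, pc p, j) \<in> carrier M" "lax \<mu> \<Longrightarrow> \<nu> (i, pc p, j) \<preceq> \<mu> (i, pc p, j)"
      "(\<And>\<mu>. lax \<mu> \<Longrightarrow> c \<preceq> \<mu> (i, pc p, j)) \<Longrightarrow> c \<preceq> \<nu> (i, pc p, j)"
    if "gpath \<Gamma> i p j" for i p j \<mu> c
    using that Fg_arcI by blast+
  have lax: "lax \<nu>"
    unfolding lax_def
  proof (intro conjI allI impI)
    fix i p j assume p: "gpath \<Gamma> i p j"
    show "\<nu> (i, pc p, j) \<in> carrier M" "lab p \<preceq> \<nu> (i, pc p, j)"
      using \<nu>[OF p] lax_label p by blast+
    fix q k assume q: "gpath \<Gamma> j q k"
    have pq: "gpath \<Gamma> i (p @ q) k" using p q by (auto simp: D.gpath_append)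
    show "\<nu> (i, pc p, j) \<otimes> \<nu> (j, pc q, k) \<preceq> \<nu> (i, pc (p @ q), k)"
    proof (rule \<nu>(3)[OF pq])
      fix \<mu> assume \<mu>: "lax \<mu>"
      have "\<nu> (i, pc p, j) \<otimes> \<nu> (j, pc q, k) \<preceq> \<mu> (i, pc p, j) \<otimes> \<mu> (j, pc q, k)"
        using \<nu>(2) \<mu> p q lax_closed by (intro le_mult) auto
      then show "\<nu> (i, pc p, j) \<otimes> \<nu> (j, pc q, k) \<preceq> \<mu> (i, pc (p @ q), k)"
        using le_trans lax_mult[OF \<mu> p q] lax_closed[OF \<mu> pq] by blast
    qed
  qed
  \<comment> \<open>One inequality for all \<open>g\<close> suffices: applied to the translated
    arrow and the inverse of \<open>g\<close>, it becomes the reverse one.\<close>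
  have act_le: "\<nu> (g \<cdot> i, pc (gact M g p), g \<cdot> j) \<preceq> \<nu> (i, pc p, j)"
    if p: "gpath \<Gamma> i p j" and g: "g \<in> carrier G" for i p j g
  proof (rule \<nu>(3)[OF p])
    fix \<mu> assume \<mu>: "lax \<mu>"
    have "inv\<^sub>G g \<in> carrier G" using g by simp
    from \<nu>(2)[OF gpath_gact[OF g p] lax_act[OF \<mu> this]] g p
    show "\<nu> (g \<cdot> i, pc (gact M g p), g \<cdot> j) \<preceq> \<mu> (i, pc p, j)"
      using D.gpath_verts[OF p] D.gpath_words[OF p] by (simp add: gact_image gact_words gact_gact)
  qed
  have act: "\<nu> (g \<cdot> i, pc (gact M g p), g \<cdot> j) = \<nu> (i, pc p, j)"
    if p: "gpath \<Gamma> i p j" and g: "g \<in> carrier G" for i p j g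
  proof (rule le_antisym)
    show "\<nu> (i, pc p, j) \<preceq> \<nu> (g \<cdot> i, pc (gact M g p), g \<cdot> j)"
      using act_le[OF gpath_gact[OF g p], of "inv\<^sub>G g"] g D.gpath_verts[OF p] D.gpath_words[OF p]
      by (simp add: gact_gact)
  qed (use act_le[OF p g] \<nu>(1) p gpath_gact[OF g p] in auto)
  have dag_le: "(\<nu> (j, pc (inv_word p), i))\<dagger> \<preceq> \<nu> (i, pc p, j)" if p: "gpath \<Gamma> i p j" for i p j
  proof (rule \<nu>(3)[OF p])
    fix \<mu> assume \<mu>: "lax \<mu>"
    have "\<nu> (j, pc (inv_word p), i) \<preceq> (\<mu> (i, pc p, j))\<dagger>"
      using \<nu>(2)[OF D.gpath_inv[OF p] lax_inv[OF \<mu>]] D.gpath_words[OF p] by (simp add: inv_word_image)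
    then show "(\<nu> (j, pc (inv_word p), i))\<dagger> \<preceq> \<mu> (i, pc p, j)"
      using le_dag[of _ "(\<mu> (i, pc p, j))\<dagger>"] lax_closed[OF \<mu> p] by simp
  qed
  have dag: "\<nu> (j, pc (inv_word p), i) = (\<nu> (i, pc p, j))\<dagger>" if p: "gpath \<Gamma> i p j" for i p j
  proof (rule le_antisym)
    show "(\<nu> (i, pc p, j))\<dagger> \<preceq> \<nu> (j, pc (inv_word p), i)" using dag_le[OF D.gpath_inv[OF p]] by simp
    show "\<nu> (j, pc (inv_word p), i) \<preceq> (\<nu> (i, pc p, j))\<dagger>"
      using le_dag[OF dag_le[OF p]] \<nu>(1)[OF p] \<nu>(1)[OF D.gpath_inv[OF p]] by simp
  qed (use \<nu>(1)[OF p] \<nu>(1)[OF D.gpath_inv[OF p]] in auto)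
  show thesis by (rule that[OF lax dag act])
qed

text \<open>Restrict \<nu> to arrows from the identity. In a product the second path is drawn from
  the end \<open>g\<close> of the first, and invariance under \<open>g\<close> brings its value back
  to that of \<psi>.\<close>

lemma GU_of_lax:
  assumes "eunitary M" "finite_above M" and A: "A \<subseteq> max_minus M" and "\<exists>\<mu>. lax \<mu>"
  shows "\<exists>\<psi>. dual_premorphism H M \<psi> \<and> canonical_on A (GU_gen M A U) id \<psi>"
proof -
  obtain \<nu> where lax: "lax \<nu>"
    and dag: "\<And>i p j. gpath \<Gamma> i p j \<Longrightarrow> \<nu> (j, pc (inv_word p), i) = (\<nu> (i, pc p, j))\<dagger>"
    and act: "\<And>g i p j. gpath \<Gamma> i p j \<Longrightarrow> g \<in> carrier G \<Longrightarrow>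
       \<nu> (g \<cdot> i, pc (gact M g p), g \<cdot> j) = \<nu> (i, pc p, j)"
    using invariant_lax[OF assms(1,2,4)] by blast
  define \<psi> where "\<psi> = (\<lambda>(c, g). \<nu> (\<one>\<^sub>G, c, g))"
  have "dual_premorphism H M \<psi>"
    unfolding dual_premorphism_def
  proof (intro conjI ballI)
    show "inverse_monoid H" by (rule group_inverse_monoid[OF GU_group])
    show "inverse_monoid M" by (rule inverse_monoid)
    show "\<psi> \<in> carrier H \<rightarrow> carrier M" using lax_closed[OF lax] by (auto simp: GU_carrier \<psi>_def)
    show "\<psi> \<one>\<^bsub>H\<^esub> = \<one>" using lax_one[OF lax] by (simp add: \<psi>_def GU_one)
    fix x assume "x \<in> carrier H"
    then obtain p g where p: "gpath \<Gamma> \<one>\<^sub>G p g" "x = (pc p, g)" by (auto simp: GU_carrier)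
    have pW: "p \<in> W" and g: "g \<in> carrier G" using D.gpath_words D.gpath_verts p by fastforce+
    have "\<nu> (inv\<^sub>G g \<cdot> g, pc (gact M (inv\<^sub>G g) (inv_word p)), inv\<^sub>G g \<cdot> \<one>\<^sub>G) = (\<nu> (\<one>\<^sub>G, pc p, g))\<dagger>"
      using act[OF D.gpath_inv[OF p(1)], of "inv\<^sub>G g"] dag[OF p(1)] g by simp
    then show "\<psi> (vinv H x) = (\<psi> x)\<dagger>" using p g by (simp add: GU_vinv \<psi>_def)
    fix y assume "y \<in> carrier H"
    then obtain q h where q: "gpath \<Gamma> \<one>\<^sub>G q h" "y = (pc q, h)" by (auto simp: GU_carrier)
    have qW: "q \<in> W" and h: "h \<in> carrier G" using D.gpath_words D.gpath_verts q by fastforce+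
    have "\<nu> (\<one>\<^sub>G, pc p, g) \<otimes> \<nu> (g, pc (gact M g q), g \<cdot> h) \<preceq> \<nu> (\<one>\<^sub>G, pc (p @ gact M g q), g \<cdot> h)"
      by (rule lax_mult[OF lax p(1) gpath_gact_one[OF q(1) g]])
    then show "\<psi> x \<otimes> \<psi> y \<preceq> \<psi> (x \<otimes>\<^bsub>H\<^esub> y)"
      using act[OF q(1) g] p q pW qW g by (simp add: GU_mult \<psi>_def)
  qed
  moreover have "canonical_on A (GU_gen M A U) id \<psi>"
    unfolding canonical_on_def
  proof
    fix a assume a: "a \<in> A"
    then have "a \<in> carrier M" using C_sub by auto
    then show "\<psi> (GU_gen M A U a) = id a"
      using lax_edge[OF lax A _ a, of "\<one>\<^sub>G"] by (simp add: \<psi>_def GU_gen_def base_edge_def)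
  qed
  ultimately show ?thesis by blast
qed

end

section \<open>Transport along isomorphisms\<close>

lemma inverse_monoid_iso:
  assumes M: "inverse_monoid M" and bij: "bij_betw f (carrier M) (carrier N)"
    and mult: "\<And>a b. a \<in> carrier M \<Longrightarrow> b \<in> carrier M \<Longrightarrow> f (a \<otimes>\<^bsub>M\<^esub> b) = f a \<otimes>\<^bsub>N\<^esub> f b"
    and one: "f \<one>\<^bsub>M\<^esub> = \<one>\<^bsub>N\<^esub>"
  shows "inverse_monoid N"
proof -
  interpret M: inv_monoid M by unfold_locales (rule M)
  have fM: "f a \<in> carrier N" if "a \<in> carrier M" for a using bij that by (auto simp: bij_betw_def)
  have inj: "a = b" if "f a = f b" "a \<in> carrier M" "b \<in> carrier M" for a b
    using bij that by (auto simp: bij_betw_def inj_on_def)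
  have surj: "\<exists>a\<in>carrier M. x = f a" if "x \<in> carrier N" for x
    using bij that by (auto simp: bij_betw_def)
  have "monoid N"
  proof
    fix x y z assume "x \<in> carrier N" "y \<in> carrier N" "z \<in> carrier N"
    then obtain a b c where abc: "a \<in> carrier M" "b \<in> carrier M" "c \<in> carrier M" "x = f a" "y = f b" "z = f c"
      using surj by metis
    show "x \<otimes>\<^bsub>N\<^esub> y \<in> carrier N" using abc fM[of "a \<otimes>\<^bsub>M\<^esub> b"] by (simp add: mult)
    have "x \<otimes>\<^bsub>N\<^esub> y \<otimes>\<^bsub>N\<^esub> z = f (a \<otimes>\<^bsub>M\<^esub> b \<otimes>\<^bsub>M\<^esub> c)" using abc by (simp add: mult)
    also have "\<dots> = f (a \<otimes>\<^bsub>M\<^esub> (b \<otimes>\<^bsub>M\<^esub> c))" using abc by (simp add: M.m_assoc)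
    also have "\<dots> = x \<otimes>\<^bsub>N\<^esub> (y \<otimes>\<^bsub>N\<^esub> z)" using abc by (simp add: mult)
    finally show "x \<otimes>\<^bsub>N\<^esub> y \<otimes>\<^bsub>N\<^esub> z = x \<otimes>\<^bsub>N\<^esub> (y \<otimes>\<^bsub>N\<^esub> z)" .
    show "\<one>\<^bsub>N\<^esub> \<otimes>\<^bsub>N\<^esub> x = x" "x \<otimes>\<^bsub>N\<^esub> \<one>\<^bsub>N\<^esub> = x"
      using mult[of "\<one>\<^bsub>M\<^esub>" a] mult[of a "\<one>\<^bsub>M\<^esub>"] abc by (simp_all add: one)
  qed (use fM one in \<open>metis M.one_closed\<close>)
  moreover have "\<exists>!y. y \<in> carrier N \<and> x \<otimes>\<^bsub>N\<^esub> y \<otimes>\<^bsub>N\<^esub> x = x \<and> y \<otimes>\<^bsub>N\<^esub> x \<otimes>\<^bsub>N\<^esub> y = y"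
    if x: "x \<in> carrier N" for x
  proof -
    obtain a where a: "a \<in> carrier M" "x = f a" using surj x by blast
    show ?thesis
    proof (rule ex1I[of _ "f (vinv M a)"])
      show "f (vinv M a) \<in> carrier N \<and> x \<otimes>\<^bsub>N\<^esub> f (vinv M a) \<otimes>\<^bsub>N\<^esub> x = x \<and>
          f (vinv M a) \<otimes>\<^bsub>N\<^esub> x \<otimes>\<^bsub>N\<^esub> f (vinv M a) = f (vinv M a)"
        using a fM M.dag_spec[OF a(1)] by (simp add: mult[symmetric])
      fix y assume y: "y \<in> carrier N \<and> x \<otimes>\<^bsub>N\<^esub> y \<otimes>\<^bsub>N\<^esub> x = x \<and> y \<otimes>\<^bsub>N\<^esub> x \<otimes>\<^bsub>N\<^esub> y = y"
      then obtain b where b: "b \<in> carrier M" "y = f b" using surj by blast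
      have "f (a \<otimes>\<^bsub>M\<^esub> (b \<otimes>\<^bsub>M\<^esub> a)) = f a" "f (b \<otimes>\<^bsub>M\<^esub> (a \<otimes>\<^bsub>M\<^esub> b)) = f b"
        using y a b by (simp_all add: mult M.m_assoc[symmetric])
      then have "a \<otimes>\<^bsub>M\<^esub> (b \<otimes>\<^bsub>M\<^esub> a) = a" "b \<otimes>\<^bsub>M\<^esub> (a \<otimes>\<^bsub>M\<^esub> b) = b"
        using a b by (auto intro: inj)
      then show "y = f (vinv M a)" using M.dag_eqI a b by blast
    qed
  qed
  ultimately show ?thesis by (simp add: inverse_monoid_def)
qed

text \<open>That \<open>N\<close> is an inverse monoid is derived along the way, so the transport
  serves for an isomorphism out of \<open>M\<close> and for its inverse alike.\<close>

lemma dual_premorphism_comp_iso: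
  assumes \<psi>: "dual_premorphism K M \<psi>" and bij: "bij_betw f (carrier M) (carrier N)"
    and mult: "\<And>a b. a \<in> carrier M \<Longrightarrow> b \<in> carrier M \<Longrightarrow> f (a \<otimes>\<^bsub>M\<^esub> b) = f a \<otimes>\<^bsub>N\<^esub> f b"
    and one: "f \<one>\<^bsub>M\<^esub> = \<one>\<^bsub>N\<^esub>"
  shows "dual_premorphism K N (f \<circ> \<psi>)"
proof -
  have M: "inverse_monoid M" and K: "inverse_monoid K" using \<psi> by (auto simp: dual_premorphism_def)
  have N: "inverse_monoid N" by (rule inverse_monoid_iso[OF M bij mult one])
  interpret M: inv_monoid M by unfold_locales (rule M)
  interpret N: inv_monoid N by unfold_locales (rule N)
  interpret K: inv_monoid K by unfold_locales (rule K)
  have fM: "f a \<in> carrier N" if "a \<in> carrier M" for a using bij that by (auto simp: bij_betw_def)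
  have dag: "f (vinv M a) = vinv N (f a)" if a: "a \<in> carrier M" for a
    using M.dag_simps[OF a] a fM by (intro N.dag_eqI[symmetric]) (auto simp: mult[symmetric])
  have le: "nat_le N (f a) (f b)" if ab: "nat_le M a b" "b \<in> carrier M" for a b
  proof -
    obtain e where e: "e \<in> idem M" "a = e \<otimes>\<^bsub>M\<^esub> b" using ab by (auto simp: nat_le_def)
    then have "e \<in> carrier M" by simp
    moreover from this have "f e \<in> idem N"
      using e fM by (intro N.idemI) (auto simp: mult[symmetric])
    ultimately show ?thesis using e mult ab(2) by (intro N.leI[of "f e"]) auto
  qed
  have \<psi>M: "\<psi> x \<in> carrier M" if "x \<in> carrier K" for x using \<psi> that by (auto simp: dual_premorphism_def)
  show ?thesis
    unfolding dual_premorphism_def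
  proof (intro conjI ballI K N)
    show "f \<circ> \<psi> \<in> carrier K \<rightarrow> carrier N" using fM \<psi>M by auto
    show "(f \<circ> \<psi>) \<one>\<^bsub>K\<^esub> = \<one>\<^bsub>N\<^esub>" using \<psi> one by (simp add: dual_premorphism_def)
    fix x assume x: "x \<in> carrier K"
    show "(f \<circ> \<psi>) (vinv K x) = vinv N ((f \<circ> \<psi>) x)"
      using \<psi> dag[OF \<psi>M[OF x]] x by (simp add: dual_premorphism_def)
    fix y assume y: "y \<in> carrier K"
    have "nat_le M (\<psi> x \<otimes>\<^bsub>M\<^esub> \<psi> y) (\<psi> (x \<otimes>\<^bsub>K\<^esub> y))" using \<psi> x y by (simp add: dual_premorphism_def)
    then show "nat_le N ((f \<circ> \<psi>) x \<otimes>\<^bsub>N\<^esub> (f \<circ> \<psi>) y) ((f \<circ> \<psi>) (x \<otimes>\<^bsub>K\<^esub> y))"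
      using le \<psi>M x y by (simp add: mult[symmetric])
  qed
qed

text \<open>Some value is attained infinitely often, and between two occurrences of it the
  increasing sequence is squeezed.\<close>

lemma (in inv_monoid) increasing_stabilises:
  fixes f :: "nat \<Rightarrow> 'a"
  assumes inc: "\<And>n. f n \<preceq> f (Suc n)" and closed: "\<And>n. f n \<in> carrier M" and fin: "finite (range f)"
  shows "\<exists>N. \<forall>n\<ge>N. f n = f N"
proof -
  have mono: "f m \<preceq> f n" if "m \<le> n" for m n
    using that
  proof (induction n rule: dec_induct)
    case (step n)
    then show ?case using le_trans inc closed by blast
  qed (use closed in auto)
  obtain v where v: "infinite (f -` {v})" using inf_img_fin_dom[OF fin infinite_UNIV_nat] by auto
  then obtain N where N: "f N = v" using infinite_imp_nonempty by fastforce
  have "f n = f N" if n: "n \<ge> N" for n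
  proof -
    obtain k where k: "k \<ge> n" "f k = v" using v by (metis infinite_nat_iff_unbounded_le vimage_singleton_eq)
    then show ?thesis using mono[OF n] mono[OF k(1)] N closed le_antisym by metis
  qed
  then show ?thesis by blast
qed

section \<open>The monoid and the category of closed graphs\<close>

context generated
begin

definition XclG_elem :: "'a \<Rightarrow> ('a set, 'a edge) subgr \<times> 'a set" where
  "XclG_elem m = (S \<one>\<^sub>G (dom m), s m)"

text \<open>Injectivity is the fact that \<open>m\<close> is determined by \<open>s m\<close> and
  \<open>dom m\<close>; for surjectivity, a closed graph containing the identity vertex is redrawn
  from there.\<close>

lemma XclG_elem_bij: "bij_betw XclG_elem (carrier M) (carrier (XclG M B))"
  unfolding bij_betw_def
proof
  show "inj_on XclG_elem (carrier M)"
  proof (rule inj_onI)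
    fix a b assume "a \<in> carrier M" "b \<in> carrier M" "XclG_elem a = XclG_elem b"
    then show "a = b" using S_inj[of "\<one>\<^sub>G" "dom a" "dom b"] eq_if_s_dom[of a b] by (auto simp: XclG_elem_def)
  qed
  show "XclG_elem ` carrier M = carrier (XclG M B)"
  proof (intro equalityI subsetI)
    fix x assume "x \<in> XclG_elem ` carrier M"
    then obtain m where "m \<in> carrier M" "x = XclG_elem m" by blast
    then show "x \<in> carrier (XclG M B)"
      using S_dom_in_ClSub[of "\<one>\<^sub>G" m] by (simp add: XclG_def XclG_elem_def)
  next
    fix x assume "x \<in> carrier (XclG M B)"
    then obtain X g where x: "x = (X, g)" "X \<in> ClSub_fc M B" "\<one>\<^sub>G \<in> fst X" "g \<in> fst X"
      by (auto simp: XclG_def)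
    then obtain m where m: "m \<in> carrier M" "X = S \<one>\<^sub>G (dom m)" "g = \<one>\<^sub>G \<cdot> s m"
      using ClSub_rooted by blast
    then have "x = XclG_elem m" using x by (simp add: XclG_elem_def)
    then show "x \<in> XclG_elem ` carrier M" using m by blast
  qed
qed

lemma XclG_elem_mult:
  assumes "a \<in> carrier M" "b \<in> carrier M"
  shows "XclG_elem (a \<otimes> b) = XclG_elem a \<otimes>\<^bsub>XclG M B\<^esub> XclG_elem b"
  using closure_S_mult[of "\<one>\<^sub>G" a b] assms by (simp add: XclG_elem_def XclG_def subgr_act_S)

lemma XclG_elem_one: "XclG_elem \<one> = \<one>\<^bsub>XclG M B\<^esub>"
  by (simp add: XclG_elem_def XclG_def closure_vertex)

lemma XclG_elem_gen: "a \<in> B \<Longrightarrow> XclG_elem a = XclG_gen M B a"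
  using closure_edge[of "\<one>\<^sub>G" a] B_carrier by (simp add: XclG_elem_def XclG_gen_def base_edge_def)

lemma premorphism_XclG_iff:
  assumes "A \<subseteq> B"
  shows "(\<exists>\<psi>. dual_premorphism K M \<psi> \<and> canonical_on A \<gamma> id \<psi>) \<longleftrightarrow>
    (\<exists>\<psi>. dual_premorphism K (XclG M B) \<psi> \<and> canonical_on A \<gamma> (XclG_gen M B) \<psi>)"
proof
  assume "\<exists>\<psi>. dual_premorphism K M \<psi> \<and> canonical_on A \<gamma> id \<psi>"
  then obtain \<psi> where \<psi>: "dual_premorphism K M \<psi>" "canonical_on A \<gamma> id \<psi>" by blast
  have "dual_premorphism K (XclG M B) (XclG_elem \<circ> \<psi>)"
    by (rule dual_premorphism_comp_iso[OF \<psi>(1) XclG_elem_bij XclG_elem_mult XclG_elem_one])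
  moreover have "canonical_on A \<gamma> (XclG_gen M B) (XclG_elem \<circ> \<psi>)"
    using \<psi>(2) assms XclG_elem_gen by (auto simp: canonical_on_def)
  ultimately show "\<exists>\<psi>. dual_premorphism K (XclG M B) \<psi> \<and> canonical_on A \<gamma> (XclG_gen M B) \<psi>" by blast
next
  assume "\<exists>\<psi>. dual_premorphism K (XclG M B) \<psi> \<and> canonical_on A \<gamma> (XclG_gen M B) \<psi>"
  then obtain \<psi> where \<psi>: "dual_premorphism K (XclG M B) \<psi>" "canonical_on A \<gamma> (XclG_gen M B) \<psi>" by blast
  let ?f = "inv_into (carrier M) XclG_elem"
  have inj: "inj_on XclG_elem (carrier M)" using XclG_elem_bij by (simp add: bij_betw_def)
  have "dual_premorphism K M (?f \<circ> \<psi>)"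
  proof (rule dual_premorphism_comp_iso[OF \<psi>(1) bij_betw_inv_into[OF XclG_elem_bij]])
    show "?f \<one>\<^bsub>XclG M B\<^esub> = \<one>" by (metis XclG_elem_one inj inv_into_f_f one_closed)
    fix x y assume "x \<in> carrier (XclG M B)" "y \<in> carrier (XclG M B)"
    then obtain a b where ab: "a \<in> carrier M" "b \<in> carrier M" "x = XclG_elem a" "y = XclG_elem b"
      using XclG_elem_bij by (metis bij_betw_imp_surj_on imageE)
    then show "?f (x \<otimes>\<^bsub>XclG M B\<^esub> y) = ?f x \<otimes> ?f y"
      using inj XclG_elem_mult[of a b, symmetric] by simp
  qed
  moreover have "canonical_on A \<gamma> id (?f \<circ> \<psi>)"
    unfolding canonical_on_def
  proof
    fix a assume "a \<in> A"
    then have a: "a \<in> B" "a \<in> carrier M" "\<psi> (\<gamma> a) = XclG_elem a"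
      using \<psi>(2) assms B_carrier XclG_elem_gen by (auto simp: canonical_on_def)
    then show "(?f \<circ> \<psi>) (\<gamma> a) = id a" using inj by simp
  qed
  ultimately show "\<exists>\<psi>. dual_premorphism K M \<psi> \<and> canonical_on A \<gamma> id \<psi>" by blast
qed

section \<open>The category of closed graphs in terms of vertices and elements\<close>

abbreviation "X \<equiv> Xcl M B"

lemma Xcl_simps [simp]:
  "verts X = carrier G" "tail X (i, Y, j) = i" "head X (i, Y, j) = j"
  by (auto simp: Xcl_def)

definition arrow :: "'a set \<Rightarrow> 'a \<Rightarrow> 'a cl_arrow" where
  "arrow i m = (i, S i (dom m), i \<cdot> s m)"

lemma arrow_ends [simp]: "tail X (arrow i m) = i" "head X (arrow i m) = i \<cdot> s m"
  by (simp_all add: arrow_def)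

lemma Xcl_arcs: "x \<in> arcs X \<longleftrightarrow> (\<exists>i\<in>carrier G. \<exists>m\<in>carrier M. x = arrow i m)"
proof
  assume "x \<in> arcs X"
  then obtain i Y j where x: "x = (i, Y, j)" "Y \<in> ClSub_fc M B" "i \<in> fst Y" "j \<in> fst Y"
    by (auto simp: Xcl_def)
  then show "\<exists>i\<in>carrier G. \<exists>m\<in>carrier M. x = arrow i m"
    using ClSub_rooted[of Y i j] unfolding arrow_def by blast
next
  assume "\<exists>i\<in>carrier G. \<exists>m\<in>carrier M. x = arrow i m"
  then show "x \<in> arcs X" using S_dom_in_ClSub by (auto simp: Xcl_def arrow_def simp del: base_in_S)
qed

lemma arrow_in_arcs [simp]: "i \<in> carrier G \<Longrightarrow> m \<in> carrier M \<Longrightarrow> arrow i m \<in> arcs X"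
  using Xcl_arcs by blast

lemma Xcl_arcs_tail: "x \<in> arcs X \<Longrightarrow> tail X x = i \<Longrightarrow> i \<in> carrier G \<and> (\<exists>m\<in>carrier M. x = arrow i m)"
  using Xcl_arcs by auto

lemma arrow_inj:
  assumes "arrow i m = arrow i n" "i \<in> carrier G" "m \<in> carrier M" "n \<in> carrier M"
  shows "m = n"
proof -
  have "dom m = dom n" "s m = s n" using assms S_inj[of i "dom m" "dom n"] by (auto simp: arrow_def)
  then show ?thesis using assms eq_if_s_dom by blast
qed

lemma arrow_comp [simp]:
  assumes "i \<in> carrier G" "m \<in> carrier M" "n \<in> carrier M" "j = i \<cdot> s m"
  shows "ccomp X (arrow i m) (arrow j n) = arrow i (m \<otimes> n)"
  using assms closure_S_mult by (simp add: arrow_def Xcl_def G.m_assoc)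

lemma Xcl_cid: "i \<in> carrier G \<Longrightarrow> cid X i = arrow i \<one>"
  by (simp add: arrow_def Xcl_def closure_vertex)

lemma arrow_inverse_law:
  assumes "i \<in> carrier G" "m \<in> carrier M"
  shows "arrow (i \<cdot> s m) (m\<dagger>) \<in> arcs X \<and> tail X (arrow (i \<cdot> s m) (m\<dagger>)) = head X (arrow i m) \<and>
    head X (arrow (i \<cdot> s m) (m\<dagger>)) = tail X (arrow i m) \<and>
    ccomp X (ccomp X (arrow i m) (arrow (i \<cdot> s m) (m\<dagger>))) (arrow i m) = arrow i m \<and>
    ccomp X (ccomp X (arrow (i \<cdot> s m) (m\<dagger>)) (arrow i m)) (arrow (i \<cdot> s m) (m\<dagger>)) = arrow (i \<cdot> s m) (m\<dagger>)"
  using assms by (simp add: G.m_assoc m_assoc)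

lemma Xcl_category: "inverse_category X"
proof
  fix e assume "e \<in> arcs X"
  then obtain i m where im: "i \<in> carrier G" "m \<in> carrier M" and e: "e = arrow i m" by (auto simp: Xcl_arcs)
  show "tail X e \<in> verts X" "head X e \<in> verts X" using im by (simp_all add: e)
  show "ccomp X (cid X (tail X e)) e = e" "ccomp X e (cid X (head X e)) = e"
    using im by (simp_all add: e Xcl_cid)
  let ?f = "arrow (i \<cdot> s m) (m\<dagger>)"
  show "\<exists>!f. f \<in> arcs X \<and> tail X f = head X e \<and> head X f = tail X e \<and>
      ccomp X (ccomp X e f) e = e \<and> ccomp X (ccomp X f e) f = f"
  proof (rule ex1I)
    show "?f \<in> arcs X \<and> tail X (?f) = head X e \<and>
      head X (?f) = tail X e \<and>
      ccomp X (ccomp X e (?f)) e = e \<and>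
      ccomp X (ccomp X (?f) e) (?f) = ?f"
      unfolding e by (rule arrow_inverse_law[OF im])
    fix f assume f: "f \<in> arcs X \<and> tail X f = head X e \<and> head X f = tail X e \<and>
      ccomp X (ccomp X e f) e = e \<and> ccomp X (ccomp X f e) f = f"
    then obtain n where n: "n \<in> carrier M" "f = arrow (i \<cdot> s m) n"
      using Xcl_arcs_tail[of f "i \<cdot> s m"] by (auto simp: e)
    have h: "i \<cdot> s m \<cdot> s n = i" using f n by (simp add: e)
    \<comment> \<open>The return condition read at the vertex \<open>i \<cdot> s m\<close>, for the
      composite that starts there.\<close>
    have h': "s n \<cdot> s m = \<one>\<^sub>G" using h im n G.inv_comm[of "s m" "s n"] by (simp add: G.m_assoc)
    have "arrow i (m \<otimes> n \<otimes> m) = arrow i m" using f n im h by (simp add: e G.m_assoc)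
    moreover have "arrow (i \<cdot> s m) (n \<otimes> m \<otimes> n) = arrow (i \<cdot> s m) n"
      using f n im h h' by (simp add: e G.m_assoc)
    ultimately have "m \<otimes> n \<otimes> m = m" "n \<otimes> m \<otimes> n = n" using im n arrow_inj by (meson G.m_closed m_closed s_closed)+
    then have "m\<dagger> = n" using im n by (intro dag_eqI) (auto simp: m_assoc)
    then show "f = ?f" using n by simp
  qed
  fix f assume f: "f \<in> arcs X" "head X e = tail X f"
  then obtain n where n: "n \<in> carrier M" and f': "f = arrow (i \<cdot> s m) n"
    using Xcl_arcs_tail[of f "i \<cdot> s m"] by (auto simp: e)
  show "ccomp X e f \<in> arcs X \<and> tail X (ccomp X e f) = tail X e \<and> head X (ccomp X e f) = head X f"
    using im n by (simp add: e f' G.m_assoc)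
  fix g assume g: "g \<in> arcs X" "head X f = tail X g"
  then obtain k where k: "k \<in> carrier M" and g': "g = arrow (i \<cdot> s m \<cdot> s n) k"
    using Xcl_arcs_tail[of g "i \<cdot> s m \<cdot> s n"] by (auto simp: f')
  show "ccomp X (ccomp X e f) g = ccomp X e (ccomp X f g)"
    using im n k by (simp add: e f' g' G.m_assoc m_assoc)
next
  fix i assume "i \<in> verts X"
  then show "cid X i \<in> arcs X \<and> tail X (cid X i) = i \<and> head X (cid X i) = i"
    by (simp add: Xcl_cid)
qed

lemma Xcl_cinv:
  assumes "i \<in> carrier G" "m \<in> carrier M"
  shows "cinv X (arrow i m) = arrow (i \<cdot> s m) (m\<dagger>)"
  unfolding cinv_def
  by (rule the1_equality[OF inverse_category.inverse[OF Xcl_category arrow_in_arcs[OF assms]]])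
    (rule arrow_inverse_law[OF assms])

text \<open>The categorical order multiplies by idempotent arrows on the right. These are the loops
  \<open>arrow (i \<cdot> s n) k\<close> with \<open>k\<close> idempotent, and
  \<open>le_right_iff\<close> translates.\<close>

lemma Xcl_le_iff:
  assumes i: "i \<in> carrier G" and m: "m \<in> carrier M" and n: "n \<in> carrier M"
  shows "cat_le X (arrow i m) (arrow i n) \<longleftrightarrow> m \<preceq> n"
proof
  assume "cat_le X (arrow i m) (arrow i n)"
  then obtain h where h: "h \<in> arcs X" "tail X h = i \<cdot> s n" "head X h = i \<cdot> s n" "ccomp X h h = h"
    "arrow i m = ccomp X (arrow i n) h" by (auto simp: cat_le_def)
  then obtain k where k: "k \<in> carrier M" "h = arrow (i \<cdot> s n) k" using Xcl_arcs_tail by metis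
  have "i \<cdot> s n \<cdot> s k = i \<cdot> s n" using h k by simp
  then have "arrow (i \<cdot> s n) (k \<otimes> k) = arrow (i \<cdot> s n) k" using h k i n by simp
  then have "k \<in> E" using arrow_inj[of "i \<cdot> s n" "k \<otimes> k" k] i n k by (intro idemI) auto
  moreover have "arrow i m = arrow i (n \<otimes> k)" using h k i n by simp
  then have "m = n \<otimes> k" using arrow_inj[of i m "n \<otimes> k"] i m n k by simp
  ultimately show "m \<preceq> n" using n by (auto simp: le_right_iff)
next
  assume "m \<preceq> n"
  then obtain k where k: "k \<in> E" "m = n \<otimes> k" using n by (auto simp: le_right_iff)
  then show "cat_le X (arrow i m) (arrow i n)"
    unfolding cat_le_def using i n by (intro bexI[of _ "arrow (i \<cdot> s n) k"]) auto
qed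

lemma Xcl_gen_arrow: "g \<in> carrier G \<Longrightarrow> a \<in> B \<Longrightarrow> snd (Xcl_gen M B) (g, a, g \<cdot> s a) = arrow g a"
  using closure_edge[of g a] by (simp add: Xcl_gen_def arrow_def)

end

section \<open>Dual premorphisms and the graphs \<open>P\<^sub>n\<close>\<close>

lemma (in inverse_category) factors_arc: "factors X xs x \<Longrightarrow>
    x \<in> arcs X \<and> set xs \<subseteq> arcs X \<and> xs \<noteq> [] \<and> tail X x = tail X (hd xs)"
  by (induction rule: factors.induct) (auto simp: ccomp_arc)

locale quasi_generated_setup = generated M "A \<union> I" for M (structure) and A I +
  fixes U :: laws
  assumes fin_above: "finite_above M" and A_max: "A \<subseteq> max_minus M"
begin

sublocale L: free_cayley M A U
  using C_sub by unfold_locales auto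

abbreviation "P n x \<equiv> Pcl M A I U n x"
abbreviation "C n x \<equiv> Ccl M A I U n x"
abbreviation "src \<equiv> tail L.F"
abbreviation "tgt \<equiv> head L.F"

lemma gpath_L: "gpath L.\<Gamma> i p j \<Longrightarrow> gpath \<Gamma> i p j"
  using gpath_mono by blast

section \<open>Lax functions and dual premorphisms into the category\<close>

lemma Xcl_of_lax:
  assumes ex: "\<exists>\<mu>. L.lax \<mu>"
  shows "\<exists>\<psi>. cat_dual_premorphism L.F X \<psi> \<and> cat_canonical L.\<Gamma> (Fg_gen M A U) (Xcl_gen M (A \<union> I)) \<psi>"
proof -
  \<comment> \<open>An arbitrary lax function need not commute with inversion, which a dual
    premorphism must; hence the passage to \<nu>.\<close>
  obtain \<nu> where lax: "L.lax \<nu>"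
    and dag: "\<And>i p j. gpath L.\<Gamma> i p j \<Longrightarrow> \<nu> (j, L.pc (inv_word p), i) = (\<nu> (i, L.pc p, j))\<dagger>"
    and "\<And>g i p j. gpath L.\<Gamma> i p j \<Longrightarrow> g \<in> carrier G \<Longrightarrow>
       \<nu> (g \<cdot> i, L.pc (gact M g p), g \<cdot> j) = \<nu> (i, L.pc p, j)"
    by (rule L.invariant_lax[OF eunitary_axioms fin_above ex]) (rule that)
  let ?\<psi> = "(id, \<lambda>x. arrow (src x) (\<nu> x))"
  note closed = L.lax_closed[OF lax]
  note hd = L.lax_head[OF lax, symmetric]
  have "cat_dual_premorphism L.F X ?\<psi>"
    unfolding cat_dual_premorphism_def
  proof (intro conjI ballI impI)
    show "inverse_category L.F" by (rule L.Fg_category)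
    show "inverse_category X" by (rule Xcl_category)
    show "graph_morphism L.F X ?\<psi>"
      using closed hd L.D.gpath_verts by (auto simp: graph_morphism_def L.Fg_arcs)
    fix i assume "i \<in> verts L.F"
    then show "snd ?\<psi> (cid L.F i) = cid X (fst ?\<psi> i)"
      using L.lax_one[OF lax] by (simp add: Xcl_cid)
  next
    fix e assume "e \<in> arcs L.F"
    then obtain i p j where p: "gpath L.\<Gamma> i p j" and e: "e = (i, L.pc p, j)" by (auto simp: L.Fg_arcs)
    have i: "i \<in> carrier G" and pW: "p \<in> L.W" using L.D.gpath_verts[OF p] L.D.gpath_words[OF p] by auto
    show "snd ?\<psi> (cinv L.F e) = cinv X (snd ?\<psi> e)"
      using dag[OF p] closed[OF p] hd[OF p] i by (simp add: e L.Fg_cinv[OF p] Xcl_cinv)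
    fix f assume f: "f \<in> arcs L.F" "tgt e = src f"
    obtain l q k where "gpath L.\<Gamma> l q k" "f = (l, L.pc q, k)" using f(1) by (auto simp: L.Fg_arcs)
    then have q: "gpath L.\<Gamma> j q k" and f: "f = (j, L.pc q, k)" using f(2) by (simp_all add: e)
    have qW: "q \<in> L.W" using L.D.gpath_words[OF q] by simp
    have pq: "gpath L.\<Gamma> i (p @ q) k" using p q by (auto simp: L.D.gpath_append)
    show "cat_le X (ccomp X (snd ?\<psi> e) (snd ?\<psi> f)) (snd ?\<psi> (ccomp L.F e f))"
      using L.lax_mult[OF lax p q] closed[OF p] closed[OF q] closed[OF pq] hd[OF p] i pW qW
      by (simp add: e f Xcl_le_iff)
  qed
  moreover have "cat_canonical L.\<Gamma> (Fg_gen M A U) (Xcl_gen M (A \<union> I)) ?\<psi>"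
    unfolding cat_canonical_def
  proof (intro conjI ballI)
    fix e assume "e \<in> arcs L.\<Gamma>"
    then obtain g a where "g \<in> carrier G" "a \<in> A" "e = (g, a, g \<cdot> s a)" by (cases e) auto
    then show "snd ?\<psi> (snd (Fg_gen M A U) e) = snd (Xcl_gen M (A \<union> I)) e"
      using L.lax_edge[OF lax A_max] by (simp add: Fg_gen_def Xcl_gen_arrow)
  qed (simp add: Fg_gen_def Xcl_gen_def)
  ultimately show ?thesis by blast
qed

text \<open>A canonical morphism fixes all vertices, so the image of \<open>x\<close> again runs
  from \<open>src x\<close> to \<open>tgt x\<close> and is named by an element of
  \<open>M\<close>.\<close>

lemma lax_of_Xcl:
  assumes \<psi>: "cat_dual_premorphism L.F X \<psi>"
    and can: "cat_canonical L.\<Gamma> (Fg_gen M A U) (Xcl_gen M (A \<union> I)) \<psi>"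
  shows "\<exists>\<mu>. L.lax \<mu>"
proof -
  have vert: "fst \<psi> i = i" if "i \<in> carrier G" for i
    using can that by (simp add: cat_canonical_def Fg_gen_def Xcl_gen_def)
  have gm: "graph_morphism L.F X \<psi>" using \<psi> by (simp add: cat_dual_premorphism_def)
  have "\<forall>x\<in>arcs L.F. \<exists>m. m \<in> carrier M \<and> snd \<psi> x = arrow (src x) m \<and>
      tgt x = src x \<cdot> s m"
  proof
    fix x assume x: "x \<in> arcs L.F"
    then obtain i p j where p: "gpath L.\<Gamma> i p j" "x = (i, L.pc p, j)" by (auto simp: L.Fg_arcs)
    have "snd \<psi> x \<in> arcs X" "tail X (snd \<psi> x) = i" "head X (snd \<psi> x) = j"
      using gm x p L.D.gpath_verts[OF p(1)] vert by (auto simp: graph_morphism_def)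
    then show "\<exists>m. m \<in> carrier M \<and> snd \<psi> x = arrow (src x) m \<and>
      tgt x = src x \<cdot> s m" using Xcl_arcs_tail[of "snd \<psi> x" i] p by auto
  qed
  from bchoice[OF this] obtain \<mu> where \<mu>: "\<And>x. x \<in> arcs L.F \<Longrightarrow> \<mu> x \<in> carrier M \<and>
      snd \<psi> x = arrow (src x) (\<mu> x) \<and> tgt x = src x \<cdot> s (\<mu> x)" by blast
  have \<mu>': "\<mu> (i, L.pc p, j) \<in> carrier M" "snd \<psi> (i, L.pc p, j) = arrow i (\<mu> (i, L.pc p, j))"
      "j = i \<cdot> s (\<mu> (i, L.pc p, j))" if "gpath L.\<Gamma> i p j" for i p j
    using \<mu>[OF L.Fg_arcI[OF that]] by simp_all
  have "L.lax \<mu>"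
  proof (rule L.laxI)
    fix i p j assume p: "gpath L.\<Gamma> i p j"
    have i: "i \<in> carrier G" "j \<in> carrier G" and pW: "p \<in> L.W"
      using L.D.gpath_verts[OF p] L.D.gpath_words[OF p] by auto
    show "\<mu> (i, L.pc p, j) \<in> carrier M" by (rule \<mu>'(1)[OF p])
    have "snd \<psi> (cinv L.F (i, L.pc p, j)) = cinv X (snd \<psi> (i, L.pc p, j))"
      using \<psi> L.Fg_arcI[OF p] unfolding cat_dual_premorphism_def by blast
    then have "snd \<psi> (j, L.pc (inv_word p), i) = cinv X (snd \<psi> (i, L.pc p, j))"
      by (simp only: L.Fg_cinv[OF p])
    also have "\<dots> = arrow j ((\<mu> (i, L.pc p, j))\<dagger>)"
      using \<mu>'[OF p] i by (simp add: Xcl_cinv)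
    finally show "\<mu> (j, L.pc (inv_word p), i) = (\<mu> (i, L.pc p, j))\<dagger>"
      using \<mu>'[OF L.D.gpath_inv[OF p]] \<mu>'[OF p] arrow_inj i by simp
    fix q k assume q: "gpath L.\<Gamma> j q k"
    have qW: "q \<in> L.W" using L.D.gpath_words[OF q] by auto
    have pq: "gpath L.\<Gamma> i (p @ q) k" using p q by (auto simp: L.D.gpath_append)
    from \<psi> have "\<forall>e\<in>arcs L.F. \<forall>f\<in>arcs L.F. tgt e = src f \<longrightarrow>
        cat_le X (ccomp X (snd \<psi> e) (snd \<psi> f)) (snd \<psi> (ccomp L.F e f))"
      unfolding cat_dual_premorphism_def by blast
    from bspec[OF bspec[OF this L.Fg_arcI[OF p]] L.Fg_arcI[OF q]] have "cat_le X (ccomp X (arrow i (\<mu> (i, L.pc p, j))) (arrow j (\<mu> (j, L.pc q, k))))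
        (arrow i (\<mu> (i, L.pc (p @ q), k)))"
      using \<mu>'(2)[OF p] \<mu>'(2)[OF q] \<mu>'(2)[OF pq] pW qW by simp
    then show "\<mu> (i, L.pc p, j) \<otimes> \<mu> (j, L.pc q, k) \<preceq> \<mu> (i, L.pc (p @ q), k)"
      using \<mu>'[OF p] \<mu>'[OF q] \<mu>'[OF pq] i by (simp add: Xcl_le_iff)
  next
    fix i assume i: "i \<in> carrier G"
    then have "gpath L.\<Gamma> i [] i" by simp
    note this' = \<mu>'[OF this]
    have "snd \<psi> (i, L.pc [], i) = arrow i \<one>"
      using \<psi> vert i by (simp add: cat_dual_premorphism_def Xcl_cid)
    then show "\<mu> (i, L.pc [], i) = \<one>" using this' i arrow_inj[of i] by simp
  next
    fix g a assume g: "g \<in> carrier G" "a \<in> A"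
    then have a: "a \<in> carrier M" using C_sub by auto
    let ?e = "(g, a, g \<cdot> s a)"
    have "gpath L.\<Gamma> g [(?e, True)] (g \<cdot> s a)" using g a by auto
    note this' = \<mu>'[OF this]
    have "?e \<in> arcs L.\<Gamma>" using g by simp
    then have "snd \<psi> (snd (Fg_gen M A U) ?e) = snd (Xcl_gen M (A \<union> I)) ?e"
      using can by (simp only: cat_canonical_def)
    then have "snd \<psi> (g, L.pc [(?e, True)], g \<cdot> s a) = arrow g a"
      using Xcl_gen_arrow[of g a] g by (simp add: Fg_gen_def)
    then show "\<mu> (g, L.pc [(?e, True)], g \<cdot> s a) = a" using this' g a arrow_inj[of g] by simp
  qed
  then show ?thesis by blast
qed

section \<open>Factorisations of arrows and the graphs \<open>P n x\<close>\<close>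

abbreviation prd :: "('a rf_arrow \<Rightarrow> 'a) \<Rightarrow> 'a rf_arrow list \<Rightarrow> 'a" where
  "prd \<mu> xs \<equiv> foldr (\<lambda>y. (\<otimes>) (\<mu> y)) xs \<one>"

text \<open>Paths realising the factors are concatenated. The resulting path stays in the union of
  the graphs of the factors, while the graph drawn from its label contains that union; this sandwich
  computes the closure in \<open>closure_factors\<close>.\<close>

lemma factors_path:
  assumes \<mu>: "\<And>y. y \<in> arcs L.F \<Longrightarrow> \<mu> y \<in> carrier M \<and> tgt y = src y \<cdot> s (\<mu> y)"
    and "factors L.F xs x"
  defines "Z \<equiv> \<lambda>y. S (src y) (dom (\<mu> y))"
  shows "\<exists>q. gpath \<Gamma> (src x) q (tgt x) \<and> lab q = prd \<mu> xs \<and>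
    spanned \<Gamma> (src x) q \<le> Sup (Z ` set xs) \<and> (\<forall>y\<in>set xs. Z y \<le> S (src x) (dom (lab q)))"
proof -
  interpret F: inverse_category L.F by (rule L.Fg_category)
  have single: "\<exists>q. gpath \<Gamma> (src y) q (tgt y) \<and> lab q = \<mu> y \<and>
      spanned \<Gamma> (src y) q \<le> Z y" if y: "y \<in> arcs L.F" for y
  proof -
    have t: "src y \<in> carrier G" using F.tail_in[OF y] by simp
    then show ?thesis using path_ex[of "\<mu> y" "src y"] \<mu>[OF y] spanned_self_le_S
      unfolding Z_def by metis
  qed
  show ?thesis using assms(2)
  proof (induction rule: factors.induct)
    case (single x)
    then obtain q where "gpath \<Gamma> (src x) q (tgt x)" "lab q = \<mu> x"
      "spanned \<Gamma> (src x) q \<le> Z x" using \<open>\<And>y. y \<in> arcs L.F \<Longrightarrow> \<exists>q. _ y q\<close> by blast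
    then show ?case using \<mu>[OF single] by (intro exI[of _ q]) (auto simp: Z_def)
  next
    case (cons x xs y)
    obtain p where p: "gpath \<Gamma> (src x) p (tgt x)" "lab p = \<mu> x"
      "spanned \<Gamma> (src x) p \<le> Z x" using single cons by blast
    obtain q where q: "gpath \<Gamma> (src y) q (tgt y)" "lab q = prd \<mu> xs"
      "spanned \<Gamma> (src y) q \<le> Sup (Z ` set xs)"
      "\<forall>z\<in>set xs. Z z \<le> S (src y) (dom (lab q))" using cons by blast
    have y: "y \<in> arcs L.F" using F.factors_arc cons by blast
    have ends: "src (ccomp L.F x y) = src x" "tgt (ccomp L.F x y) = tgt y"
      using F.ccomp_arc cons y by auto
    have q': "gpath \<Gamma> (tgt x) q (tgt y)" using q cons by simp
    have pq: "gpath \<Gamma> (src x) (p @ q) (tgt y)" using p q' by (auto simp: D.gpath_append)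
    have sp: "spanned \<Gamma> (src x) (p @ q) = sup (spanned \<Gamma> (src x) p) (spanned \<Gamma> (tgt x) q)"
      using D.spanned_append[OF p(1)] .
    let ?T = "S (src x) (dom (lab (p @ q)))"
    have i: "src x \<in> carrier G" using F.tail_in cons by simp
    have e: "dom (lab (p @ q)) \<in> E" using label_closed[OF pq] by simp
    have le: "spanned \<Gamma> (src x) p \<le> ?T" "spanned \<Gamma> (tgt x) q \<le> ?T"
      using spanned_self_le_S[OF pq] unfolding sp by simp_all
    have "Z x \<le> ?T" using S_le_S_if_spanned[OF i e p(1) le(1)] p(2) by (simp add: Z_def)
    moreover have "S (src y) (dom (lab q)) \<le> ?T"
      using S_le_S_if_spanned[OF i e q' le(2)] cons by simp
    moreover have "spanned \<Gamma> (src x) (p @ q) \<le> Sup (Z ` set (x # xs))"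
      unfolding sp using p(3) q(3) cons by (auto intro: le_supI1 le_supI2)
    moreover have "lab (p @ q) = prd \<mu> (x # xs)"
      using label_append[OF p(1) q'] p q by simp
    ultimately show ?case using pq q(4) unfolding ends by (intro exI[of _ "p @ q"]) (auto intro: order_trans)
  qed
qed

lemma closure_factors:
  assumes \<mu>: "\<And>y. y \<in> arcs L.F \<Longrightarrow> \<mu> y \<in> carrier M \<and> tgt y = src y \<cdot> s (\<mu> y)"
    and x: "factors L.F xs x"
  shows "cl (Sup ((\<lambda>y. S (src y) (dom (\<mu> y))) ` set xs)) = S (src x) (dom (prd \<mu> xs))"
    and "prd \<mu> xs \<in> carrier M"
proof -
  obtain q where q: "gpath \<Gamma> (src x) q (tgt x)" "lab q = prd \<mu> xs"
    "spanned \<Gamma> (src x) q \<le> Sup ((\<lambda>y. S (src y) (dom (\<mu> y))) ` set xs)"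
    "\<forall>y\<in>set xs. S (src y) (dom (\<mu> y)) \<le> S (src x) (dom (lab q))"
    using factors_path[OF \<mu> x] by blast
  show c: "prd \<mu> xs \<in> carrier M" using label_closed[OF q(1)] q(2) by simp
  have "src x \<in> carrier G" using D.gpath_verts[OF q(1)] by simp
  then show "cl (Sup ((\<lambda>y. S (src y) (dom (\<mu> y))) ` set xs)) = S (src x) (dom (prd \<mu> xs))"
    using S_le_closure[OF q(1,3)] q(2,4) c by (intro antisym closure_le_S SUP_least) auto
qed

lemma Ccl_Suc: "C (Suc n) x = Inf {cl (Sup (P n ` set xs)) | xs. factors L.F xs x}"
  by (simp add: Pcl_def)

lemma Pcl_le_Ccl: "P n x \<le> C n x"
  unfolding Pcl_def component_def by (rule Sup_least) blast

lemma S_le_Pcl: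
  assumes "src x \<in> carrier G" "e \<in> E" "S (src x) e \<le> C n x"
  shows "S (src x) e \<le> P n x"
  unfolding Pcl_def component_def by (rule Sup_upper) (use assms S_conn in simp)

lemma lax_prd_le:
  assumes lax: "L.lax \<mu>"
  shows "factors L.F xs x \<Longrightarrow> prd \<mu> xs \<preceq> \<mu> x"
proof (induction rule: factors.induct)
  case (single x)
  then show ?case using L.lax_closed[OF lax] by (auto simp: L.Fg_arcs)
next
  case (cons x xs y)
  interpret F: inverse_category L.F by (rule L.Fg_category)
  have y: "y \<in> arcs L.F" using F.factors_arc cons by blast
  obtain i p j where p: "gpath L.\<Gamma> i p j" "x = (i, L.pc p, j)" using cons by (auto simp: L.Fg_arcs)
  obtain l q k where "gpath L.\<Gamma> l q k" "y = (l, L.pc q, k)" using y by (auto simp: L.Fg_arcs)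
  then have q: "gpath L.\<Gamma> j q k" "y = (j, L.pc q, k)" using cons(3) p by simp_all
  have pq: "gpath L.\<Gamma> i (p @ q) k" using p q by (auto simp: L.D.gpath_append)
  have comp: "ccomp L.F x y = (i, L.pc (p @ q), k)"
    using p q L.D.gpath_words by simp
  have "\<mu> x \<otimes> prd \<mu> xs \<preceq> \<mu> x \<otimes> \<mu> y"
    using cons.IH L.lax_closed[OF lax] p q by (intro le_mult) auto
  then show ?case
    unfolding comp using le_trans L.lax_mult[OF lax p(1) q(1)] L.lax_closed[OF lax pq] p q by auto
qed

text \<open>The closure need not be idempotent on disconnected graphs: the closures of the components may
  meet. As nothing is known yet about the connectedness of the \<open>P\<^sub>n\<close>, only monotonicity is used.\<close>

lemma lax_imp_Pcl:
  assumes lax: "L.lax \<mu>" and "x \<in> arcs L.F"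
  shows "S (src x) (dom (\<mu> x)) \<le> P n x"
  using assms(2)
proof (induction n arbitrary: x)
  case 0
  obtain i p j where p: "gpath L.\<Gamma> i p j" and x: "x = (i, L.pc p, j)" using 0 by (auto simp: L.Fg_arcs)
  have i: "i \<in> carrier G" using L.D.gpath_verts[OF p] by simp
  have m: "\<mu> x \<in> carrier M" using L.lax_closed[OF lax p] x by simp
  have "S i (dom (\<mu> x)) \<le> cl (spanned L.\<Gamma> i q)"
    if q: "gpath L.\<Gamma> i q j" "x = (i, L.pc q, j)" for q
  proof -
    have "cl (spanned L.\<Gamma> i q) = S i (dom (lab q))"
      using closure_spanned[OF gpath_L[OF q(1)]] spanned_cayley[of M A "A \<union> I"] by simp
    moreover have "lab q \<preceq> \<mu> x" using L.lax_label[OF lax q(1)] q(2) by simp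
    ultimately show ?thesis using S_mono[OF i] dom_mono m q(1) by simp
  qed
  then have "S i (dom (\<mu> x)) \<le> C 0 x" by (auto simp: x intro!: Inf_greatest)
  then show ?case using S_le_Pcl[of x "dom (\<mu> x)" 0] i m by (simp add: x del: Ccl.simps)
next
  case (Suc n)
  have \<mu>: "\<mu> y \<in> carrier M \<and> tgt y = src y \<cdot> s (\<mu> y)" if "y \<in> arcs L.F" for y
    using L.lax_closed[OF lax] L.lax_head[OF lax] that by (auto simp: L.Fg_arcs)
  interpret F: inverse_category L.F by (rule L.Fg_category)
  have i: "src x \<in> carrier G" using F.tail_in[OF Suc.prems] by simp
  have "S (src x) (dom (\<mu> x)) \<le> cl (Sup (P n ` set xs))"
    if xs: "factors L.F xs x" for xs
  proof -
    have "S (src x) (dom (\<mu> x)) \<le> S (src x) (dom (prd \<mu> xs))"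
      using lax_prd_le[OF lax xs] closure_factors(2)[OF \<mu> xs] \<mu>[OF Suc.prems] i
      by (intro S_mono dom_mono) auto
    also have "\<dots> = cl (Sup ((\<lambda>y. S (src y) (dom (\<mu> y))) ` set xs))"
      using closure_factors(1)[OF \<mu> xs] by simp
    also have "\<dots> \<le> cl (Sup (P n ` set xs))"
      using Suc.IH F.factors_arc[OF xs] by (intro closure_mono SUP_mono) blast
    finally show ?thesis .
  qed
  then have "S (src x) (dom (\<mu> x)) \<le> C (Suc n) x"
    unfolding Ccl_Suc by (auto intro!: Inf_greatest)
  then show ?case using S_le_Pcl i \<mu>[OF Suc.prems] by simp
qed

lemma Pcl_of_lax:
  assumes lax: "L.lax \<mu>" and x: "x \<in> arcs L.F"
  shows "tgt x \<in> fst (P n x)"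
proof -
  obtain i p j where p: "gpath L.\<Gamma> i p j" "x = (i, L.pc p, j)" using x by (auto simp: L.Fg_arcs)
  have "j \<in> fst (S i (dom (\<mu> x)))"
    using L.lax_closed[OF lax p(1)] L.lax_head[OF lax p(1)] p(2) by (auto simp: S_vert)
  then show ?thesis using lax_imp_Pcl[OF lax x, of n] p(2) by (auto simp: less_eq_prod_def)
qed

text \<open>If all \<open>P\<^sub>n(x)\<close> contain the head of \<open>x\<close>, then each is the closed graph of an element \<open>m\<^sub>n(x)\<close>
  of \<open>M\<close>. These elements increase with \<open>n\<close>, so they stabilise, since \<open>M\<close> is finite-above.\<close>

lemma Pcl_eq_S:
  assumes 5: "\<And>x n. x \<in> arcs L.F \<Longrightarrow> tgt x \<in> fst (P n x)" and "x \<in> arcs L.F"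
  shows "\<exists>m. m \<in> carrier M \<and> P n x = S (src x) (dom m) \<and> tgt x = src x \<cdot> s m"
  using assms(2)
proof (induction n arbitrary: x)
  interpret F: inverse_category L.F by (rule L.Fg_category)
  \<comment> \<open>The component of such an intersection is some \<open>S (src x) f\<close>; that
    it contains the head provides an element \<open>m\<close> with \<open>dom m = f\<close>.\<close>
  have key: "\<exists>m. m \<in> carrier M \<and> P n x = S (src x) (dom m) \<and> tgt x = src x \<cdot> s m"
    if x: "x \<in> arcs L.F" and K: "K \<subseteq> E" "K \<noteq> {}" "C n x = Inf (S (src x) ` K)" for n x K
  proof -
    have "src x \<in> carrier G" using F.tail_in[OF x] by simp
    then obtain f where f: "f \<in> E" "P n x = S (src x) f"
      using component_Inf[OF fin_above _ K(1,2)] K(3) unfolding Pcl_def by metis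
    then show ?thesis using 5[OF x, of n] by (auto simp: S_vert)
  qed
  {
    case 0
    obtain i p j where p: "gpath L.\<Gamma> i p j" and x: "x = (i, L.pc p, j)" using 0 by (auto simp: L.Fg_arcs)
    let ?Q = "{q. gpath L.\<Gamma> i q j \<and> x = (i, L.pc q, j)}"
    have "cl (spanned L.\<Gamma> i q) = S i (dom (lab q))" if "q \<in> ?Q" for q
      using that closure_spanned[OF gpath_L, of i q j] spanned_cayley[of M A "A \<union> I"] by simp
    then have "C 0 x = Inf (S (src x) ` (\<lambda>q. dom (lab q)) ` ?Q)"
      unfolding Ccl.simps image_image setcompr_eq_image
      by (intro arg_cong[of _ _ Inf] image_cong) (auto simp: x)
    moreover have "(\<lambda>q. dom (lab q)) ` ?Q \<subseteq> E" "(\<lambda>q. dom (lab q)) ` ?Q \<noteq> {}"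
      using p x by auto
    ultimately show ?case using key[OF 0] by blast
  next
    case (Suc n)
    \<comment> \<open>With the elements of level \<open>n\<close> chosen for all arrows at once,
      every factorisation of \<open>x\<close> contributes a graph drawn from \<open>src x\<close>,
      and \<open>key\<close> applies to their intersection.\<close>
    from bchoice[of "arcs L.F"] Suc.IH obtain \<mu> where \<mu>: "\<And>y. y \<in> arcs L.F \<Longrightarrow> \<mu> y \<in> carrier M \<and>
      P n y = S (src y) (dom (\<mu> y)) \<and> tgt y = src y \<cdot> s (\<mu> y)" by metis
    have \<mu>': "\<mu> y \<in> carrier M \<and> tgt y = src y \<cdot> s (\<mu> y)" if "y \<in> arcs L.F" for y
      using \<mu>[OF that] by blast
    have "cl (Sup (P n ` set xs)) = S (src x) (dom (prd \<mu> xs))"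
      if xs: "factors L.F xs x" for xs
    proof -
      have "P n ` set xs = (\<lambda>y. S (src y) (dom (\<mu> y))) ` set xs"
        using \<mu> F.factors_arc[OF xs] by (intro image_cong) auto
      then show ?thesis using closure_factors(1)[OF \<mu>' xs] by simp
    qed
    then have "C (Suc n) x = Inf (S (src x) ` (\<lambda>xs. dom (prd \<mu> xs)) ` {xs. factors L.F xs x})"
      unfolding Ccl_Suc image_image setcompr_eq_image by (intro arg_cong[of _ _ Inf] image_cong) auto
    moreover have "(\<lambda>xs. dom (prd \<mu> xs)) ` {xs. factors L.F xs x} \<subseteq> E"
      using closure_factors(2)[OF \<mu>'] dom_idem by blast
    moreover have "(\<lambda>xs. dom (prd \<mu> xs)) ` {xs. factors L.F xs x} \<noteq> {}"
      using factors.single[OF Suc.prems] by blast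
    ultimately show ?case using key[OF Suc.prems] by blast
  }
qed

lemma lax_of_Pcl:
  assumes 5: "\<And>x n. x \<in> arcs L.F \<Longrightarrow> tgt x \<in> fst (P n x)"
  shows "\<exists>\<mu>. L.lax \<mu>"
proof -
  interpret F: inverse_category L.F by (rule L.Fg_category)
  obtain m where m: "\<And>n x. x \<in> arcs L.F \<Longrightarrow> m n x \<in> carrier M \<and>
      P n x = S (src x) (dom (m n x)) \<and> tgt x = src x \<cdot> s (m n x)"
  proof -
    have "\<forall>n x. \<exists>m. x \<in> arcs L.F \<longrightarrow> m \<in> carrier M \<and>
        P n x = S (src x) (dom m) \<and> tgt x = src x \<cdot> s m"
      using Pcl_eq_S[rotated] 5 by blast
    then show thesis using that by metis
  qed
  have cl: "m n x \<in> carrier M" and PS: "P n x = S (src x) (dom (m n x))"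
    and hd: "tgt x = src x \<cdot> s (m n x)" if "x \<in> arcs L.F" for n x
    using m[OF that] by blast+
  \<comment> \<open>Inclusion of graphs reverses the order: an upper bound for \<open>C n x\<close>
    yields a lower bound for \<open>m n x\<close>.\<close>
  have le: "a \<preceq> m n x" if x: "x \<in> arcs L.F" and a: "a \<in> carrier M" "tgt x = src x \<cdot> s a"
      "C n x \<le> S (src x) (dom a)" for a n x
  proof -
    have i: "src x \<in> carrier G" using F.tail_in[OF x] by simp
    have "S (src x) (dom (m n x)) \<le> S (src x) (dom a)"
      using Pcl_le_Ccl[of n x] a(3) PS[OF x] by simp
    then have "dom a \<preceq> dom (m n x)" using S_le_iff i a cl[OF x] by simp
    moreover have "src x \<cdot> s a = src x \<cdot> s (m n x)" using a(2) hd[OF x, of n] by simp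
    then have "s a = s (m n x)" using i a cl[OF x] by simp
    ultimately show ?thesis using a cl[OF x] by (simp add: le_iff[of a])
  qed
  \<comment> \<open>\<open>C (Suc n) x\<close> is an intersection over all factorisations, hence
    inside the graph of each single one.\<close>
  have prd: "prd (m n) xs \<preceq> m (Suc n) x" if x: "factors L.F xs x" for n xs x
  proof (rule le)
    have \<mu>: "m n y \<in> carrier M \<and> tgt y = src y \<cdot> s (m n y)" if "y \<in> arcs L.F" for y
      using m[OF that] by blast
    show "x \<in> arcs L.F" using F.factors_arc[OF x] by blast
    show "prd (m n) xs \<in> carrier M" using closure_factors(2)[OF \<mu> x] .
    obtain q where "gpath \<Gamma> (src x) q (tgt x)" "lab q = prd (m n) xs"
      using factors_path[OF \<mu> x] by blast
    then show "tgt x = src x \<cdot> s (prd (m n) xs)" using end_eq by metis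
    have "P n ` set xs = (\<lambda>y. S (src y) (dom (m n y))) ` set xs"
      using PS F.factors_arc[OF x] by (intro image_cong) auto
    then have "cl (Sup (P n ` set xs)) = S (src x) (dom (prd (m n) xs))"
      using closure_factors(1)[OF \<mu> x] by simp
    then show "C (Suc n) x \<le> S (src x) (dom (prd (m n) xs))"
      unfolding Ccl_Suc using x by (intro Inf_lower) force
  qed
  \<comment> \<open>The factorisation of \<open>x\<close> with \<open>x\<close> as its only
    factor.\<close>
  have inc: "m n x \<preceq> m (Suc n) x" if "x \<in> arcs L.F" for n x
    using prd[OF factors.single[OF that], of n] cl[OF that] by simp
  have "\<exists>N. \<forall>n\<ge>N. m n x = m N x" if x: "x \<in> arcs L.F" for x
  proof (rule increasing_stabilises)
    have "m 0 x \<preceq> m n x" for n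
    proof (induction n)
      case (Suc n)
      then show ?case using le_trans inc[OF x] cl[OF x] by blast
    qed (use cl[OF x] in simp)
    then have "range (\<lambda>n. m n x) \<subseteq> {n \<in> carrier M. m 0 x \<preceq> n}" using cl[OF x] by auto
    moreover have "finite {n \<in> carrier M. m 0 x \<preceq> n}"
      using fin_above cl[OF x] unfolding finite_above_def by blast
    ultimately show "finite (range (\<lambda>n. m n x))" by (rule finite_subset)
  qed (use inc cl x in auto)
  then have "\<forall>x\<in>arcs L.F. \<exists>N. \<forall>n\<ge>N. m n x = m N x" by blast
  from bchoice[OF this] obtain N where N: "\<And>x n. x \<in> arcs L.F \<Longrightarrow> n \<ge> N x \<Longrightarrow> m n x = m (N x) x"
    by blast
  have "L.lax (\<lambda>x. m (N x) x)"
    unfolding L.lax_def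
  proof (intro conjI allI impI)
    fix i p j assume p: "gpath L.\<Gamma> i p j"
    let ?x = "(i, L.pc p, j)"
    show "m (N ?x) ?x \<in> carrier M" using cl p by simp
    have "cl (spanned L.\<Gamma> i p) = S i (dom (lab p))"
      using closure_spanned[OF gpath_L[OF p]] spanned_cayley[of M A "A \<union> I"] by simp
    then have "C 0 ?x \<le> S i (dom (lab p))"
      unfolding Ccl.simps using p by (intro Inf_lower) force
    then have 0: "lab p \<preceq> m 0 ?x" using p L.end_eq[OF p] by (intro le) auto
    have "lab p \<preceq> m n ?x" for n
    proof (induction n)
      case (Suc n)
      then show ?case using le_trans inc[of ?x n] cl[of ?x] p by simp
    qed (rule 0)
    then show "lab p \<preceq> m (N ?x) ?x" .
    fix q k assume q: "gpath L.\<Gamma> j q k"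
    let ?y = "(j, L.pc q, k)" and ?z = "(i, L.pc (p @ q), k)"
    have pq: "gpath L.\<Gamma> i (p @ q) k" using p q by (auto simp: L.D.gpath_append)
    \<comment> \<open>The factorisation with two factors yields laxness up to a shift of the level
      by one.\<close>
    have "factors L.F [?x, ?y] (ccomp L.F ?x ?y)"
      using p q by (intro factors.cons factors.single) auto
    then have z: "factors L.F [?x, ?y] ?z" using L.D.gpath_words[OF p] L.D.gpath_words[OF q] by simp
    \<comment> \<open>From \<open>n\<close> on all three sequences are constant, so the value of the
      product at \<open>Suc n\<close> is already the eventual one.\<close>
    define n where "n = max (N ?x) (max (N ?y) (N ?z))"
    have n: "m n ?x = m (N ?x) ?x" "m n ?y = m (N ?y) ?y" "m (Suc n) ?z = m (N ?z) ?z"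
      using p q pq by (auto simp: n_def intro!: N)
    show "m (N ?x) ?x \<otimes> m (N ?y) ?y \<preceq> m (N ?z) ?z"
      using prd[OF z, of n] cl[of ?y] q unfolding n[symmetric] by simp
  qed
  then show ?thesis by blast
qed

end

section \<open>F-inverse covers\<close>

lemma carrier_quot_monoid: "carrier (quot_monoid M \<rho>) = carrier M // \<rho>"
  by (simp add: quot_monoid_def)

locale inv_monoid_hom = F: inv_monoid F + M: inv_monoid M
  for F :: "('f, 'c) monoid_scheme" and M :: "('a, 'b) monoid_scheme" +
  fixes \<phi> :: "'f \<Rightarrow> 'a"
  assumes hom: "\<phi> \<in> hom F M" and hom_one: "\<phi> \<one>\<^bsub>F\<^esub> = \<one>\<^bsub>M\<^esub>"
begin

lemma hom_closed [simp]: "x \<in> carrier F \<Longrightarrow> \<phi> x \<in> carrier M"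
  and hom_mult [simp]: "x \<in> carrier F \<Longrightarrow> y \<in> carrier F \<Longrightarrow> \<phi> (x \<otimes>\<^bsub>F\<^esub> y) = \<phi> x \<otimes>\<^bsub>M\<^esub> \<phi> y"
  using hom by (auto simp: hom_def)

lemma hom_idem: "e \<in> idem F \<Longrightarrow> \<phi> e \<in> idem M"
  by (rule M.idemI) (auto simp flip: hom_mult)

lemma hom_le:
  assumes "nat_le F x y" "y \<in> carrier F"
  shows "nat_le M (\<phi> x) (\<phi> y)"
proof -
  obtain e where e: "e \<in> idem F" "x = e \<otimes>\<^bsub>F\<^esub> y" using assms by (auto simp: nat_le_def)
  then have "\<phi> x = \<phi> e \<otimes>\<^bsub>M\<^esub> \<phi> y" using assms by simp
  then show ?thesis using hom_idem[OF e(1)] by (rule M.leI[rotated])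
qed

lemma hom_dag: "x \<in> carrier F \<Longrightarrow> \<phi> (vinv F x) = vinv M (\<phi> x)"
  by (rule M.dag_eqI[symmetric]) (auto simp flip: hom_mult)

lemma hom_s:
  assumes "x \<in> carrier F" "y \<in> carrier F" "F.s x = F.s y"
  shows "M.s (\<phi> x) = M.s (\<phi> y)"
proof -
  obtain z where "nat_le F z x" "nat_le F z y" using assms F.s_eq_iff by blast
  then have "nat_le M (\<phi> z) (\<phi> x)" "nat_le M (\<phi> z) (\<phi> y)" using assms hom_le by simp_all
  then show ?thesis using M.s_eq_iff[of "\<phi> x" "\<phi> y"] assms by auto
qed

lemma mem_F_s: "x \<in> carrier F \<Longrightarrow> y \<in> F.s x \<longleftrightarrow> y \<in> carrier F \<and> F.s y = F.s x"
  using eq_equiv_class_iff[OF F.srel_equiv, of x y] equiv_class_subset[OF F.srel_equiv]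
    F.srel_equiv unfolding F.sigma_eq equiv_def by blast

text \<open>\<open>induced_hom\<close> is a union over a class of \<open>F\<close>; all members give
  the same class of \<open>M\<close>, because \<phi> preserves common lower bounds.\<close>

lemma induced_s:
  assumes x: "x \<in> carrier F"
  shows "induced_hom M \<phi> (F.s x) = M.s (\<phi> x)"
proof -
  have "induced_hom M \<phi> (F.s x) = (\<Union>y\<in>F.s x. M.s (\<phi> y))" by (auto simp: induced_hom_def)
  also have "\<dots> = (\<Union>y\<in>F.s x. M.s (\<phi> x))"
  proof (rule SUP_cong)
    fix y assume "y \<in> F.s x"
    then have "y \<in> carrier F" "F.s y = F.s x" using mem_F_s[OF x] by simp_all
    then show "M.s (\<phi> y) = M.s (\<phi> x)" by (rule hom_s[OF _ x])
  qed simp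
  also have "\<dots> = M.s (\<phi> x)" using mem_F_s[OF x, of x] x by auto
  finally show ?thesis .
qed

sublocale induced: group_hom "max_group F" "max_group M" "induced_hom M \<phi>"
proof unfold_locales
  show "induced_hom M \<phi> \<in> hom (max_group F) (max_group M)"
    by (auto simp: hom_def F.G_carrier induced_s simp flip: F.s_mult)
qed

end

text \<open>Closure of varieties under subgroups: the value of a law in \<open>K\<close> is mapped
  to the identity of \<open>H\<close>, and injectivity brings this back to \<open>K\<close>.\<close>

lemma in_variety_inj:
  assumes H: "in_variety U H" and K: "group K" and h: "h \<in> hom K H" and inj: "inj_on h (carrier K)"
  shows "in_variety U K"
proof -
  interpret K: group K by fact
  interpret H: group H using H by (simp add: in_variety_def)
  interpret h: group_hom K H h by unfold_locales (rule h)
  show ?thesis unfolding in_variety_def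
  proof (intro conjI K ballI allI impI)
    fix w and f :: "nat \<Rightarrow> _" assume w: "w \<in> U" and f: "range f \<subseteq> carrier K"
    have cl: "eval_word K f v \<in> carrier K" for v
      using f by (intro eval_word_closed[OF K, of f UNIV]) (auto simp: words_def)
    have "h (eval_word K f v) = eval_word H (h \<circ> f) v" for v
    proof (induction v)
      case (Cons a v)
      then show ?case using cl[of v] f by (cases a) (auto simp: image_subset_iff)
    qed simp
    moreover have "eval_word H (h \<circ> f) w = \<one>\<^bsub>H\<^esub>"
    proof -
      have "range (h \<circ> f) \<subseteq> carrier H" using f by (auto simp: image_subset_iff)
      then show ?thesis using H w by (simp add: in_variety_def)
    qed
    ultimately have "h (eval_word K f w) = h \<one>\<^bsub>K\<^esub>" by simp
    then show "eval_word K f w = \<one>\<^bsub>K\<^esub>" using inj cl by (auto simp: inj_on_def)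
  qed
qed

context free_cayley
begin

text \<open>Given an F-inverse cover, lift a path to the cover and take the greatest element of its
  \<open>\<sigma>\<close>-class. That the class only depends on the value of the path in the relatively free group
  follows by conjugating the labels into the kernel with a section of \<open>F/\<sigma> \<rightarrow> M/\<sigma>\<close>.\<close>

lemma lax_of_cover:
  assumes "has_F_inverse_cover_via TYPE('f) M U"
  shows "\<exists>\<mu>. lax \<mu>"
proof -
  obtain Q :: "'f monoid" and \<phi> where cover: "F_inverse_cover Q M \<phi>"
    and var: "in_variety U ((max_group Q)\<lparr>carrier := kernel (max_group Q) G (induced_hom M \<phi>)\<rparr>)"
    using assms by (auto simp: has_F_inverse_cover_via_def)
  have Qinv: "inverse_monoid Q" using cover by (simp add: F_inverse_cover_def F_inverse_def)
  interpret h: inv_monoid_hom Q M \<phi>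
    using Qinv cover by unfold_locales (auto simp: F_inverse_cover_def)
  have surj: "\<phi> ` carrier Q = carrier M" using cover by (simp add: F_inverse_cover_def)
  let ?K = "max_group Q" and ?\<pi> = "induced_hom M \<phi>"
  let ?N = "kernel ?K G ?\<pi>"
  let ?KN = "?K\<lparr>carrier := ?N\<rparr>"
  have KG: "group ?K" by (rule h.F.max_group_group)
  have N: "subgroup ?N ?K" by (rule h.induced.subgroup_kernel)
  have KN: "group ?KN" using var by (simp add: in_variety_def)
  have "\<forall>k\<in>carrier ?K. \<exists>m. m \<in> k \<and> (\<forall>a\<in>k. nat_le Q a m)"
  proof -
    have "F_inverse Q" using cover by (simp add: F_inverse_cover_def)
    then show ?thesis unfolding F_inverse_def Bex_def carrier_quot_monoid by blast
  qed
  from bchoice[OF this] obtain mx where mx: "\<And>k. k \<in> carrier ?K \<Longrightarrow> mx k \<in> k \<and> (\<forall>a\<in>k. nat_le Q a (mx k))"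
    by blast
  have mx_closed: "mx k \<in> carrier Q" and mx_s: "h.F.s (mx k) = k"
    and mx_le: "\<And>a. a \<in> carrier Q \<Longrightarrow> h.F.s a = k \<Longrightarrow> nat_le Q a (mx k)" if k: "k \<in> carrier ?K" for k
  proof -
    obtain x where x: "x \<in> carrier Q" "k = h.F.s x" using k by (auto simp: h.F.G_carrier)
    show "mx k \<in> carrier Q" "h.F.s (mx k) = k" using mx[OF k] h.mem_F_s[OF x(1)] x(2) by auto
    show "nat_le Q a (mx k)" if "a \<in> carrier Q" "h.F.s a = k" for a
      using mx[OF k] h.mem_F_s[OF x(1), of a] x(2) that by auto
  qed
  have "\<forall>a\<in>carrier M. \<exists>x. x \<in> carrier Q \<and> \<phi> x = a"
  proof
    fix a assume "a \<in> carrier M"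
    then have "a \<in> \<phi> ` carrier Q" by (simp only: surj)
    then obtain x where "a = \<phi> x" "x \<in> carrier Q" by (rule imageE)
    then show "\<exists>x. x \<in> carrier Q \<and> \<phi> x = a" by (intro exI[of _ x]) simp
  qed
  from bchoice[OF this] obtain f where f: "\<And>a. a \<in> carrier M \<Longrightarrow> f a \<in> carrier Q \<and> \<phi> (f a) = a" by blast
  have "\<forall>g\<in>carrier G. \<exists>k. k \<in> carrier ?K \<and> ?\<pi> k = g"
  proof
    fix g assume "g \<in> carrier G"
    then obtain m where "m \<in> carrier M" "g = s m" by (auto simp: G_carrier)
    then show "\<exists>k. k \<in> carrier ?K \<and> ?\<pi> k = g" using f[of m] h.induced_s[of "f m"] by (intro exI[of _ "h.F.s (f m)"]) auto
  qed
  \<comment> \<open>A set-theoretic section of the induced homomorphism; nothing is said about its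
    behaviour on products.\<close>
  from bchoice[OF this] obtain t where t: "\<And>g. g \<in> carrier G \<Longrightarrow> t g \<in> carrier ?K \<and> ?\<pi> (t g) = g" by blast
  define c where "c = (\<lambda>(g :: 'a set, a, h :: 'a set). h.F.s (f a))"
  \<comment> \<open>For an edge from \<open>g\<close> to \<open>h\<close> with label
    \<open>a\<close>, the value is mapped to \<open>g \<cdot> s a\<close> times the inverse of
    \<open>h\<close>, which is the identity; hence it lies in the kernel.\<close>
  define w where "w = (\<lambda>(g, a, h). t g \<otimes>\<^bsub>?K\<^esub> h.F.s (f a) \<otimes>\<^bsub>?K\<^esub> inv\<^bsub>?K\<^esub> t h)"
  have Am: "a \<in> carrier M" if "a \<in> A" for a using that C_sub by auto
  let ?ev = "eval_word ?K c"
  have c_closed: "c ` arcs \<Gamma> \<subseteq> carrier ?K" using f Am by (auto simp: c_def)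
  have wN: "w e \<in> ?N" if "e \<in> arcs \<Gamma>" for e
  proof -
    obtain g a where e: "e = (g, a, g \<cdot> s a)" "g \<in> carrier G" "a \<in> A" using \<open>e \<in> arcs \<Gamma>\<close> by (cases e) auto
    have fa: "f a \<in> carrier Q" "?\<pi> (h.F.s (f a)) = s a" using f Am e h.induced_s[of "f a"] by auto
    have cl: "h.F.s (f a) \<in> carrier ?K" "t g \<in> carrier ?K" "t (g \<cdot> s a) \<in> carrier ?K"
      "?\<pi> (t g) = g" "?\<pi> (t (g \<cdot> s a)) = g \<cdot> s a"
      using fa t[OF e(2)] t[of "g \<cdot> s a"] e Am by auto
    then have "?\<pi> (w e) = g \<cdot> s a \<cdot> inv\<^sub>G (g \<cdot> s a)" by (simp add: w_def e fa)
    then show ?thesis using cl e Am by (simp add: kernel_def w_def)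
  qed
  have w_closed: "w ` arcs \<Gamma> \<subseteq> carrier ?K" using wN by (auto simp: kernel_def)
  \<comment> \<open>Along a path the inner values of \<open>t\<close> cancel in pairs, leaving those
    at the two ends.\<close>
  have eval_w: "eval_word ?K w p = t i \<otimes>\<^bsub>?K\<^esub> ?ev p \<otimes>\<^bsub>?K\<^esub> inv\<^bsub>?K\<^esub> t j" if "gpath \<Gamma> i p j" for i p j
    using that
  proof (induction p arbitrary: i)
    case Nil
    then show ?case using t by auto
  next
    case (Cons x p)
    obtain g a h b where x: "x = ((g, a, h), b)" by (cases x) auto
    let ?k = "if b then h else g" and ?u = "h.F.s (f a)"
    have *: "(g, a, h) \<in> arcs \<Gamma>" "g \<in> carrier G" "h \<in> carrier G" "a \<in> A" "gpath \<Gamma> ?k p j" "i = (if b then g else h)"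
      "j \<in> carrier G"
      using Cons.prems D.gpath_verts[OF Cons.prems] Am by (auto simp: x)
    have cl: "t g \<in> carrier ?K" "t h \<in> carrier ?K" "t j \<in> carrier ?K" "?u \<in> carrier ?K" "?ev p \<in> carrier ?K"
      using t * f Am eval_word_closed[OF KG c_closed D.gpath_words[OF *(5)]] by auto
    have wx: "w (g, a, h) = t g \<otimes>\<^bsub>?K\<^esub> (?u \<otimes>\<^bsub>?K\<^esub> inv\<^bsub>?K\<^esub> t h)" "c (g, a, h) = ?u"
      using cl by (simp_all add: w_def c_def h.F.G.m_assoc)
    show ?case using Cons.IH[OF *(5)] cl wx *(6)
      by (cases b) (simp_all add: x h.F.G.m_assoc h.F.G.inv_mult_group h.F.G_cancel)
  qed
  \<comment> \<open>The inverse in the kernel, taken as a group of its own, is a different term from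
    the inverse in the whole group; on the kernel the two agree.\<close>
  have eval_N: "eval_word ?KN w p = eval_word ?K w p" if "p \<in> W" for p
    using that
  proof (induction p)
    case (Cons x p)
    obtain e b where x: "x = (e, b)" by fastforce
    have "inv\<^bsub>?KN\<^esub> w e = inv\<^bsub>?K\<^esub> w e" using wN Cons.prems h.F.G.m_inv_consistent[OF N] by (simp add: x)
    then show ?case using Cons by (simp add: x)
  qed simp
  \<comment> \<open>The laws hold in the kernel, so equal classes give equal values of
    \<open>w\<close>. As the two paths share their ends, the outer factors \<open>t i\<close> and
    \<open>t j\<close> cancel.\<close>
  have wd: "?ev p = ?ev q" if p: "gpath \<Gamma> i p j" and q: "gpath \<Gamma> i q j" and eq: "pc p = pc q" for i p j q
  proof -
    have pq: "p \<in> W" "q \<in> W" using D.gpath_words p q by auto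
    then have "(p, q) \<in> relfree_cong U (arcs \<Gamma>)" using eq by (simp add: word_class_eq_iff)
    then have "eval_word ?KN w p = eval_word ?KN w q"
      using wN by (intro relfree_universal[OF var]) auto
    then have "t i \<otimes>\<^bsub>?K\<^esub> ?ev p \<otimes>\<^bsub>?K\<^esub> inv\<^bsub>?K\<^esub> t j = t i \<otimes>\<^bsub>?K\<^esub> ?ev q \<otimes>\<^bsub>?K\<^esub> inv\<^bsub>?K\<^esub> t j"
      using eval_N pq eval_w p q by simp
    moreover have "t i \<in> carrier ?K" "t j \<in> carrier ?K" using t D.gpath_verts[OF p] by auto
    moreover have "?ev p \<in> carrier ?K" "?ev q \<in> carrier ?K"
      using eval_word_closed[OF KG c_closed] pq by auto
    ultimately show ?thesis by simp
  qed
  have lift: "\<exists>x\<in>carrier Q. \<phi> x = lab p \<and> h.F.s x = ?ev p" if "gpath \<Gamma> i p j" for i p j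
    using that
  proof (induction p arbitrary: i)
    case Nil
    then show ?case by (intro bexI[of _ "\<one>\<^bsub>Q\<^esub>"]) (auto simp: h.hom_one)
  next
    case (Cons x p)
    obtain g a h b where x: "x = ((g, a, h), b)" by (cases x) auto
    obtain y where y: "y \<in> carrier Q" "\<phi> y = lab p" "h.F.s y = ?ev p"
      using Cons by (auto simp: x)
    let ?z = "if b then f a else vinv Q (f a)"
    have fa: "f a \<in> carrier Q" "\<phi> (f a) = a" using f Am Cons.prems by (auto simp: x)
    then show ?case
      using y by (intro bexI[of _ "?z \<otimes>\<^bsub>Q\<^esub> y"]) (auto simp: x c_def h.hom_dag)
  qed
  \<comment> \<open>The choice of the representing path is harmless by \<open>wd\<close>.\<close>
  define \<mu> where "\<mu> = (\<lambda>(i, u, j). \<phi> (mx (?ev (SOME p. gpath \<Gamma> i p j \<and> pc p = u))))"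
  have \<mu>: "\<mu> (i, pc p, j) = \<phi> (mx (?ev p))" if p: "gpath \<Gamma> i p j" for i p j
  proof -
    let ?q = "SOME q. gpath \<Gamma> i q j \<and> pc q = pc p"
    have "gpath \<Gamma> i ?q j \<and> pc ?q = pc p" by (rule someI[of _ p]) (use p in simp)
    then show ?thesis using wd[OF _ p] by (simp add: \<mu>_def)
  qed
  have ev: "?ev p \<in> carrier ?K" if "gpath \<Gamma> i p j" for i p j
    using eval_word_closed[OF KG c_closed] D.gpath_words that by blast
  have "lax \<mu>"
    unfolding lax_def
  proof (intro conjI allI impI)
    fix i p j assume p: "gpath \<Gamma> i p j"
    show "\<mu> (i, pc p, j) \<in> carrier M" using \<mu>[OF p] mx_closed[OF ev[OF p]] by simp
    obtain x where "x \<in> carrier Q" "\<phi> x = lab p" "h.F.s x = ?ev p" using lift[OF p] by blast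
    then show "lab p \<preceq> \<mu> (i, pc p, j)"
      using \<mu>[OF p] mx_le[OF ev[OF p]] mx_closed[OF ev[OF p]] h.hom_le by metis
    fix q k assume q: "gpath \<Gamma> j q k"
    have pq: "gpath \<Gamma> i (p @ q) k" using p q by (auto simp: D.gpath_append)
    have ev_pq: "?ev (p @ q) = ?ev p \<otimes>\<^bsub>?K\<^esub> ?ev q"
      using eval_word_append[OF KG c_closed] D.gpath_words p q by blast
    \<comment> \<open>The product of two greatest elements lies in the class of the product, hence
      below its greatest element.\<close>
    have "nat_le Q (mx (?ev p) \<otimes>\<^bsub>Q\<^esub> mx (?ev q)) (mx (?ev (p @ q)))"
      using mx_closed[OF ev[OF p]] mx_closed[OF ev[OF q]] mx_s[OF ev[OF p]] mx_s[OF ev[OF q]]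
      by (intro mx_le[OF ev[OF pq]]) (auto simp: ev_pq)
    then have "nat_le M (\<phi> (mx (?ev p) \<otimes>\<^bsub>Q\<^esub> mx (?ev q))) (\<phi> (mx (?ev (p @ q))))"
      using mx_closed[OF ev[OF pq]] h.hom_le by blast
    then show "\<mu> (i, pc p, j) \<otimes> \<mu> (j, pc q, k) \<preceq> \<mu> (i, pc (p @ q), k)"
      using \<mu>[OF p] \<mu>[OF q] \<mu>[OF pq] mx_closed[OF ev[OF p]] mx_closed[OF ev[OF q]] by simp
  qed
  then show ?thesis by blast
qed

section \<open>The cover built from a dual premorphism\<close>

definition cover :: "('a edge word set \<times> 'a set \<Rightarrow> 'a) \<Rightarrow> ('a \<times> ('a edge word set \<times> 'a set)) monoid" where
  "cover \<psi> = \<lparr>carrier = {(m, u). m \<in> carrier M \<and> u \<in> carrier H \<and> m \<preceq> \<psi> u},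
     monoid.mult = (\<lambda>(m, u) (n, v). (m \<otimes> n, u \<otimes>\<^bsub>H\<^esub> v)), one = (\<one>, \<one>\<^bsub>H\<^esub>)\<rparr>"

lemma cover_simps [simp]:
  "(m, u) \<in> carrier (cover \<psi>) \<longleftrightarrow> m \<in> carrier M \<and> u \<in> carrier H \<and> m \<preceq> \<psi> u"
  "(m, u) \<otimes>\<^bsub>cover \<psi>\<^esub> (n, v) = (m \<otimes> n, u \<otimes>\<^bsub>H\<^esub> v)"
  "\<one>\<^bsub>cover \<psi>\<^esub> = (\<one>, \<one>\<^bsub>H\<^esub>)"
  by (simp_all add: cover_def)

lemma cover_of_GU:
  assumes \<psi>: "dual_premorphism H M \<psi>" and can: "canonical_on A (GU_gen M A U) id \<psi>"
    and qgen: "quasi_generated M A"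
  shows "has_F_inverse_cover_via TYPE('a \<times> ('a edge word set \<times> 'a set)) M U"
proof -
  let ?C = "cover \<psi>"
  have \<psi>_closed: "\<psi> u \<in> carrier M" if "u \<in> carrier H" for u using \<psi> that by (auto simp: dual_premorphism_def)
  have \<psi>_one: "\<psi> \<one>\<^bsub>H\<^esub> = \<one>" using \<psi> by (simp add: dual_premorphism_def)
  have \<psi>_inv: "\<psi> (inv\<^bsub>H\<^esub> u) = (\<psi> u)\<dagger>" if "u \<in> carrier H" for u
    using \<psi> that unfolding group_vinv[OF GU_group that, symmetric] by (simp add: dual_premorphism_def)
  have \<psi>_mult: "\<psi> u \<otimes> \<psi> v \<preceq> \<psi> (u \<otimes>\<^bsub>H\<^esub> v)" if "u \<in> carrier H" "v \<in> carrier H" for u v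
    using \<psi> that by (simp add: dual_premorphism_def)
  \<comment> \<open>The defining inequality of a dual premorphism is what makes the carrier closed
    under products.\<close>
  have mult_le: "m \<otimes> n \<preceq> \<psi> (u \<otimes>\<^bsub>H\<^esub> v)"
    if "u \<in> carrier H" "v \<in> carrier H" "m \<preceq> \<psi> u" "n \<preceq> \<psi> v" for m n u v
    using le_trans[OF le_mult \<psi>_mult] that \<psi>_closed by blast
  have inv_le: "m\<dagger> \<preceq> \<psi> (inv\<^bsub>H\<^esub> u)" if "u \<in> carrier H" "m \<preceq> \<psi> u" for m u
    using le_dag that \<psi>_closed \<psi>_inv by simp
  have "monoid ?C"
    by unfold_locales (auto simp: m_assoc H.m_assoc \<psi>_one intro: mult_le)
  moreover have "\<exists>!b. b \<in> carrier ?C \<and> a \<otimes>\<^bsub>?C\<^esub> b \<otimes>\<^bsub>?C\<^esub> a = a \<and> b \<otimes>\<^bsub>?C\<^esub> a \<otimes>\<^bsub>?C\<^esub> b = b"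
    if a: "a \<in> carrier ?C" for a
  proof -
    obtain m u where mu: "a = (m, u)" "m \<in> carrier M" "u \<in> carrier H" "m \<preceq> \<psi> u" using a by (cases a) auto
    show ?thesis
    proof (rule ex1I[of _ "(m\<dagger>, inv\<^bsub>H\<^esub> u)"])
      show "(m\<dagger>, inv\<^bsub>H\<^esub> u) \<in> carrier ?C \<and> a \<otimes>\<^bsub>?C\<^esub> (m\<dagger>, inv\<^bsub>H\<^esub> u) \<otimes>\<^bsub>?C\<^esub> a = a \<and>
          (m\<dagger>, inv\<^bsub>H\<^esub> u) \<otimes>\<^bsub>?C\<^esub> a \<otimes>\<^bsub>?C\<^esub> (m\<dagger>, inv\<^bsub>H\<^esub> u) = (m\<dagger>, inv\<^bsub>H\<^esub> u)"
        using mu inv_le by (simp add: m_assoc)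
      fix b assume b: "b \<in> carrier ?C \<and> a \<otimes>\<^bsub>?C\<^esub> b \<otimes>\<^bsub>?C\<^esub> a = a \<and> b \<otimes>\<^bsub>?C\<^esub> a \<otimes>\<^bsub>?C\<^esub> b = b"
      obtain n v where nv: "b = (n, v)" by (cases b)
      have "m\<dagger> = n" using b mu nv by (intro dag_eqI) (auto simp: m_assoc)
      moreover have "v = inv\<^bsub>H\<^esub> u" using b mu nv by (intro group_vinv_unique[OF GU_group]) auto
      ultimately show "b = (m\<dagger>, inv\<^bsub>H\<^esub> u)" using nv by simp
    qed
  qed
  ultimately have Cinv: "inverse_monoid ?C" by (simp add: inverse_monoid_def)
  interpret h: inv_monoid_hom ?C M fst
    by (unfold_locales) (auto simp: Cinv hom_def)
  \<comment> \<open>The second component is an idempotent of a group, hence trivial, so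
    \<open>fst\<close> separates idempotents.\<close>
  have idem: "(e, u) \<in> idem ?C \<longleftrightarrow> e \<in> E \<and> u = \<one>\<^bsub>H\<^esub>" for e u
  proof
    assume "(e, u) \<in> idem ?C"
    then have "e \<in> carrier M" "e \<otimes> e = e" "u \<in> carrier H" "u \<otimes>\<^bsub>H\<^esub> u = u" unfolding idem_def by auto
    then show "e \<in> E \<and> u = \<one>\<^bsub>H\<^esub>" by (auto intro: idemI)
  next
    assume "e \<in> E \<and> u = \<one>\<^bsub>H\<^esub>"
    then show "(e, u) \<in> idem ?C" by (intro h.F.idemI) (auto simp: \<psi>_one idem_le_one)
  qed
  have le: "nat_le ?C (m, u) (n, v) \<longleftrightarrow> u = v \<and> m \<preceq> n" if nv: "(n, v) \<in> carrier ?C" for m u n v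
  proof
    assume "nat_le ?C (m, u) (n, v)"
    then obtain x where x: "x \<in> idem ?C" "(m, u) = x \<otimes>\<^bsub>?C\<^esub> (n, v)" unfolding nat_le_def ..
    obtain e w where ew: "x = (e, w)" by (cases x)
    then have "e \<in> E" "w = \<one>\<^bsub>H\<^esub>" using x(1) idem by simp_all
    then show "u = v \<and> m \<preceq> n" using x(2) ew nv leI[of e m n] by simp
  next
    assume uv: "u = v \<and> m \<preceq> n"
    then obtain e where "e \<in> E" "m = e \<otimes> n" by (auto simp: nat_le_def)
    then show "nat_le ?C (m, u) (n, v)"
      using uv idem nv by (intro h.F.leI[of "(e, \<one>\<^bsub>H\<^esub>)"]) simp_all
  qed
  \<comment> \<open>Elements over the same \<open>u\<close> have first components below
    \<open>\<psi> u\<close>, hence \<sigma>-related in \<open>M\<close>; a common lower bound of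
    these gives one over \<open>u\<close>. So the \<sigma>-classes of the cover correspond to the
    elements of \<open>G\<^sup>U\<close>.\<close>
  have s_iff: "h.F.s (m, u) = h.F.s (n, v) \<longleftrightarrow> u = v"
    if mn: "(m, u) \<in> carrier ?C" "(n, v) \<in> carrier ?C" for m u n v
  proof
    assume "h.F.s (m, u) = h.F.s (n, v)"
    then obtain z where "nat_le ?C z (m, u)" "nat_le ?C z (n, v)" using h.F.s_eq_iff mn by blast
    then show "u = v" using le mn by (cases z) auto
  next
    assume uv: "u = v"
    have "s m = s n" using mn uv s_le \<psi>_closed by (metis cover_simps(1))
    then obtain k where "k \<preceq> m" "k \<preceq> n" using mn s_eq_iff by auto
    then have "nat_le ?C (k, u) (m, u)" "nat_le ?C (k, u) (n, v)" using le mn uv by auto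
    then show "h.F.s (m, u) = h.F.s (n, v)" using h.F.s_eq_iff mn by blast
  qed
  have top: "(\<psi> u, u) \<in> carrier ?C" if "u \<in> carrier H" for u using \<psi>_closed that by simp
  have "F_inverse ?C"
    unfolding F_inverse_def
  proof (intro conjI ballI Cinv)
    fix K assume "K \<in> carrier ?C // sigma ?C"
    then obtain x where x: "x \<in> carrier ?C" "K = h.F.s x" by (auto simp: quotient_def)
    obtain m u where mu: "x = (m, u)" by (cases x)
    have u: "u \<in> carrier H" using x mu by simp
    show "\<exists>m\<in>K. \<forall>a\<in>K. nat_le ?C a m"
    proof (intro bexI[of _ "(\<psi> u, u)"] ballI)
      show "(\<psi> u, u) \<in> K" using h.mem_F_s[OF x(1)] top[OF u] s_iff x mu by simp
      fix a assume "a \<in> K"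
      then have a: "a \<in> carrier ?C" "h.F.s a = h.F.s x" using h.mem_F_s[OF x(1)] x(2) by auto
      obtain n v where nv: "a = (n, v)" by (cases a)
      then have "v = u" using a s_iff x mu by simp
      then show "nat_le ?C a (\<psi> u, u)" using le[OF top[OF u]] a nv by simp
    qed
  qed
  moreover have "fst ` carrier ?C = carrier M"
  proof (intro equalityI subsetI)
    fix m assume "m \<in> carrier M"
    then have "m \<in> inv_gen M (A \<union> idem M)" using qgen by (simp add: quasi_generated_def)
    \<comment> \<open>Elements of \<open>A\<close> are lifted by canonicity, idempotents over the
      identity of \<open>H\<close>, and products and inverses componentwise.\<close>
    then have "\<exists>u. (m, u) \<in> carrier ?C"
    proof (induction)
      case one
      show ?case using h.F.one_closed unfolding cover_simps(3) by blast
    next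
      case (incl m)
      then show ?case
      proof
        assume a: "m \<in> A"
        then have m: "m \<in> carrier M" using C_sub by auto
        have "gpath \<Gamma> \<one>\<^sub>G [(base_edge M m, True)] (s m)" using a m by (simp add: base_edge_def)
        then have "GU_gen M A U m \<in> carrier H" unfolding GU_gen_def by (rule GU_carrierI)
        moreover have "\<psi> (GU_gen M A U m) = m" using can a by (simp add: canonical_on_def)
        ultimately show ?thesis using top by metis
      next
        assume "m \<in> idem M"
        then show ?thesis using idem h.F.idem_carrier by blast
      qed
    next
      case (mult a b)
      then obtain u v where "(a, u) \<in> carrier ?C" "(b, v) \<in> carrier ?C" by blast
      from h.F.m_closed[OF this] show ?case unfolding cover_simps(2) by blast
    next
      case (inverse a)
      then obtain u where "(a, u) \<in> carrier ?C" by blast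
      then have "(a\<dagger>, inv\<^bsub>H\<^esub> u) \<in> carrier ?C" using inv_le by simp
      then show ?case by blast
    qed
    then obtain u where "(m, u) \<in> carrier ?C" ..
    then show "m \<in> fst ` carrier ?C" by (rule image_eqI[rotated]) simp
  qed auto
  moreover have "inj_on fst (idem ?C)"
  proof (rule inj_onI)
    have snd: "snd x = \<one>\<^bsub>H\<^esub>" if "x \<in> idem ?C" for x
      using idem[of "fst x" "snd x"] that by simp
    fix x y assume "x \<in> idem ?C" "y \<in> idem ?C" "fst x = fst y"
    then show "x = y" using snd[of x] snd[of y] by (simp add: prod_eq_iff)
  qed
  ultimately have "F_inverse_cover ?C M fst"
    using h.hom h.hom_one by (simp add: F_inverse_cover_def)
  moreover have "in_variety U ((max_group ?C)\<lparr>carrier := kernel (max_group ?C) G (induced_hom M fst)\<rparr>)"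
  proof -
    let ?K = "max_group ?C"
    let ?N = "kernel ?K G (induced_hom M fst)"
    \<comment> \<open>\<open>m\<close>, \<open>\<psi> u\<close> and the label of a path for
      \<open>u\<close> share one \<sigma>-class, which is the group component \<open>g\<close> of
      \<open>u\<close>; membership in the kernel makes it trivial.\<close>
    have N: "\<exists>m p. k = h.F.s (m, (pc p, \<one>\<^sub>G)) \<and> (m, (pc p, \<one>\<^sub>G)) \<in> carrier ?C \<and> p \<in> W"
      if k: "k \<in> ?N" for k
    proof -
      have "k \<in> carrier ?K" "induced_hom M fst k = \<one>\<^sub>G" using k by (auto simp: kernel_def)
      then obtain x where x: "x \<in> carrier ?C" "k = h.F.s x" using h.F.G_carrier by blast
      obtain m u where mu: "x = (m, u)" by (cases x)
      then obtain p g where p: "gpath \<Gamma> \<one>\<^sub>G p g" "u = (pc p, g)" using x GU_carrier by auto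
      have m: "m \<in> carrier M" "m \<preceq> \<psi> u" "u \<in> carrier H" using x mu by auto
      have "s m = s (\<psi> u)" using s_le m \<psi>_closed by blast
      also have "\<dots> = s (lab p)"
        using s_le[OF GU_label_le[OF \<psi> can p(1)]] \<psi>_closed m p by simp
      also have "\<dots> = g" using end_eq[OF p(1)] p(1) by simp
      finally have "g = \<one>\<^sub>G"
        using \<open>induced_hom M fst k = _\<close> h.induced_s[OF x(1)] x mu by simp
      then show ?thesis using x mu p D.gpath_words by blast
    qed
    \<comment> \<open>A kernel class is determined by its component in the relatively free group, so
      \<theta> embeds the kernel there and the laws of \<open>U\<close> are inherited.\<close>
    define \<theta> where "\<theta> k = (THE c. \<exists>m. k = h.F.s (m, (c, \<one>\<^sub>G)) \<and> (m, (c, \<one>\<^sub>G)) \<in> carrier ?C)" for k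
    have \<theta>: "\<theta> (h.F.s (m, (c, \<one>\<^sub>G))) = c" if "(m, (c, \<one>\<^sub>G)) \<in> carrier ?C" for m c
      unfolding \<theta>_def using that s_iff by (intro the_equality) blast+
    show ?thesis
    proof (rule in_variety_inj[OF relfree_in_variety])
      show "group (?K\<lparr>carrier := ?N\<rparr>)"
        using h.F.G.subgroup_imp_group h.induced.subgroup_kernel by blast
      show "\<theta> \<in> hom (?K\<lparr>carrier := ?N\<rparr>) R"
      proof (rule homI)
        fix k assume "k \<in> carrier (?K\<lparr>carrier := ?N\<rparr>)"
        then have "k \<in> ?N" by simp
        from N[OF this] obtain m p where
          k: "k = h.F.s (m, (pc p, \<one>\<^sub>G))" "(m, (pc p, \<one>\<^sub>G)) \<in> carrier ?C" "p \<in> W" by blast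
        then show "\<theta> k \<in> carrier R" using \<theta>[OF k(2)] by simp
        fix l assume "l \<in> carrier (?K\<lparr>carrier := ?N\<rparr>)"
        then have "l \<in> ?N" by simp
        from N[OF this] obtain n q where
          l: "l = h.F.s (n, (pc q, \<one>\<^sub>G))" "(n, (pc q, \<one>\<^sub>G)) \<in> carrier ?C" "q \<in> W" by blast
        have "(m, (pc p, \<one>\<^sub>G)) \<otimes>\<^bsub>?C\<^esub> (n, (pc q, \<one>\<^sub>G)) = (m \<otimes> n, (pc (p @ q), \<one>\<^sub>G))"
          using k(3) l(3) by (simp add: GU_mult)
        then have "k \<otimes>\<^bsub>?K\<^esub> l = h.F.s (m \<otimes> n, (pc (p @ q), \<one>\<^sub>G))"
          "(m \<otimes> n, (pc (p @ q), \<one>\<^sub>G)) \<in> carrier ?C"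
          using h.F.s_mult[OF k(2) l(2)] h.F.m_closed[OF k(2) l(2)] k(1) l(1) by simp_all
        then show "\<theta> (k \<otimes>\<^bsub>?K\<lparr>carrier := ?N\<rparr>\<^esub> l) = \<theta> k \<otimes>\<^bsub>R\<^esub> \<theta> l"
          using \<theta> k l by simp
      qed
      show "inj_on \<theta> (carrier (?K\<lparr>carrier := ?N\<rparr>))"
      proof (rule inj_onI)
        fix k l assume "k \<in> carrier (?K\<lparr>carrier := ?N\<rparr>)" "l \<in> carrier (?K\<lparr>carrier := ?N\<rparr>)" and eq: "\<theta> k = \<theta> l"
        then have "k \<in> ?N" "l \<in> ?N" by simp_all
        from N[OF this(1)] N[OF this(2)] obtain m p n q
          where k: "k = h.F.s (m, (pc p, \<one>\<^sub>G))" "(m, (pc p, \<one>\<^sub>G)) \<in> carrier ?C"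
            and l: "l = h.F.s (n, (pc q, \<one>\<^sub>G))" "(n, (pc q, \<one>\<^sub>G)) \<in> carrier ?C" by blast
        have "pc p = pc q" using \<theta>[OF k(2)] \<theta>[OF l(2)] eq unfolding k(1) l(1) by simp
        then show "k = l" using s_iff[OF k(2) l(2)] unfolding k(1) l(1) by simp
      qed
    qed
  qed
  ultimately show ?thesis unfolding has_F_inverse_cover_via_def by blast
qed

end

theorem theorem3p19:
  fixes M :: "'m monoid" and A I :: "'m set" and U :: laws
  assumes "inverse_monoid M" and "finite_above M" and "E_unitary M"
    and "A \<subseteq> max_minus M" and "quasi_generated M A"
    and "I \<subseteq> idem M" and "inv_gen M (A \<union> I) = carrier M"
  shows
    "(has_F_inverse_cover_via TYPE('f) M U \<longrightarrow>
      has_F_inverse_cover_via TYPE('m \<times> ('m edge word set \<times> 'm set)) M U) \<and>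
     (has_F_inverse_cover_via TYPE('m \<times> ('m edge word set \<times> 'm set)) M U \<longleftrightarrow>
      (\<exists>\<psi>. dual_premorphism (GU M A U) M \<psi> \<and> canonical_on A (GU_gen M A U) id \<psi>)) \<and>
     ((\<exists>\<psi>. dual_premorphism (GU M A U) M \<psi> \<and> canonical_on A (GU_gen M A U) id \<psi>) \<longleftrightarrow>
      (\<exists>\<psi>. dual_premorphism (GU M A U) (XclG M (A \<union> I)) \<psi> \<and>
         canonical_on A (GU_gen M A U) (XclG_gen M (A \<union> I)) \<psi>)) \<and>
     ((\<exists>\<psi>. dual_premorphism (GU M A U) (XclG M (A \<union> I)) \<psi> \<and>
         canonical_on A (GU_gen M A U) (XclG_gen M (A \<union> I)) \<psi>) \<longleftrightarrow>
      (\<exists>\<psi>. cat_dual_premorphism (Fg M A U) (Xcl M (A \<union> I)) \<psi> \<and>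
         cat_canonical (cayley M A) (Fg_gen M A U) (Xcl_gen M (A \<union> I)) \<psi>)) \<and>
     ((\<exists>\<psi>. cat_dual_premorphism (Fg M A U) (Xcl M (A \<union> I)) \<psi> \<and>
         cat_canonical (cayley M A) (Fg_gen M A U) (Xcl_gen M (A \<union> I)) \<psi>) \<longleftrightarrow>
      (\<forall>x\<in>arcs (Fg M A U). \<forall>n. head (Fg M A U) x \<in> fst (Pcl M A I U n x)))"
proof -
  interpret inv_monoid M by unfold_locales (rule assms(1))
  have sub: "A \<union> I \<subseteq> carrier M" using assms(4,6) unfolding max_minus_def idem_def by blast
  interpret quasi_generated_setup M A I U
    by unfold_locales (use assms sub in auto)
  let ?one = "has_F_inverse_cover_via TYPE('m \<times> ('m edge word set \<times> 'm set)) M U"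
  let ?two = "\<exists>\<psi>. dual_premorphism (GU M A U) M \<psi> \<and> canonical_on A (GU_gen M A U) id \<psi>"
  let ?lax = "\<exists>\<mu>. L.lax \<mu>"
  \<comment> \<open>\<open>lax_of_cover\<close> allows any type for the cover; the detour through
    \<open>?lax\<close> therefore replaces a cover of any type by one of the fixed type.\<close>
  have 1: "has_F_inverse_cover_via TYPE('f) M U \<longrightarrow> ?lax" "?one \<longrightarrow> ?lax"
    using L.lax_of_cover by blast+
  have 2: "?lax \<longleftrightarrow> ?two"
    using L.GU_of_lax[OF eunitary_axioms fin_above A_max] L.lax_of_GU by blast
  have 21: "?two \<longrightarrow> ?one"
    using L.cover_of_GU assms(5) by blast
  have 3: "?two \<longleftrightarrow>
      (\<exists>\<psi>. dual_premorphism (GU M A U) (XclG M (A \<union> I)) \<psi> \<and>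
         canonical_on A (GU_gen M A U) (XclG_gen M (A \<union> I)) \<psi>)"
    by (rule premorphism_XclG_iff) simp
  have 4: "?lax \<longleftrightarrow> (\<exists>\<psi>. cat_dual_premorphism (Fg M A U) (Xcl M (A \<union> I)) \<psi> \<and>
         cat_canonical (cayley M A) (Fg_gen M A U) (Xcl_gen M (A \<union> I)) \<psi>)"
    using Xcl_of_lax lax_of_Xcl by blast
  have 5: "?lax \<longleftrightarrow> (\<forall>x\<in>arcs (Fg M A U). \<forall>n. head (Fg M A U) x \<in> fst (Pcl M A I U n x))"
    using Pcl_of_lax lax_of_Pcl by blast
  show ?thesis using 1 2 21 3 4 5 by blast
qed

end
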